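(* Let $1<p<\infty$. The algebra $N^p$ has the Corona Property; that is, for every $n\ge 1$ and all $f_1,\ldots,f_n\in N^p$, the ideal of $N^p$ generated by $f_1,\ldots,f_n$ equals $N^p$ if and only if there is an invertible element $f$ of $N^p$ such that $$|f(z)|\le\sum_{i=1}^n|f_i(z)|\quad\text{for all } z\in D.$$
   Context: $D$ is the open unit disk in $\mathbb{C}$. For $1<p<\infty$, $N^p$ is the algebra (under pointwise operations) of holomorphic $f$ on $D$ with $\sup_{0<r<1}\int_0^{2\pi}\big(\log^+|f(re^{i\theta})|\big)^p\,\frac{d\theta}{2\pi}<\infty$, where $\log^+ x=\max(\log x,0)$ for $x\ge 0$ (so $\log^+0=0$). *)

theory Defs
  imports "HOL-Complex_Analysis.Complex_Analysis" "HOL-Algebra.Algebra"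
begin

abbreviation unit_disc :: "complex set" where
  "unit_disc \<equiv> ball 0 1"

(* ln 0 = 0 in HOL, so log_plus 0 = 0. *)
definition log_plus :: "real \<Rightarrow> real" where
  "log_plus x = max (ln x) 0"

(* Functions on the disc are represented by total functions that are undefined
   outside it, so that HOL equality of elements is equality on the disc.
   For holomorphic f the integrand is continuous, so each integral exists and
   bdd_above says exactly that the supremum over 0 < r < 1 is finite. *)
definition Np_carrier :: "real \<Rightarrow> (complex \<Rightarrow> complex) set" where
  "Np_carrier p = {f \<in> extensional unit_disc. f holomorphic_on unit_disc \<and>
     bdd_above ((\<lambda>r. integral {0..2*pi}
        (\<lambda>\<theta>. log_plus (norm (f (of_real r * cis \<theta>))) powr p / (2*pi))) ` {0<..<1})}"

definition Np :: "real \<Rightarrow> (complex \<Rightarrow> complex) ring" where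
  "Np p = \<lparr>carrier = Np_carrier p,
           monoid.mult = (\<lambda>f g. \<lambda>z\<in>unit_disc. f z * g z),
           monoid.one = (\<lambda>z\<in>unit_disc. 1),
           ring.zero = (\<lambda>z\<in>unit_disc. 0),
           ring.add = (\<lambda>f g. \<lambda>z\<in>unit_disc. f z + g z)\<rparr>"

end

theory Submission
  imports Defs "Jordan_Normal_Form.Determinant"
begin

text \<open>
  Dividing by outer functions that are units of \<open>N\<^sup>p\<close>, one may assume that the \<open>f\<^sub>i\<close> are replaced by
  bounded functions \<open>h\<^sub>i\<close> with \<open>\<bar>\<delta>\<bar>\<^sup>2 \<le> \<Sum> \<bar>h\<^sub>i\<bar>\<^sup>2\<close> for a unit \<open>\<delta>\<close>. It then suffices to solve
  \<open>\<Sum> h\<^sub>i G\<^sub>i = \<delta>\<^sup>6\<close> with \<open>G\<^sub>i\<close> in the Hardy space \<open>H\<^sup>2\<close>, which lies in \<open>N\<^sup>p\<close>; the power of \<open>\<delta>\<close>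
  absorbs the losses of Wolff's argument.

  By duality in \<open>H\<^sup>2\<close>, solvability with a norm bound amounts to the inequality
  \<open>\<bar>\<langle>\<delta>\<^sup>6, k\<rangle>\<bar> \<le> C \<parallel>v\<parallel>\<close> for polynomials \<open>k\<close>, where \<open>v\<^sub>i\<close> is the analytic part of the boundary function
  \<open>cnj h\<^sub>i k = v\<^sub>i + cnj K\<^sub>i\<close>, i.e. \<open>v\<close> is the image of \<open>k\<close> under the adjoint of \<open>(G\<^sub>i) \<mapsto> \<Sum> h\<^sub>i G\<^sub>i\<close>.
  With the smooth solution \<open>\<phi>\<^sub>i = cnj h\<^sub>i / \<Sum> \<bar>h\<^sub>j\<bar>\<^sup>2\<close> of \<open>\<Sum> h\<^sub>i \<phi>\<^sub>i = 1\<close>, the pairing is a harmless term plus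
  the circle integral of \<open>\<Sum> K\<^sub>i \<phi>\<^sub>i \<delta>\<^sup>6\<close>. Green's formula turns this into an area integral, and the Koszul
  antisymmetry leaves only the holomorphic functions \<open>K\<^sub>i h\<^sub>j - K\<^sub>j h\<^sub>i\<close>, whose boundary values
  \<open>cnj v\<^sub>j h\<^sub>i - cnj v\<^sub>i h\<^sub>j\<close> are controlled by \<open>v\<close>. The Littlewood-Paley inequality finishes the estimate.
  The argument is run for dilated functions and modulo \<open>z\<^sup>N\<close>, where the dual problem is a
  finite linear system; Montel's theorem yields the limit.

  The outer divisor of \<open>g\<close> is a limit of functions \<open>exp (- P)\<close>, where \<open>Re P\<close> is a trigonometric polynomial
  approximating \<open>log\<^sup>+ \<bar>g\<bar>\<close> from above on a circle.
\<close>

text \<open>The lower bound at hand is a function \<open>\<delta>\<close>, not a constant, so a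
  bounded solution is not aimed at: powers of a unit can be divided out at the end, and mean-square
  growth is harmless for logarithmic means. The exponent 6 comes from the mixed derivative of the
  pairing, where the square sum \<open>s\<close> occurs to the power -3 while only |\<delta>|^2
  \<le> s is known. The obstacle in the dual inequality is that the coanalytic part \<open>K\<close>
  is not controlled by \<open>v\<close>. On the circle \<open>k\<close> cancels from the
  antisymmetric combinations of \<open>K\<close> and \<open>h\<close>, and these are all that one
  cnj z derivative leaves, because the numerator of the quotient rule is a sum of 2 by 2 minors.
  Dilation turns boundary values into ordinary values of functions holomorphic past the circle.
  Truncation makes uniqueness imply existence, with a norm bound that does not depend on N. For the
  divisors, \<open>Re P\<close> need only be bounded in p-th mean, and subharmonicity of its p-th
  power carries that bound from one circle to all smaller ones.\<close>

section \<open>Wirtinger derivatives and Green's formula\<close>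

text \<open>Not normalised: \<open>cmean f r\<close> is \<open>2 * pi\<close> times the mean value of \<open>f\<close>.\<close>

definition cmean :: "(complex \<Rightarrow> 'a::banach) \<Rightarrow> real \<Rightarrow> 'a" where
  "cmean f r = integral {0..2*pi} (\<lambda>t. f (of_real r * cis t))"

text \<open>\<open>a\<close> and \<open>b\<close> are the derivatives with respect to z and cnj z.
  Second order enters by chaining: given \<open>wirtinger_on S f a b\<close> and
  \<open>wirtinger_on S b c e\<close>, the function 4 c plays the role of the Laplacian of
  \<open>f\<close>.\<close>

definition wirtinger_on ::
    "complex set \<Rightarrow> (complex \<Rightarrow> complex) \<Rightarrow> (complex \<Rightarrow> complex) \<Rightarrow> (complex \<Rightarrow> complex) \<Rightarrow> bool" where
  "wirtinger_on S f a b \<longleftrightarrow> continuous_on S a \<and> continuous_on S b \<and>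
     (\<forall>z\<in>S. (f has_derivative (\<lambda>w. a z * w + b z * cnj w)) (at z))"

lemma wirtinger_on_imp_continuous_on:
  assumes "wirtinger_on S f a b"
  shows "continuous_on S f"
  using assms unfolding wirtinger_on_def
  by (meson continuous_at_imp_continuous_on has_derivative_continuous)

lemma wirtinger_on_add:
  assumes "wirtinger_on S f a b" "wirtinger_on S g c d"
  shows "wirtinger_on S (\<lambda>z. f z + g z) (\<lambda>z. a z + c z) (\<lambda>z. b z + d z)"
  using assms unfolding wirtinger_on_def
  by (auto intro!: continuous_intros derivative_eq_intros simp: algebra_simps)

lemma wirtinger_on_const: "wirtinger_on S (\<lambda>z. c) (\<lambda>z. 0) (\<lambda>z. 0)"
  unfolding wirtinger_on_def by auto

lemma wirtinger_on_sum:
  assumes "\<And>i. i \<in> I \<Longrightarrow> wirtinger_on S (f i) (a i) (b i)"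
  shows "wirtinger_on S (\<lambda>z. \<Sum>i\<in>I. f i z) (\<lambda>z. \<Sum>i\<in>I. a i z) (\<lambda>z. \<Sum>i\<in>I. b i z)"
  using assms
proof (induction I rule: infinite_finite_induct)
  case (insert x F)
  then show ?case using wirtinger_on_add[of S "f x" "a x" "b x"] by simp
qed (simp_all add: wirtinger_on_const)

lemma wirtinger_on_mult:
  assumes "wirtinger_on S f a b" "wirtinger_on S g c d"
  shows "wirtinger_on S (\<lambda>z. f z * g z) (\<lambda>z. a z * g z + f z * c z) (\<lambda>z. b z * g z + f z * d z)"
proof -
  have "continuous_on S f" "continuous_on S g"
    using assms wirtinger_on_imp_continuous_on by blast+
  with assms show ?thesis unfolding wirtinger_on_def
    by (auto intro!: continuous_intros derivative_eq_intros simp: algebra_simps)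
qed

lemma wirtinger_on_inverse:
  assumes "wirtinger_on S f a b" "\<And>z. z \<in> S \<Longrightarrow> f z \<noteq> 0"
  shows "wirtinger_on S (\<lambda>z. inverse (f z)) (\<lambda>z. - a z / (f z)\<^sup>2) (\<lambda>z. - b z / (f z)\<^sup>2)"
proof -
  have "continuous_on S f"
    using assms wirtinger_on_imp_continuous_on by blast+
  with assms show ?thesis unfolding wirtinger_on_def
    by (auto intro!: continuous_intros derivative_eq_intros
        simp: field_simps power2_eq_square)
qed

lemma wirtinger_on_holomorphic:
  assumes "f holomorphic_on S" "open S"
  shows "wirtinger_on S f (deriv f) (\<lambda>z. 0)"
  unfolding wirtinger_on_def
  using holomorphic_derivI[OF assms] holomorphic_on_imp_continuous_on[OF holomorphic_deriv[OF assms]]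
  by (auto simp: has_field_derivative_def)

lemma wirtinger_on_cnj_holomorphic:
  assumes "f holomorphic_on S" "open S"
  shows "wirtinger_on S (\<lambda>z. cnj (f z)) (\<lambda>z. 0) (\<lambda>z. cnj (deriv f z))"
proof -
  have "((\<lambda>z. cnj (f z)) has_derivative (\<lambda>w. cnj (deriv f z * w))) (at z)" if "z \<in> S" for z
    using holomorphic_derivI[OF assms that]
    by (intro has_derivative_cnj) (auto simp: has_field_derivative_def)
  then show ?thesis unfolding wirtinger_on_def
    using holomorphic_on_imp_continuous_on[OF holomorphic_deriv[OF assms]]
    by (auto intro!: continuous_intros)
qed

lemma wirtinger_on_cong:
  assumes "wirtinger_on S f a b" "open S" "\<And>z. z \<in> S \<Longrightarrow> f z = g z"
    "\<And>z. z \<in> S \<Longrightarrow> a z = c z" "\<And>z. z \<in> S \<Longrightarrow> b z = d z"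
  shows "wirtinger_on S g c d"
  unfolding wirtinger_on_def
proof (intro conjI ballI)
  show "continuous_on S c" "continuous_on S d"
    using assms(1,4,5) by (auto simp: wirtinger_on_def cong: continuous_on_cong_simp)
  fix z assume z: "z \<in> S"
  have "(f has_derivative (\<lambda>w. a z * w + b z * cnj w)) (at z)"
    using assms z unfolding wirtinger_on_def by blast
  then have "(g has_derivative (\<lambda>w. a z * w + b z * cnj w)) (at z)"
    by (rule has_derivative_transform_within_open[OF _ \<open>open S\<close> z]) (use assms in auto)
  then show "(g has_derivative (\<lambda>w. c z * w + d z * cnj w)) (at z)"
    using assms z by simp
qed

lemma norm_of_real_cis [simp]: "norm (of_real r * cis t) = \<bar>r\<bar>"
  by (simp add: norm_mult)

lemma continuous_on_polar:
  fixes F :: "complex \<Rightarrow> 'a::topological_space"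
  assumes "continuous_on S F" "\<And>r t. r \<in> I \<Longrightarrow> of_real r * cis t \<in> S"
  shows "continuous_on (I \<times> J) (\<lambda>(r, t). F (of_real r * cis t))"
  unfolding case_prod_beta
  by (rule continuous_on_compose2[OF assms(1)]) (use assms in \<open>auto intro!: continuous_intros\<close>)

lemma continuous_on_circle:
  fixes F :: "complex \<Rightarrow> 'a::topological_space"
  assumes "continuous_on S F" "\<And>t. of_real r * cis t \<in> S"
  shows "continuous_on J (\<lambda>t. F (of_real r * cis t))"
  by (rule continuous_on_compose2[OF assms(1)]) (use assms in \<open>auto intro!: continuous_intros\<close>)

lemma integrable_circle:
  fixes F :: "complex \<Rightarrow> 'a::banach"
  assumes "continuous_on S F" "\<And>t. of_real r * cis t \<in> S"
  shows "(\<lambda>t. F (of_real r * cis t)) integrable_on {0..2*pi}"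
  by (intro integrable_continuous_real continuous_on_circle[OF assms])

lemma continuous_on_cmean:
  fixes F :: "complex \<Rightarrow> 'a::banach"
  assumes "continuous_on S F" "\<And>r t. r \<in> I \<Longrightarrow> of_real r * cis t \<in> S"
  shows "continuous_on I (cmean F)"
  unfolding cmean_def
  using integral_continuous_on_param[OF continuous_on_polar[OF assms, where J="cbox 0 (2*pi)"]]
  by simp

text \<open>The derivative along the circle is i (a z - b cnj z) and integrates to zero over a full
  turn. Hence the two means agree, and the mean of the radial derivative (a z + b cnj z) / r can be
  expressed by either of them.\<close>

lemma cmean_deriv:
  assumes "wirtinger_on (ball 0 R) f a b" "r \<in> {0<..<R}"
  shows "(cmean f has_vector_derivative cmean (\<lambda>z. 2 * (a z * z)) r /\<^sub>R r) (at r)"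
    and "cmean (\<lambda>z. b z * cnj z) r = cmean (\<lambda>z. a z * z) r"
proof -
  have cont: "continuous_on (ball 0 R) a" "continuous_on (ball 0 R) b" "continuous_on (ball 0 R) f"
    and der: "\<And>z. z \<in> ball 0 R \<Longrightarrow> (f has_derivative (\<lambda>w. a z * w + b z * cnj w)) (at z)"
    using assms wirtinger_on_imp_continuous_on unfolding wirtinger_on_def by blast+
  have r: "of_real r * cis t \<in> ball 0 R" for t using assms by auto
  have int1: "(\<lambda>t. a (of_real r * cis t) * (of_real r * cis t)) integrable_on {0..2*pi}"
    by (rule integrable_circle[where S="ball 0 R", of "\<lambda>z. a z * z"]) (use r cont in \<open>auto intro!: continuous_intros\<close>)
  have int2: "(\<lambda>t. b (of_real r * cis t) * cnj (of_real r * cis t)) integrable_on {0..2*pi}"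
    by (rule integrable_circle[where S="ball 0 R", of "\<lambda>z. b z * cnj z"]) (use r cont in \<open>auto intro!: continuous_intros\<close>)
  have "((\<lambda>t. f (of_real r * cis t)) has_vector_derivative
      (a (of_real r * cis t) * (\<i> * (of_real r * cis t)) + b (of_real r * cis t) * cnj (\<i> * (of_real r * cis t)))) (at t)" for t
  proof -
    have *: "((\<lambda>t. of_real r * cis t) has_vector_derivative (\<i> * (of_real r * cis t))) (at t)"
      by (auto intro!: derivative_eq_intros simp: has_vector_derivative_def scaleR_conv_of_real)
    show ?thesis
      using has_derivative_compose[OF *[unfolded has_vector_derivative_def] der[OF r]]
      unfolding has_vector_derivative_def
      by (simp add: scaleR_conv_of_real distrib_left right_diff_distrib mult.left_commute)
  qed
  then have "((\<lambda>t. a (of_real r * cis t) * (\<i> * (of_real r * cis t)) + b (of_real r * cis t) * cnj (\<i> * (of_real r * cis t)))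
     has_integral f (of_real r * cis (2*pi)) - f (of_real r * cis 0)) {0..2*pi}"
    by (intro fundamental_theorem_of_calculus) (auto intro: has_vector_derivative_at_within)
  then have "((\<lambda>t. \<i> * (a (of_real r * cis t) * (of_real r * cis t) - b (of_real r * cis t) * cnj (of_real r * cis t))) has_integral 0) {0..2*pi}"
    by (simp add: cis_2pi right_diff_distrib mult.left_commute)
  then have "integral {0..2*pi} (\<lambda>t. \<i> * (a (of_real r * cis t) * (of_real r * cis t) - b (of_real r * cis t) * cnj (of_real r * cis t))) = 0"
    by (rule integral_unique)
  then have "integral {0..2*pi} (\<lambda>t. a (of_real r * cis t) * (of_real r * cis t) - b (of_real r * cis t) * cnj (of_real r * cis t)) = 0"
    by (simp only: integral_mult_right) simp
  then show eq: "cmean (\<lambda>z. b z * cnj z) r = cmean (\<lambda>z. a z * z) r"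
    unfolding cmean_def using integral_diff[OF int1 int2] by simp
  have "((\<lambda>r. integral (cbox 0 (2*pi)) (\<lambda>t. f (of_real r * cis t))) has_vector_derivative
     integral (cbox 0 (2*pi)) (\<lambda>t. a (of_real r * cis t) * cis t + b (of_real r * cis t) * cnj (cis t))) (at r within {0<..<R})"
  proof (rule leibniz_rule_vector_derivative)
    fix s t assume s: "s \<in> {0<..<R}"
    then have s': "of_real s * cis t \<in> ball 0 R" by auto
    have *: "((\<lambda>s. of_real s * cis t) has_vector_derivative cis t) (at s)"
      by (auto intro!: derivative_eq_intros simp: has_vector_derivative_def scaleR_conv_of_real algebra_simps)
    show "((\<lambda>r. f (of_real r * cis t)) has_vector_derivative a (of_real s * cis t) * cis t + b (of_real s * cis t) * cnj (cis t)) (at s within {0<..<R})"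
      using has_derivative_at_withinI[OF has_derivative_compose[OF *[unfolded has_vector_derivative_def] der[OF s']]]
      unfolding has_vector_derivative_def
      by (simp add: scaleR_conv_of_real distrib_left mult.left_commute)
  next
    fix s assume "s \<in> {0<..<R}"
    then show "(\<lambda>t. f (of_real s * cis t)) integrable_on cbox 0 (2*pi)"
      using integrable_circle[OF cont(3), of s] by auto
  next
    have *: "continuous_on ({0<..<R} \<times> cbox 0 (2*pi)) (\<lambda>(s,t). a (of_real s * cis t))"
      "continuous_on ({0<..<R} \<times> cbox 0 (2*pi)) (\<lambda>(s,t). b (of_real s * cis t))"
      by (intro continuous_on_polar[OF cont(1)] continuous_on_polar[OF cont(2)]; force)+
    show "continuous_on ({0<..<R} \<times> cbox 0 (2*pi))
      (\<lambda>(s,t). a (of_real s * cis t) * cis t + b (of_real s * cis t) * cnj (cis t))"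
      using * unfolding case_prod_beta by (auto intro!: continuous_intros)
  qed (use assms in auto)
  then have "(cmean f has_vector_derivative
     integral (cbox 0 (2*pi)) (\<lambda>t. a (of_real r * cis t) * cis t + b (of_real r * cis t) * cnj (cis t))) (at r)"
    unfolding cmean_def[abs_def] box_real
    by (simp only: at_within_open[OF assms(2) open_greaterThanLessThan])
  moreover have "integral (cbox 0 (2*pi)) (\<lambda>t. a (of_real r * cis t) * cis t + b (of_real r * cis t) * cnj (cis t))
     = cmean (\<lambda>z. 2 * (a z * z)) r /\<^sub>R r"
  proof -
    have "integral (cbox 0 (2*pi)) (\<lambda>t. a (of_real r * cis t) * cis t + b (of_real r * cis t) * cnj (cis t))
       = integral {0..2*pi} (\<lambda>t. (a (of_real r * cis t) * (of_real r * cis t) + b (of_real r * cis t) * cnj (of_real r * cis t)) /\<^sub>R r)"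
      using assms(2) by (simp only: box_real) (rule integral_cong, auto simp: scaleR_conv_of_real field_simps)
    also have "\<dots> = integral {0..2*pi} (\<lambda>t. a (of_real r * cis t) * (of_real r * cis t) + b (of_real r * cis t) * cnj (of_real r * cis t)) /\<^sub>R r"
      by (rule integral_cmul)
    also have "integral {0..2*pi} (\<lambda>t. a (of_real r * cis t) * (of_real r * cis t) + b (of_real r * cis t) * cnj (of_real r * cis t))
       = cmean (\<lambda>z. a z * z) r + cmean (\<lambda>z. b z * cnj z) r"
      unfolding cmean_def using int1 int2 by (rule integral_add)
    also have "\<dots> = cmean (\<lambda>z. 2 * (a z * z)) r"
      unfolding eq unfolding cmean_def by (simp only: integral_mult_right) simp
    finally show ?thesis .
  qed
  ultimately show "(cmean f has_vector_derivative cmean (\<lambda>z. 2 * (a z * z)) r /\<^sub>R r) (at r)" by simp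
qed

lemma cmean_has_derivative:
  fixes f a b :: "complex \<Rightarrow> complex"
  assumes f: "wirtinger_on (ball 0 R) f a b" and r: "r \<in> {0<..<R}"
  shows "(cmean f has_vector_derivative (2 * cmean (\<lambda>z. b z * cnj z) r) /\<^sub>R r) (at r)"
proof -
  have "cmean (\<lambda>z. 2 * (a z * z)) r = 2 * cmean (\<lambda>z. b z * cnj z) r"
    unfolding cmean_deriv(2)[OF f r] unfolding cmean_def by (simp only: integral_mult_right)
  then show ?thesis using cmean_deriv(1)[OF f r] by simp
qed

text \<open>The factor cnj z is a constant for the z derivative, so \<open>cmean_deriv\<close> in
  its \<open>a\<close> form brings in \<open>c\<close> alone. With
  \<open>cmean_has_derivative\<close> this says (r M')' = 4 r \<open>cmean c r\<close> for M =
  \<open>cmean f\<close>: the Laplacian in polar coordinates.\<close>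

lemma cmean_dbar_has_derivative:
  fixes b c e :: "complex \<Rightarrow> complex"
  assumes b: "wirtinger_on (ball 0 R) b c e" and r: "r \<in> {0<..<R}"
  shows "(cmean (\<lambda>z. b z * cnj z) has_vector_derivative (2 * r) *\<^sub>R cmean c r) (at r)"
proof -
  have "wirtinger_on (ball 0 R) (\<lambda>z. cnj z) (\<lambda>z. 0) (\<lambda>z. 1)"
    using wirtinger_on_cnj_holomorphic[of "\<lambda>z. z" "ball 0 R"] by simp
  from wirtinger_on_mult[OF b this] have
    "wirtinger_on (ball 0 R) (\<lambda>z. b z * cnj z) (\<lambda>z. c z * cnj z) (\<lambda>z. e z * cnj z + b z)" by simp
  from cmean_deriv(1)[OF this r]
  have "(cmean (\<lambda>z. b z * cnj z) has_vector_derivative cmean (\<lambda>z. 2 * (c z * cnj z * z)) r /\<^sub>R r) (at r)" .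
  moreover have "cmean (\<lambda>z. 2 * (c z * cnj z * z)) r = (2 * r^2) *\<^sub>R cmean c r"
  proof -
    have *: "c (of_real r * cis t) * cnj (of_real r * cis t) * (of_real r * cis t) = (r^2) *\<^sub>R c (of_real r * cis t)" for t
    proof -
      have "cnj (of_real r * cis t) * (of_real r * cis t) = of_real (r^2)"
        by (metis (no_types) complex_norm_square mult.commute norm_of_real_cis of_real_power power2_abs)
      then show ?thesis by (simp add: scaleR_conv_of_real mult.assoc)
    qed
    show ?thesis unfolding cmean_def * by (simp add: scaleR_conv_of_real)
  qed
  moreover have "inverse r * (2 * r^2) = 2 * r" using r by (simp add: power2_eq_square)
  ultimately show ?thesis by (simp only: scaleR_scaleR)
qed

lemma continuous_on_mult_ln: "continuous_on {0..1} (\<lambda>r::real. r * ln r)"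
proof -
  have "continuous (at x within {0..1}) (\<lambda>r::real. r * ln r)" if "x \<in> {0..1}" for x
  proof (cases "x = 0")
    case True
    have "((\<lambda>r::real. r * ln r) \<longlongrightarrow> 0) (at_right 0)" by real_asymp
    moreover have "at (0::real) within {0..1} \<le> at_right 0"
      by (simp add: at_within_Icc_at_right)
    ultimately have "((\<lambda>r::real. r * ln r) \<longlongrightarrow> 0) (at 0 within {0..1})"
      using tendsto_mono by blast
    then show ?thesis using True by (simp add: continuous_within)
  next
    case False
    then show ?thesis using that by (intro continuous_intros) auto
  qed
  then show ?thesis using continuous_on_eq_continuous_within by blast
qed

text \<open>With M the circle mean of \<open>f\<close> and N = r M', the function M - ln r N has
  derivative - ln r N', which is the integrand. The weight is the Green function of the disc with
  pole at 0.\<close>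

theorem green_disc:
  fixes f a b c e :: "complex \<Rightarrow> complex"
  assumes f: "wirtinger_on (ball 0 R) f a b" and b: "wirtinger_on (ball 0 R) b c e" and "R > 1"
  shows "((\<lambda>r. - (4 * r * ln r) *\<^sub>R cmean c r) has_integral (cmean f 1 - 2 * pi * f 0)) {0..1}"
proof -
  define N where "N r = 2 * cmean (\<lambda>z. b z * cnj z) r" for r
  have cont: "continuous_on (ball 0 R) b" "continuous_on (ball 0 R) f" "continuous_on (ball 0 R) c"
    using wirtinger_on_imp_continuous_on[OF b] wirtinger_on_imp_continuous_on[OF f] b
    by (simp_all add: wirtinger_on_def)
  have dM: "(cmean f has_vector_derivative N r /\<^sub>R r) (at r)" if "r \<in> {0<..<R}" for r
    using cmean_has_derivative[OF f that] by (simp add: N_def)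
  have dN: "(N has_vector_derivative (4 * r) *\<^sub>R cmean c r) (at r)" if r: "r \<in> {0<..<R}" for r
    using has_vector_derivative_mult_right[OF cmean_dbar_has_derivative[OF b r], of 2]
    unfolding N_def[abs_def] by (simp add: scaleR_conv_of_real mult.assoc)
  \<comment> \<open>N carries a factor r, so the singular term ln r N is 2 (r ln r) Q, which is
    continuous up to r = 0 and vanishes there.\<close>
  define Q where "Q r = integral {0..2*pi} (\<lambda>t. b (of_real r * cis t) * cnj (cis t))" for r
  have NQ: "N r = (2 * r) *\<^sub>R Q r" for r
    unfolding N_def cmean_def Q_def by (simp add: scaleR_conv_of_real mult.assoc mult.left_commute)
  have contQ: "continuous_on {0..1} Q"
  proof -
    have "continuous_on ({0..1} \<times> cbox 0 (2*pi)) (\<lambda>(s,t). b (of_real s * cis t))"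
      using \<open>R > 1\<close> by (intro continuous_on_polar[OF cont(1)]) auto
    then have "continuous_on ({0..1} \<times> cbox 0 (2*pi)) (\<lambda>(s,t). b (of_real s * cis t) * cnj (cis t))"
      unfolding case_prod_beta by (auto intro!: continuous_intros)
    from integral_continuous_on_param[OF this] show ?thesis unfolding Q_def[abs_def] by simp
  qed
  define H where "H r = cmean f r - (2 * (r * ln r)) *\<^sub>R Q r" for r
  have H: "H = (\<lambda>r. cmean f r - ln r *\<^sub>R N r)"
    unfolding H_def[abs_def] NQ by (simp add: fun_eq_iff mult_ac)
  have "((\<lambda>r. - (4 * r * ln r) *\<^sub>R cmean c r) has_integral (H 1 - H 0)) {0..1}"
  proof (rule fundamental_theorem_of_calculus_interior)
    have "continuous_on {0..1} (cmean f)"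
      by (rule continuous_on_cmean[OF cont(2)]) (use \<open>R > 1\<close> in auto)
    then show "continuous_on {0..1} H"
      unfolding H_def[abs_def] by (intro continuous_intros continuous_on_mult_ln contQ)
    fix r :: real assume r: "r \<in> {0<..<1}"
    have 1: "(cmean f has_vector_derivative N r /\<^sub>R r) (at r)" using r \<open>R > 1\<close> by (intro dM) auto
    have 2: "(N has_vector_derivative (4 * r) *\<^sub>R cmean c r) (at r)" using r \<open>R > 1\<close> by (intro dN) auto
    have 3: "(ln has_field_derivative (1/r)) (at r)" using r by (auto intro!: derivative_eq_intros)
    show "(H has_vector_derivative - (4 * r * ln r) *\<^sub>R cmean c r) (at r)"
      unfolding H
      using has_vector_derivative_diff[OF 1 has_vector_derivative_scaleR[OF 3 2]]
      by (simp add: algebra_simps inverse_eq_divide)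
  qed auto
  then show ?thesis by (simp add: H_def cmean_def scaleR_conv_of_real)
qed

section \<open>Littlewood-Paley inequalities\<close>

text \<open>The area integral of \<open>F\<close> over the disc against 4 log (1/|z|), in polar
  coordinates.\<close>

definition log_area :: "(complex \<Rightarrow> real) \<Rightarrow> real" where
  "log_area F = integral {0..1} (\<lambda>r. - (4 * r * ln r) * cmean F r)"

lemma continuous_on_log_area:
  assumes "continuous_on (cball 0 1) F"
  shows "continuous_on {0..1} (\<lambda>r. - (4 * r * ln r) * cmean F r :: real)"
proof -
  have "continuous_on {0..1} (cmean F)"
    by (rule continuous_on_cmean[OF assms]) auto
  with continuous_on_mult_ln have "continuous_on {0..1} (\<lambda>r. - (4 * (r * ln r)) * cmean F r)"
    by (intro continuous_on_mult[OF continuous_on_minus[OF continuous_on_mult[OF continuous_on_const]]])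
  then show ?thesis by (simp add: mult.assoc)
qed

lemma cmean_add:
  assumes "continuous_on (cball 0 1) F" "continuous_on (cball 0 1) G" "r \<in> {0..1}"
  shows "cmean (\<lambda>z. F z + G z) r = cmean F r + (cmean G r :: 'a::banach)"
  unfolding cmean_def
  by (intro integral_add integrable_circle[OF assms(1)] integrable_circle[OF assms(2)]) (use assms in auto)

lemma cmean_sum:
  assumes "finite I" "\<And>i. i \<in> I \<Longrightarrow> continuous_on (cball 0 1) (F i)" "r \<in> {0..1}"
  shows "cmean (\<lambda>z. \<Sum>i\<in>I. F i z) r = (\<Sum>i\<in>I. cmean (F i) r :: 'a::banach)"
  unfolding cmean_def
  by (intro integral_sum integrable_circle[OF assms(2)]) (use assms in auto)

lemma cmean_mono:
  fixes F G :: "complex \<Rightarrow> real"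
  assumes "continuous_on (cball 0 1) F" "continuous_on (cball 0 1) G" "r \<in> {0..1}"
    and "\<And>z. norm z = r \<Longrightarrow> F z \<le> G z"
  shows "cmean F r \<le> cmean G r"
  unfolding cmean_def
  by (intro integral_le integrable_circle[OF assms(1)] integrable_circle[OF assms(2)])
     (use assms in auto)

lemma cmean_cmult: "cmean (\<lambda>z. c * F z) r = c * (cmean F r :: 'a::{real_normed_field,banach})"
  unfolding cmean_def by simp

lemma norm_cmean_le:
  fixes F :: "complex \<Rightarrow> complex"
  assumes "continuous_on (cball 0 1) F" "continuous_on (cball 0 1) G" "r \<in> {0..1}"
    and "\<And>z. norm z = r \<Longrightarrow> norm (F z) \<le> G z"
  shows "norm (cmean F r) \<le> cmean G r"
  unfolding cmean_def
  by (intro integral_norm_bound_integral integrable_circle[OF assms(1)] integrable_circle[OF assms(2)])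
     (use assms in auto)

lemma cmean_const: "cmean (\<lambda>z. c) r = 2 * pi * (c :: real)"
  unfolding cmean_def by simp

lemma cmean_of_real:
  assumes "continuous_on (cball 0 1) F" "r \<in> {0..1}"
  shows "cmean (\<lambda>z. complex_of_real (F z)) r = of_real (cmean F r)"
proof -
  have "(\<lambda>t. F (of_real r * cis t)) integrable_on {0..2*pi}"
    by (rule integrable_circle[OF assms(1)]) (use assms in auto)
  from has_integral_of_real[OF integrable_integral[OF this], where 'b=complex] show ?thesis
    unfolding cmean_def by (rule integral_unique)
qed

lemma log_area_add:
  assumes "continuous_on (cball 0 1) F" "continuous_on (cball 0 1) G"
  shows "log_area (\<lambda>z. F z + G z) = log_area F + log_area G"
proof -
  have "log_area (\<lambda>z. F z + G z) = integral {0..1} (\<lambda>r. - (4 * r * ln r) * cmean F r + - (4 * r * ln r) * cmean G r)"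
    unfolding log_area_def by (intro integral_cong) (simp add: cmean_add[OF assms] algebra_simps)
  also have "\<dots> = log_area F + log_area G"
    unfolding log_area_def
    by (intro integral_add integrable_continuous_real continuous_on_log_area assms)
  finally show ?thesis .
qed

lemma log_area_cmult: "log_area (\<lambda>z. c * F z) = c * log_area F"
  unfolding log_area_def cmean_cmult by (simp add: mult.left_commute flip: integral_mult_right)

lemma log_area_sum:
  assumes "finite I" "\<And>i. i \<in> I \<Longrightarrow> continuous_on (cball 0 1) (F i)"
  shows "log_area (\<lambda>z. \<Sum>i\<in>I. F i z) = (\<Sum>i\<in>I. log_area (F i))"
  using assms
proof (induction I)
  case empty
  then show ?case by (simp add: log_area_def cmean_def)
next
  case (insert x I)
  then have "log_area (\<lambda>z. F x z + (\<Sum>i\<in>I. F i z)) = log_area (F x) + log_area (\<lambda>z. \<Sum>i\<in>I. F i z)"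
    by (intro log_area_add continuous_intros) auto
  with insert show ?case by simp
qed

lemma mult_ln_nonpos: "r \<in> {0..1} \<Longrightarrow> 4 * r * ln r \<le> (0::real)"
  by (cases "r = 0") (auto simp: mult_nonneg_nonpos)

lemma log_area_mono:
  assumes "continuous_on (cball 0 1) F" "continuous_on (cball 0 1) G"
    and "\<And>z. z \<in> cball 0 1 \<Longrightarrow> F z \<le> G z"
  shows "log_area F \<le> log_area G"
  unfolding log_area_def
proof (intro integral_le integrable_continuous_real continuous_on_log_area assms)
  fix r :: real assume r: "r \<in> {0..1}"
  have "cmean F r \<le> cmean G r"
    by (rule cmean_mono) (use assms r in auto)
  with mult_ln_nonpos[OF r] show "- (4 * r * ln r) * cmean F r \<le> - (4 * r * ln r) * cmean G r"
    by (intro mult_left_mono) auto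
qed

lemma green_disc_bound:
  fixes f a b c e :: "complex \<Rightarrow> complex"
  assumes f: "wirtinger_on (ball 0 R) f a b" and b: "wirtinger_on (ball 0 R) b c e" and "R > 1"
    and G: "continuous_on (cball 0 1) G" "\<And>z. z \<in> cball 0 1 \<Longrightarrow> norm (c z) \<le> G z"
  shows "norm (cmean f 1 - 2 * pi * f 0) \<le> log_area G"
proof -
  have "continuous_on (cball 0 1) c"
    using b \<open>R > 1\<close> unfolding wirtinger_on_def by (auto intro: continuous_on_subset)
  note green = green_disc[OF f b \<open>R > 1\<close>]
  have "norm (integral {0..1} (\<lambda>r. - (4 * r * ln r) *\<^sub>R cmean c r)) \<le> log_area G"
    unfolding log_area_def
  proof (rule integral_norm_bound_integral)
    show "(\<lambda>r. - (4 * r * ln r) *\<^sub>R cmean c r) integrable_on {0..1}"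
      using green by blast
    show "(\<lambda>r. - (4 * r * ln r) * cmean G r) integrable_on {0..1}"
      by (intro integrable_continuous_real continuous_on_log_area G)
    fix r :: real assume r: "r \<in> {0..1}"
    have "norm (cmean c r) \<le> cmean G r"
      by (rule norm_cmean_le) (use G r \<open>continuous_on (cball 0 1) c\<close> in auto)
    moreover have "\<bar>4 * r * ln r\<bar> = - (4 * r * ln r)" using mult_ln_nonpos[OF r] by simp
    ultimately show "norm (- (4 * r * ln r) *\<^sub>R cmean c r) \<le> - (4 * r * ln r) * cmean G r"
      using mult_ln_nonpos[OF r] by (simp only: norm_scaleR abs_minus_cancel real_norm_def) (intro mult_left_mono, auto)
  qed
  with integral_unique[OF green] show ?thesis by simp
qed

lemma continuous_on_cball_holomorphic:
  assumes "f holomorphic_on ball 0 R" "R > 1"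
  shows "continuous_on (cball 0 1) f" "continuous_on (cball 0 1) (deriv f)"
proof -
  have "cball 0 1 \<subseteq> ball (0::complex) R" using assms by auto
  then show "continuous_on (cball 0 1) f" "continuous_on (cball 0 1) (deriv f)"
    using holomorphic_on_imp_continuous_on[OF assms(1)]
     holomorphic_on_imp_continuous_on[OF holomorphic_deriv[OF assms(1) open_ball]]
    by (auto intro: continuous_on_subset)
qed

text \<open>The mixed derivative of |f|^2 is |f'|^2, so Green's formula gives an identity; the
  inequality only drops 2 pi |f 0|^2.\<close>

lemma littlewood_paley:
  assumes "f holomorphic_on ball 0 R" "R > 1"
  shows "log_area (\<lambda>z. (norm (deriv f z))\<^sup>2) \<le> cmean (\<lambda>z. (norm (f z))\<^sup>2) 1"
proof -
  note w = wirtinger_on_holomorphic[OF assms(1) open_ball] wirtinger_on_cnj_holomorphic[OF assms(1) open_ball]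
  have f': "deriv f holomorphic_on ball 0 R" using assms(1) by (intro holomorphic_deriv) auto
  note w' = wirtinger_on_cnj_holomorphic[OF f' open_ball]
  note cont = continuous_on_cball_holomorphic[OF assms]
  have w1: "wirtinger_on (ball 0 R) (\<lambda>z. f z * cnj (f z)) (\<lambda>z. deriv f z * cnj (f z)) (\<lambda>z. f z * cnj (deriv f z))"
    using wirtinger_on_mult[OF w] by simp
  have w2: "wirtinger_on (ball 0 R) (\<lambda>z. f z * cnj (deriv f z))
      (\<lambda>z. of_real ((norm (deriv f z))\<^sup>2)) (\<lambda>z. f z * cnj (deriv (deriv f) z))"
    using wirtinger_on_mult[OF w(1) w'] by (simp only: complex_norm_square) simp
  let ?I = "cmean (\<lambda>z. (norm (f z))\<^sup>2) 1 - 2 * pi * (norm (f 0))\<^sup>2"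
  have 1: "cmean (\<lambda>z. f z * cnj (f z)) 1 - 2 * pi * (f 0 * cnj (f 0)) = of_real ?I"
    unfolding complex_norm_square[symmetric] using cont
    by (subst cmean_of_real) (auto intro!: continuous_intros)
  have 2: "- (4 * r * ln r) *\<^sub>R cmean (\<lambda>z. complex_of_real ((norm (deriv f z))\<^sup>2)) r
      = of_real (- (4 * r * ln r) * cmean (\<lambda>z. (norm (deriv f z))\<^sup>2) r)" if "r \<in> {0..1}" for r
  proof -
    have "cmean (\<lambda>z. complex_of_real ((norm (deriv f z))\<^sup>2)) r = of_real (cmean (\<lambda>z. (norm (deriv f z))\<^sup>2) r)"
      using cont that by (intro cmean_of_real continuous_intros)
    then show ?thesis by (simp only: scaleR_conv_of_real of_real_mult)
  qed
  have "((\<lambda>r. complex_of_real (- (4 * r * ln r) * cmean (\<lambda>z. (norm (deriv f z))\<^sup>2) r)) has_integral of_real ?I) {0..1}"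
    using has_integral_eq[OF 2 green_disc[OF w1 w2 \<open>R > 1\<close>]] unfolding 1 by simp
  from has_integral_linear[OF this bounded_linear_Re]
  have "((\<lambda>r. - (4 * r * ln r) * cmean (\<lambda>z. (norm (deriv f z))\<^sup>2) r) has_integral ?I) {0..1}"
    by (simp only: o_def Re_complex_of_real)
  then have "log_area (\<lambda>z. (norm (deriv f z))\<^sup>2) = cmean (\<lambda>z. (norm (f z))\<^sup>2) 1 - 2 * pi * (norm (f 0))\<^sup>2"
    unfolding log_area_def by (rule integral_unique)
  then show ?thesis by simp
qed

lemma norm_diff_square_le:
  fixes x y :: "'a::real_normed_vector"
  shows "(norm (x - y))\<^sup>2 \<le> 2 * (norm x)\<^sup>2 + 2 * (norm y)\<^sup>2"
proof -
  have "(norm (x - y))\<^sup>2 \<le> (norm x + norm y)\<^sup>2"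
    by (intro power_mono norm_triangle_ineq4) auto
  also have "\<dots> \<le> 2 * (norm x)\<^sup>2 + 2 * (norm y)\<^sup>2"
    using sum_squares_bound[of "norm x" "norm y"] by (simp add: power2_sum)
  finally show ?thesis .
qed

lemma cmean_norm_square_nonneg: "cmean (\<lambda>z. (norm (f z))\<^sup>2) r \<ge> 0"
  unfolding cmean_def by (cases "(\<lambda>t. (norm (f (of_real r * cis t)))\<^sup>2) integrable_on {0..2*pi}")
    (auto intro: integral_nonneg simp: not_integrable_integral)

text \<open>The derivative of a bounded function gives a Carleson measure: write
  \<open>L q' = (L q)' - L' q\<close> and apply the Littlewood-Paley inequality twice.\<close>

lemma littlewood_paley_weighted:
  assumes L: "L holomorphic_on ball 0 R" and q: "q holomorphic_on ball 0 R" and "R > 1"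
    and q1: "\<And>z. z \<in> ball 0 R \<Longrightarrow> norm (q z) \<le> 1"
  shows "log_area (\<lambda>z. (norm (deriv q z))\<^sup>2 * (norm (L z))\<^sup>2) \<le> 4 * cmean (\<lambda>z. (norm (L z))\<^sup>2) 1"
proof -
  have Lq: "(\<lambda>z. L z * q z) holomorphic_on ball 0 R" using L q by (intro holomorphic_intros)
  note cont = continuous_on_cball_holomorphic[OF L \<open>R > 1\<close>] continuous_on_cball_holomorphic[OF q \<open>R > 1\<close>]
    continuous_on_cball_holomorphic[OF Lq \<open>R > 1\<close>]
  have "log_area (\<lambda>z. (norm (deriv q z))\<^sup>2 * (norm (L z))\<^sup>2)
    \<le> log_area (\<lambda>z. 2 * (norm (deriv (\<lambda>z. L z * q z) z))\<^sup>2 + 2 * (norm (deriv L z))\<^sup>2)"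
  proof (rule log_area_mono)
    fix z :: complex assume "z \<in> cball 0 1"
    with \<open>R > 1\<close> have z: "z \<in> ball 0 R" by auto
    have "deriv (\<lambda>z. L z * q z) z = L z * deriv q z + deriv L z * q z"
      using L q z by (intro deriv_mult holomorphic_on_imp_differentiable_at[OF _ open_ball])
    then have "(norm (deriv q z))\<^sup>2 * (norm (L z))\<^sup>2 = (norm (deriv (\<lambda>z. L z * q z) z - deriv L z * q z))\<^sup>2"
      by (simp add: norm_mult power_mult_distrib)
    also have "\<dots> \<le> 2 * (norm (deriv (\<lambda>z. L z * q z) z))\<^sup>2 + 2 * (norm (deriv L z * q z))\<^sup>2"
      by (rule norm_diff_square_le)
    also have "(norm (deriv L z * q z))\<^sup>2 \<le> (norm (deriv L z))\<^sup>2"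
      using q1[OF z] by (intro power_mono) (auto simp: norm_mult mult_left_le)
    finally show "(norm (deriv q z))\<^sup>2 * (norm (L z))\<^sup>2
      \<le> 2 * (norm (deriv (\<lambda>z. L z * q z) z))\<^sup>2 + 2 * (norm (deriv L z))\<^sup>2" by simp
  qed (intro continuous_intros cont)+
  also have "\<dots> = 2 * log_area (\<lambda>z. (norm (deriv (\<lambda>z. L z * q z) z))\<^sup>2) + 2 * log_area (\<lambda>z. (norm (deriv L z))\<^sup>2)"
    by (subst log_area_add) (intro continuous_intros cont | simp add: log_area_cmult)+
  also have "\<dots> \<le> 2 * cmean (\<lambda>z. (norm (L z * q z))\<^sup>2) 1 + 2 * cmean (\<lambda>z. (norm (L z))\<^sup>2) 1"
    by (intro add_mono mult_left_mono littlewood_paley[OF Lq \<open>R > 1\<close>] littlewood_paley[OF L \<open>R > 1\<close>]) auto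
  also have "cmean (\<lambda>z. (norm (L z * q z))\<^sup>2) 1 \<le> cmean (\<lambda>z. (norm (L z))\<^sup>2) 1"
  proof (rule cmean_mono)
    fix z :: complex assume "norm z = 1"
    then have "norm (q z) \<le> 1" using \<open>R > 1\<close> by (intro q1) auto
    then show "(norm (L z * q z))\<^sup>2 \<le> (norm (L z))\<^sup>2"
      by (intro power_mono) (auto simp: norm_mult mult_left_le)
  qed (auto intro!: continuous_intros cont)
  finally show ?thesis by simp
qed

text \<open>Ordered pairs are summed, hence the factor 2. For a = K, b = h, c = cnj h, d = cnj h'
  the right side is the numerator of a quotient rule, and the left side shows that it involves
  \<open>K\<close> only through its minors with \<open>h\<close>.\<close>

lemma binet_cauchy_sum:
  fixes a b c d :: "'i \<Rightarrow> 'a::comm_ring_1"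
  shows "(\<Sum>i\<in>I. \<Sum>j\<in>I. (a i * b j - a j * b i) * (c j * d i - c i * d j))
    = 2 * ((\<Sum>i\<in>I. b i * c i) * (\<Sum>i\<in>I. a i * d i) - (\<Sum>i\<in>I. a i * c i) * (\<Sum>i\<in>I. b i * d i))"
proof -
  have "(\<Sum>i\<in>I. \<Sum>j\<in>I. (a i * b j - a j * b i) * (c j * d i - c i * d j))
    = (\<Sum>i\<in>I. \<Sum>j\<in>I. (a i * d i) * (b j * c j)) + (\<Sum>i\<in>I. \<Sum>j\<in>I. (b i * c i) * (a j * d j))
    - ((\<Sum>i\<in>I. \<Sum>j\<in>I. (a i * c i) * (b j * d j)) + (\<Sum>i\<in>I. \<Sum>j\<in>I. (b i * d i) * (a j * c j)))"
    by (simp add: algebra_simps sum.distrib sum_subtractf)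
  also have "\<dots> = 2 * ((\<Sum>i\<in>I. b i * c i) * (\<Sum>i\<in>I. a i * d i) - (\<Sum>i\<in>I. a i * c i) * (\<Sum>i\<in>I. b i * d i))"
    by (simp only: sum_product[symmetric]) (simp add: algebra_simps)
  finally show ?thesis .
qed

section \<open>The Koszul form of the corona estimate\<close>

text \<open>These are the three coefficients occurring in \<open>c\<close>, with d = |\<delta>| and
  s the square sum. The middle one, from differentiating s^-2, needs d^6 \<le> s^3 and fixes the
  exponent 6.\<close>

lemma dbar_coefficient_bound:
  fixes s d :: real
  assumes "0 < s" "0 \<le> d" "d \<le> 1" "d\<^sup>2 \<le> s"
  shows "d ^ 6 / s\<^sup>2 \<le> 1" "d ^ 6 / s ^ 3 \<le> 1" "d ^ 5 / s\<^sup>2 \<le> 1"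
proof -
  have 1: "d ^ 4 \<le> s\<^sup>2" using power_mono[OF assms(4), of 2] assms by (simp flip: power_mult)
  have 2: "d ^ 6 \<le> s ^ 3" using power_mono[OF assms(4), of 3] assms by (simp flip: power_mult)
  have 3: "d ^ 6 \<le> d ^ 4" "d ^ 5 \<le> d ^ 4" using assms by (auto intro: power_decreasing)
  show "d ^ 6 / s\<^sup>2 \<le> 1" "d ^ 6 / s ^ 3 \<le> 1" "d ^ 5 / s\<^sup>2 \<le> 1"
    using 1 2 3 assms by (auto simp: divide_le_eq)
qed

text \<open>The radius \<open>R > 1\<close> is later supplied by dilation. The unit circle is then
  an interior curve, and identities on it concern plain function values.\<close>

locale corona_data =
  fixes n :: nat and R :: real and h :: "nat \<Rightarrow> complex \<Rightarrow> complex" and \<delta> :: "complex \<Rightarrow> complex"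
  assumes R: "R > 1"
    and h: "\<And>i. i < n \<Longrightarrow> h i holomorphic_on ball 0 R"
    and \<delta>: "\<delta> holomorphic_on ball 0 R"
    and h_le: "\<And>i z. i < n \<Longrightarrow> z \<in> ball 0 R \<Longrightarrow> norm (h i z) \<le> 1"
    and \<delta>_le: "\<And>z. z \<in> ball 0 R \<Longrightarrow> norm (\<delta> z) \<le> 1"
    and \<delta>_nz: "\<And>z. z \<in> ball 0 R \<Longrightarrow> \<delta> z \<noteq> 0"
    and lower: "\<And>z. z \<in> ball 0 R \<Longrightarrow> (norm (\<delta> z))\<^sup>2 \<le> (\<Sum>i<n. (norm (h i z))\<^sup>2)"
begin

definition s :: "complex \<Rightarrow> complex" where "s z = (\<Sum>i<n. h i z * cnj (h i z))"

text \<open>\<open>P\<close> dominates each first derivative pointwise, while \<open>E\<close> is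
  the density to which \<open>littlewood_paley_weighted\<close> applies term by term;
  \<open>P_sq_le\<close> passes from one to the other.\<close>

definition P :: "complex \<Rightarrow> real" where "P z = (\<Sum>i<n. norm (deriv (h i) z)) + norm (deriv \<delta> z)"

definition E :: "complex \<Rightarrow> real" where "E z = (\<Sum>i<n. (norm (deriv (h i) z))\<^sup>2) + (norm (deriv \<delta> z))\<^sup>2"

lemma s_eq: "s z = of_real (\<Sum>i<n. (norm (h i z))\<^sup>2)"
  unfolding s_def of_real_sum by (simp only: complex_norm_square)

lemma norm_s: "norm (s z) = (\<Sum>i<n. (norm (h i z))\<^sup>2)"
  unfolding s_eq by (simp add: sum_nonneg del: of_real_sum)

lemma norm_s_pos:
  assumes "z \<in> ball 0 R"
  shows "norm (s z) > 0"
proof -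
  have "0 < (norm (\<delta> z))\<^sup>2" using \<delta>_nz[OF assms] by simp
  also have "\<dots> \<le> norm (s z)" unfolding norm_s by (rule lower[OF assms])
  finally show ?thesis .
qed

lemma P_sq_le: "(P z)\<^sup>2 \<le> (real n + 1) * E z"
proof -
  define q where "q i = (if i < n then norm (deriv (h i) z) else norm (deriv \<delta> z))" for i
  have "P z = (\<Sum>i<Suc n. q i)" "E z = (\<Sum>i<Suc n. (q i)\<^sup>2)"
    by (simp_all add: P_def E_def q_def)
  then show ?thesis
    using sum_squared_le_sum_of_squares[of q "{..<Suc n}"] by (simp add: mult.commute add.commute)
qed

lemma P_nonneg: "P z \<ge> 0"
  by (simp add: P_def sum_nonneg)

lemma wirtinger_s: "wirtinger_on (ball 0 R) s
    (\<lambda>z. \<Sum>i<n. deriv (h i) z * cnj (h i z)) (\<lambda>z. \<Sum>i<n. h i z * cnj (deriv (h i) z))"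
  unfolding s_def
  by (intro wirtinger_on_sum wirtinger_on_cong[OF wirtinger_on_mult[OF wirtinger_on_holomorphic wirtinger_on_cnj_holomorphic]])
     (auto intro: h)

text \<open>\<open>c K\<close> is the mixed second derivative of \<open>\<Sum> K\<^sub>i \<phi>\<^sub>i \<delta>\<^sup>6\<close>.\<close>

definition L :: "(nat \<Rightarrow> complex \<Rightarrow> complex) \<Rightarrow> nat \<Rightarrow> nat \<Rightarrow> complex \<Rightarrow> complex" where
  "L K i j z = K i z * h j z - K j z * h i z"

definition w :: "nat \<Rightarrow> nat \<Rightarrow> complex \<Rightarrow> complex" where
  "w i j z = h j z * deriv (h i) z - h i z * deriv (h j) z"

text \<open>By \<open>binet_cauchy_sum\<close> this is 2 s^2 times the cnj z derivative of the
  quotient of \<Sum> K_i cnj h_i by \<open>s\<close>.\<close>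

definition V :: "(nat \<Rightarrow> complex \<Rightarrow> complex) \<Rightarrow> complex \<Rightarrow> complex" where
  "V K z = (\<Sum>i<n. \<Sum>j<n. L K i j z * cnj (w i j z))"

definition c :: "(nat \<Rightarrow> complex \<Rightarrow> complex) \<Rightarrow> complex \<Rightarrow> complex" where
  "c K z = 1 / 2 * ((\<Sum>i<n. \<Sum>j<n. deriv (L K i j) z * cnj (w i j z)) / (s z)\<^sup>2 * \<delta> z ^ 6
     - 2 * V K z * (\<Sum>i<n. deriv (h i) z * cnj (h i z)) / (s z) ^ 3 * \<delta> z ^ 6
     + V K z / (s z)\<^sup>2 * (6 * \<delta> z ^ 5 * deriv \<delta> z))"

context
  fixes K :: "nat \<Rightarrow> complex \<Rightarrow> complex"
  assumes K: "\<And>i. i < n \<Longrightarrow> K i holomorphic_on ball 0 R"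
begin

lemma L_holomorphic: "i < n \<Longrightarrow> j < n \<Longrightarrow> L K i j holomorphic_on ball 0 R"
  unfolding L_def by (intro holomorphic_intros K h)

lemma w_holomorphic: "i < n \<Longrightarrow> j < n \<Longrightarrow> w i j holomorphic_on ball 0 R"
  unfolding w_def by (intro holomorphic_intros h) auto

text \<open>\<open>K\<close> and \<open>\<delta>\<close> are holomorphic, so the cnj z derivative
  falls on cnj h and 1/s only; the numerator of the quotient rule is half of
  \<open>V\<close>.\<close>

lemma wirtinger_pairing:
  "wirtinger_on (ball 0 R) (\<lambda>z. (\<Sum>i<n. K i z * cnj (h i z)) * inverse (s z) * \<delta> z ^ 6)
    (\<lambda>z. (\<Sum>i<n. deriv (K i) z * cnj (h i z)) * inverse (s z) * \<delta> z ^ 6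
         - (\<Sum>i<n. K i z * cnj (h i z)) * (\<Sum>i<n. deriv (h i) z * cnj (h i z)) / (s z)\<^sup>2 * \<delta> z ^ 6
         + (\<Sum>i<n. K i z * cnj (h i z)) * inverse (s z) * deriv (\<lambda>z. \<delta> z ^ 6) z)
    (\<lambda>z. 1 / 2 * (V K z * (inverse (s z) * inverse (s z)) * \<delta> z ^ 6))"
proof -
  have U: "wirtinger_on (ball 0 R) (\<lambda>z. \<Sum>i<n. K i z * cnj (h i z))
    (\<lambda>z. \<Sum>i<n. deriv (K i) z * cnj (h i z)) (\<lambda>z. \<Sum>i<n. K i z * cnj (deriv (h i) z))"
    by (intro wirtinger_on_sum wirtinger_on_cong[OF wirtinger_on_mult[OF wirtinger_on_holomorphic wirtinger_on_cnj_holomorphic]])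
       (auto intro: h K)
  have D: "wirtinger_on (ball 0 R) (\<lambda>z. \<delta> z ^ 6) (deriv (\<lambda>z. \<delta> z ^ 6)) (\<lambda>z. 0)"
    by (intro wirtinger_on_holomorphic holomorphic_intros \<delta>) auto
  have snz: "s z \<noteq> 0" if "z \<in> ball 0 R" for z using norm_s_pos[OF that] by auto
  note W = wirtinger_on_mult[OF wirtinger_on_mult[OF U wirtinger_on_inverse[OF wirtinger_s snz]] D]
  show ?thesis
  proof (rule wirtinger_on_cong[OF W])
    fix z :: complex assume z: "z \<in> ball 0 R"
    have V: "V K z = 2 * (s z * (\<Sum>i<n. K i z * cnj (deriv (h i) z))
        - (\<Sum>i<n. K i z * cnj (h i z)) * (\<Sum>i<n. h i z * cnj (deriv (h i) z)))"
      unfolding V_def L_def w_def s_def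
      by (subst binet_cauchy_sum[symmetric]) simp
    show "((\<Sum>i<n. K i z * cnj (deriv (h i) z)) * inverse (s z) +
          (\<Sum>i<n. K i z * cnj (h i z)) * (- (\<Sum>i<n. h i z * cnj (deriv (h i) z)) / (s z)\<^sup>2)) * \<delta> z ^ 6
        + (\<Sum>i<n. K i z * cnj (h i z)) * inverse (s z) * 0
      = 1 / 2 * (V K z * (inverse (s z) * inverse (s z)) * \<delta> z ^ 6)"
      unfolding V using snz[OF z] by (simp add: field_simps power2_eq_square)
  qed (auto simp: algebra_simps)
qed

text \<open>The factors \<open>cnj (w i j z)\<close> are constants for the z derivative, which
  therefore falls on \<open>L\<close>, \<open>s\<close> and \<open>\<delta>\<close>: the three terms
  of \<open>c\<close>. The cnj z derivative stays anonymous because Green's formula does not involve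
  its value.\<close>

lemma wirtinger_V: "\<exists>e. wirtinger_on (ball 0 R)
    (\<lambda>z. 1 / 2 * (V K z * (inverse (s z) * inverse (s z)) * \<delta> z ^ 6)) (c K) e"
proof -
  have WV: "wirtinger_on (ball 0 R) (V K) (\<lambda>z. \<Sum>i<n. \<Sum>j<n. deriv (L K i j) z * cnj (w i j z))
     (\<lambda>z. \<Sum>i<n. \<Sum>j<n. L K i j z * cnj (deriv (w i j) z))"
    unfolding V_def
    by (intro wirtinger_on_sum wirtinger_on_cong[OF wirtinger_on_mult[OF wirtinger_on_holomorphic wirtinger_on_cnj_holomorphic]])
       (auto intro: L_holomorphic w_holomorphic)
  have D: "wirtinger_on (ball 0 R) (\<lambda>z. \<delta> z ^ 6) (deriv (\<lambda>z. \<delta> z ^ 6)) (\<lambda>z. 0)"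
    by (intro wirtinger_on_holomorphic holomorphic_intros \<delta>) auto
  have snz: "s z \<noteq> 0" if "z \<in> ball 0 R" for z using norm_s_pos[OF that] by auto
  note S = wirtinger_on_inverse[OF wirtinger_s snz]
  note W = wirtinger_on_mult[OF wirtinger_on_const wirtinger_on_mult[OF wirtinger_on_mult[OF WV wirtinger_on_mult[OF S S]] D]]
  show ?thesis
  proof (rule exI, rule wirtinger_on_cong[OF W open_ball refl _ refl])
    fix z :: complex assume z: "z \<in> ball 0 R"
    have d: "deriv (\<lambda>z. \<delta> z ^ 6) z = 6 * \<delta> z ^ 5 * deriv \<delta> z"
      using holomorphic_derivI[OF \<delta> open_ball z]
      by (intro DERIV_imp_deriv) (auto intro!: derivative_eq_intros)
    have alg: "0 * (v * (inverse x * inverse x) * y) + 1 / 2 * ((l * (inverse x * inverse x) +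
       v * (- g / x\<^sup>2 * inverse x + inverse x * (- g / x\<^sup>2))) * y + v * (inverse x * inverse x) * e)
     = 1 / 2 * (l / x\<^sup>2 * y - 2 * v * g / x ^ 3 * y + v / x\<^sup>2 * e)" if "x \<noteq> 0" for x y v l g e :: complex
      using that by (simp add: power2_eq_square power3_eq_cube field_simps)
    show "0 * (V K z * (inverse (s z) * inverse (s z)) * \<delta> z ^ 6) + 1 / 2 *
       (((\<Sum>i<n. \<Sum>j<n. deriv (L K i j) z * cnj (w i j z)) * (inverse (s z) * inverse (s z)) +
         V K z * (- (\<Sum>i<n. deriv (h i) z * cnj (h i z)) / (s z)\<^sup>2 * inverse (s z) +
              inverse (s z) * (- (\<Sum>i<n. deriv (h i) z * cnj (h i z)) / (s z)\<^sup>2))) * \<delta> z ^ 6 +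
            V K z * (inverse (s z) * inverse (s z)) * deriv (\<lambda>z. \<delta> z ^ 6) z) = c K z"
      unfolding c_def d by (rule alg[OF snz[OF z]])
  qed
qed

lemma w_le:
  assumes "i < n" "j < n" "z \<in> ball 0 R"
  shows "norm (w i j z) \<le> 2 * P z"
proof -
  have *: "norm (deriv (h k) z) \<le> P z" if "k < n" for k
    unfolding P_def using member_le_sum[of k "{..<n}" "\<lambda>i. norm (deriv (h i) z)"] that
    by (simp add: add_increasing2)
  have "norm (w i j z) \<le> norm (h j z) * norm (deriv (h i) z) + norm (h i z) * norm (deriv (h j) z)"
    unfolding w_def norm_mult[symmetric] by (rule norm_triangle_ineq4)
  also have "\<dots> \<le> 1 * P z + 1 * P z"
    by (intro add_mono mult_mono h_le * assms) auto
  finally show ?thesis by simp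
qed

text \<open>The three terms of \<open>c\<close> add up to P |L'| + 8 P^2 |L| per pair, with 8 = (4 +
  12) / 2. The products are split by P |L'| \<le> P^2 + |L'|^2 and |L| \<le> 1 + |L|^2, which gives
  9 = 1 + 8; each resulting term is accessible to a Littlewood-Paley estimate.\<close>

lemma norm_c_le:
  assumes z: "z \<in> ball 0 R"
  shows "norm (c K z) \<le> (\<Sum>i<n. \<Sum>j<n. 9 * (real n + 1) * E z + (norm (deriv (L K i j) z))\<^sup>2
      + 8 * (real n + 1) * (E z * (norm (L K i j z))\<^sup>2))"
proof -
  define A where "A = (\<Sum>i<n. \<Sum>j<n. norm (deriv (L K i j) z))"
  define B where "B = (\<Sum>i<n. \<Sum>j<n. norm (L K i j z))"
  note P0 = P_nonneg[of z]
  have B0: "B \<ge> 0" unfolding B_def by (intro sum_nonneg) auto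
  have A0: "A \<ge> 0" unfolding A_def by (intro sum_nonneg) auto
  have *: "norm (\<Sum>i<n. \<Sum>j<n. a i j * cnj (w i j z)) \<le> 2 * P z * (\<Sum>i<n. \<Sum>j<n. norm (a i j))" for a
    unfolding sum_distrib_left
  proof (intro sum_norm_le)
    fix i j assume "i \<in> {..<n}" "j \<in> {..<n}"
    then have "norm (w i j z) * norm (a i j) \<le> 2 * P z * norm (a i j)"
      by (intro mult_right_mono w_le z) auto
    then show "norm (a i j * cnj (w i j z)) \<le> 2 * P z * norm (a i j)"
      by (simp add: norm_mult mult.commute)
  qed
  have V: "norm (V K z) \<le> 2 * P z * B"
    unfolding V_def B_def by (rule *)
  have T: "norm (\<Sum>i<n. \<Sum>j<n. deriv (L K i j) z * cnj (w i j z)) \<le> 2 * P z * A"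
    unfolding A_def by (rule *)
  have "norm (\<Sum>i<n. deriv (h i) z * cnj (h i z)) \<le> (\<Sum>i<n. norm (deriv (h i) z))"
    by (intro sum_norm_le) (use h_le[OF _ z] in \<open>auto simp: norm_mult mult_left_le\<close>)
  also have "\<dots> \<le> P z" by (simp add: P_def)
  finally have H: "norm (\<Sum>i<n. deriv (h i) z * cnj (h i z)) \<le> P z" .
  have D: "norm (deriv \<delta> z) \<le> P z" by (simp add: P_def sum_nonneg)
  note k = dbar_coefficient_bound[OF norm_s_pos[OF z] norm_ge_zero \<delta>_le[OF z] lower[OF z, folded norm_s]]
  have c1: "norm ((\<Sum>i<n. \<Sum>j<n. deriv (L K i j) z * cnj (w i j z)) / (s z)\<^sup>2 * \<delta> z ^ 6) \<le> 2 * P z * A"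
    using mult_mono[OF T k(1)] A0 P0 by (simp add: norm_mult norm_divide norm_power)
  have c2: "norm (2 * V K z * (\<Sum>i<n. deriv (h i) z * cnj (h i z)) / (s z) ^ 3 * \<delta> z ^ 6) \<le> 4 * (P z)\<^sup>2 * B"
    using mult_mono[OF mult_mono[OF V H] k(2)] B0 P0
    by (simp add: norm_mult norm_divide norm_power power2_eq_square mult_ac)
  have c3: "norm (V K z / (s z)\<^sup>2 * (6 * \<delta> z ^ 5 * deriv \<delta> z)) \<le> 12 * (P z)\<^sup>2 * B"
    using mult_mono[OF mult_mono[OF V D] k(3)] B0 P0
    by (simp add: norm_mult norm_divide norm_power power2_eq_square mult_ac)
  have "norm (c K z) \<le> 1/2 * (2 * P z * A + 4 * (P z)\<^sup>2 * B + 12 * (P z)\<^sup>2 * B)"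
    unfolding c_def norm_mult[of "1/2"]
    using norm_triangle_le[OF add_mono[OF norm_triangle_le_diff[OF add_mono[OF c1 c2]] c3]]
    by simp
  also have "\<dots> = (\<Sum>i<n. \<Sum>j<n. P z * norm (deriv (L K i j) z) + 8 * ((P z)\<^sup>2 * norm (L K i j z)))"
    by (simp add: A_def B_def sum.distrib flip: sum_distrib_left)
  also have "\<dots> \<le> (\<Sum>i<n. \<Sum>j<n. 9 * (real n + 1) * E z + (norm (deriv (L K i j) z))\<^sup>2
      + 8 * (real n + 1) * (E z * (norm (L K i j z))\<^sup>2))"
  proof (intro sum_mono)
    fix i j
    have "P z * norm (deriv (L K i j) z) \<le> (P z)\<^sup>2 + (norm (deriv (L K i j) z))\<^sup>2"
      using sum_squares_bound[of "P z" "norm (deriv (L K i j) z)"] P0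
        mult_nonneg_nonneg[OF P0 norm_ge_zero[of "deriv (L K i j) z"]] by linarith
    moreover have "norm (L K i j z) \<le> 1 + (norm (L K i j z))\<^sup>2"
    proof -
      have "2 * norm (L K i j z) \<le> 1 + (norm (L K i j z))\<^sup>2"
        using sum_squares_bound[of 1 "norm (L K i j z)"] by simp
      with norm_ge_zero[of "L K i j z"] show ?thesis by linarith
    qed
    then have "(P z)\<^sup>2 * norm (L K i j z) \<le> (P z)\<^sup>2 * (1 + (norm (L K i j z))\<^sup>2)"
      by (intro mult_left_mono) auto
    moreover have "(P z)\<^sup>2 * (norm (L K i j z))\<^sup>2 \<le> ((real n + 1) * E z) * (norm (L K i j z))\<^sup>2"
      using P_sq_le by (intro mult_right_mono) auto
    ultimately have "P z * norm (deriv (L K i j) z) + 8 * ((P z)\<^sup>2 * norm (L K i j z)) \<le>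
       9 * ((real n + 1) * E z) + (norm (deriv (L K i j) z))\<^sup>2 + 8 * (((real n + 1) * E z) * (norm (L K i j z))\<^sup>2)"
      using P_sq_le[of z] by (simp add: distrib_left)
    then show "P z * norm (deriv (L K i j) z) + 8 * ((P z)\<^sup>2 * norm (L K i j z)) \<le>
       9 * (real n + 1) * E z + (norm (deriv (L K i j) z))\<^sup>2 + 8 * (real n + 1) * (E z * (norm (L K i j z))\<^sup>2)"
      by (simp only: mult.assoc)
  qed
  finally show ?thesis .
qed

end

end

section \<open>Boundary and area estimates for the dual pairing\<close>

lemma cmean_cong: "(\<And>z. norm z = r \<Longrightarrow> F z = G z) \<Longrightarrow> r \<ge> 0 \<Longrightarrow> cmean F r = cmean G r"
  unfolding cmean_def by (intro integral_cong) auto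

lemma cmean_holomorphic:
  fixes f :: "complex \<Rightarrow> complex"
  assumes "f holomorphic_on ball 0 R" "R > 1"
  shows "cmean f 1 = 2 * pi * f 0"
proof -
  have "((\<lambda>r. - (4 * r * ln r) *\<^sub>R cmean (\<lambda>z. 0::complex) r) has_integral (cmean f 1 - 2 * pi * f 0)) {0..1}"
    by (rule green_disc[OF wirtinger_on_holomorphic[OF assms(1) open_ball] wirtinger_on_const assms(2)])
  then have "((\<lambda>r. 0::complex) has_integral (cmean f 1 - 2 * pi * f 0)) {0..1}"
    by (simp add: cmean_def)
  then show ?thesis by (simp add: has_integral_0_eq)
qed

text \<open>2 pi n + 1 bounds the part of the pairing that contains \<open>v\<close>. The bracket is
  9 (n+1) 2 pi (n+1) + 4 + 8 (n+1) 4 (n+1) 4: the three terms of \<open>norm_c_le\<close> when the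
  minors have mean square at most 4.\<close>

definition corona_const :: "nat \<Rightarrow> real" where
  "corona_const n = 2 * pi * n + 1 + real n * real n * (18 * pi * (real n + 1)\<^sup>2 + 4 + 128 * (real n + 1)\<^sup>2)"

context corona_data
begin

lemma E_eq: "E z = (\<Sum>k<Suc n. (norm (deriv (if k < n then h k else \<delta>) z))\<^sup>2)"
  by (simp add: E_def)

lemma cont:
  assumes "f holomorphic_on ball 0 R"
  shows "continuous_on (cball 0 1) f" "continuous_on (cball 0 1) (deriv f)"
  using continuous_on_cball_holomorphic[OF assms R] by auto

lemma log_area_E:
  assumes "Lf holomorphic_on ball 0 R"
  shows "log_area (\<lambda>z. E z * (norm (Lf z))\<^sup>2) \<le> 4 * (real n + 1) * cmean (\<lambda>z. (norm (Lf z))\<^sup>2) 1"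
    and "log_area E \<le> 2 * pi * (real n + 1)"
proof -
  define q where "q k = (if k < n then h k else \<delta>)" for k
  have q: "q k holomorphic_on ball 0 R" "z \<in> ball 0 R \<Longrightarrow> norm (q k z) \<le> 1" for k z
    using h \<delta> h_le \<delta>_le by (auto simp: q_def)
  have E: "E = (\<lambda>z. \<Sum>k<Suc n. (norm (deriv (q k) z))\<^sup>2)"
    by (auto simp: E_eq q_def fun_eq_iff)
  have "log_area (\<lambda>z. E z * (norm (Lf z))\<^sup>2) = log_area (\<lambda>z. \<Sum>k<Suc n. (norm (deriv (q k) z))\<^sup>2 * (norm (Lf z))\<^sup>2)"
    by (simp only: E sum_distrib_right)
  also have "\<dots> = (\<Sum>k<Suc n. log_area (\<lambda>z. (norm (deriv (q k) z))\<^sup>2 * (norm (Lf z))\<^sup>2))"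
    by (intro log_area_sum continuous_intros cont q assms) auto
  also have "\<dots> \<le> (\<Sum>k<Suc n. 4 * cmean (\<lambda>z. (norm (Lf z))\<^sup>2) 1)"
    by (intro sum_mono littlewood_paley_weighted[OF assms q(1) R q(2)])
  finally show "log_area (\<lambda>z. E z * (norm (Lf z))\<^sup>2) \<le> 4 * (real n + 1) * cmean (\<lambda>z. (norm (Lf z))\<^sup>2) 1"
    by (simp add: algebra_simps)
  have "log_area E = (\<Sum>k<Suc n. log_area (\<lambda>z. (norm (deriv (q k) z))\<^sup>2))"
    unfolding E by (intro log_area_sum continuous_intros cont q) auto
  also have "\<dots> \<le> (\<Sum>k<Suc n. 2 * pi)"
  proof (intro sum_mono)
    fix k
    have "log_area (\<lambda>z. (norm (deriv (q k) z))\<^sup>2) \<le> cmean (\<lambda>z. (norm (q k z))\<^sup>2) 1"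
      by (rule littlewood_paley[OF q(1) R])
    also have "\<dots> \<le> cmean (\<lambda>z. 1) 1"
      by (rule cmean_mono) (use R in \<open>auto intro!: continuous_intros cont q power_le_one\<close>)
    finally show "log_area (\<lambda>z. (norm (deriv (q k) z))\<^sup>2) \<le> 2 * pi"
      by (simp add: cmean_const)
  qed
  finally show "log_area E \<le> 2 * pi * (real n + 1)" by (simp add: algebra_simps)
qed

text \<open>\<open>K i 0 = 0\<close> removes the value at the centre from Green's formula. Only the
  minors of \<open>K\<close> and \<open>h\<close> are assumed bounded in mean square, not
  \<open>K\<close> itself.\<close>

lemma cmean_pairing_bound:
  assumes K: "\<And>i. i < n \<Longrightarrow> K i holomorphic_on ball 0 R" "\<And>i. i < n \<Longrightarrow> K i 0 = 0"
    and L: "\<And>i j. i < n \<Longrightarrow> j < n \<Longrightarrow> cmean (\<lambda>z. (norm (K i z * h j z - K j z * h i z))\<^sup>2) 1 \<le> 4"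
  shows "norm (cmean (\<lambda>z. (\<Sum>i<n. K i z * cnj (h i z)) * inverse (s z) * \<delta> z ^ 6) 1)
     \<le> real n * real n * (18 * pi * (real n + 1)\<^sup>2 + 4 + 128 * (real n + 1)\<^sup>2)"
proof -
  define LK where "LK = L K"
  have LK: "LK i j holomorphic_on ball 0 R" if "i < n" "j < n" for i j
    unfolding LK_def using L_holomorphic[where K=K, OF K(1) that] .
  have contE: "continuous_on (cball 0 1) E"
    unfolding E_def by (intro continuous_intros cont h \<delta>) auto
  define G where "G i j z = 9 * (real n + 1) * E z + (norm (deriv (LK i j) z))\<^sup>2
      + 8 * (real n + 1) * (E z * (norm (LK i j z))\<^sup>2)" for i j z
  have contG: "continuous_on (cball 0 1) (G i j)" if "i < n" "j < n" for i j
    unfolding G_def using that by (intro continuous_intros cont LK contE)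
  obtain e where e: "wirtinger_on (ball 0 R)
    (\<lambda>z. 1 / 2 * (V K z * (inverse (s z) * inverse (s z)) * \<delta> z ^ 6)) (c K) e"
    using wirtinger_V[where K=K, OF K(1)] by blast
  have "norm (cmean (\<lambda>z. (\<Sum>i<n. K i z * cnj (h i z)) * inverse (s z) * \<delta> z ^ 6) 1
      - 2 * pi * ((\<Sum>i<n. K i 0 * cnj (h i 0)) * inverse (s 0) * \<delta> 0 ^ 6)) \<le> log_area (\<lambda>z. \<Sum>i<n. \<Sum>j<n. G i j z)"
  proof (rule green_disc_bound[OF wirtinger_pairing[where K=K, OF K(1)] e R])
    show "continuous_on (cball 0 1) (\<lambda>z. \<Sum>i<n. \<Sum>j<n. G i j z)"
      by (intro continuous_on_sum contG) auto
    fix z :: complex assume "z \<in> cball 0 1"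
    then have "z \<in> ball 0 R" using R by auto
    from norm_c_le[where K=K, OF K(1) this] show "norm (c K z) \<le> (\<Sum>i<n. \<Sum>j<n. G i j z)"
      unfolding G_def LK_def .
  qed
  also have "log_area (\<lambda>z. \<Sum>i<n. \<Sum>j<n. G i j z) = (\<Sum>i<n. log_area (\<lambda>z. \<Sum>j<n. G i j z))"
    by (intro log_area_sum continuous_on_sum contG) auto
  also have "\<dots> = (\<Sum>i<n. \<Sum>j<n. log_area (G i j))"
    by (intro sum.cong refl log_area_sum contG) auto
  also have "\<dots> \<le> (\<Sum>i<n. \<Sum>j<n. 18 * pi * (real n + 1)\<^sup>2 + 4 + 128 * (real n + 1)\<^sup>2)"
  proof (intro sum_mono)
    fix i j assume "i \<in> {..<n}" "j \<in> {..<n}"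
    then have ij: "i < n" "j < n" by auto
    note C = cont[OF LK[OF ij]]
    have N: "cmean (\<lambda>z. (norm (LK i j z))\<^sup>2) 1 \<le> 4"
      using L[OF ij] unfolding LK_def L_def .
    have "log_area (G i j) = 9 * (real n + 1) * log_area E + log_area (\<lambda>z. (norm (deriv (LK i j) z))\<^sup>2)
       + 8 * (real n + 1) * log_area (\<lambda>z. E z * (norm (LK i j z))\<^sup>2)"
    proof -
      have "log_area (G i j) = log_area (\<lambda>z. 9 * (real n + 1) * E z + (norm (deriv (LK i j) z))\<^sup>2)
         + log_area (\<lambda>z. 8 * (real n + 1) * (E z * (norm (LK i j z))\<^sup>2))"
        unfolding G_def by (rule log_area_add) (intro continuous_intros C contE)+
      also have "log_area (\<lambda>z. 9 * (real n + 1) * E z + (norm (deriv (LK i j) z))\<^sup>2)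
        = log_area (\<lambda>z. 9 * (real n + 1) * E z) + log_area (\<lambda>z. (norm (deriv (LK i j) z))\<^sup>2)"
        by (rule log_area_add) (intro continuous_intros C contE)+
      finally show ?thesis by (simp only: log_area_cmult)
    qed
    also have "\<dots> \<le> 9 * (real n + 1) * (2 * pi * (real n + 1)) + 4 + 8 * (real n + 1) * (4 * (real n + 1) * 4)"
    proof -
      have "log_area (\<lambda>z. E z * (norm (LK i j z))\<^sup>2) \<le> 4 * (real n + 1) * 4"
        by (rule order_trans[OF log_area_E(1)[OF LK[OF ij]] mult_left_mono[OF N]]) simp
      moreover have "log_area (\<lambda>z. (norm (deriv (LK i j) z))\<^sup>2) \<le> 4"
        by (rule order_trans[OF littlewood_paley[OF LK[OF ij] R] N])
      ultimately show ?thesis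
        by (intro add_mono mult_left_mono log_area_E(2)[OF LK[OF ij]]) auto
    qed
    also have "\<dots> = 18 * pi * (real n + 1)\<^sup>2 + 4 + 128 * (real n + 1)\<^sup>2"
      by (simp add: power2_eq_square algebra_simps)
    finally show "log_area (G i j) \<le> 18 * pi * (real n + 1)\<^sup>2 + 4 + 128 * (real n + 1)\<^sup>2" .
  qed
  also have "\<dots> = real n * real n * (18 * pi * (real n + 1)\<^sup>2 + 4 + 128 * (real n + 1)\<^sup>2)" by simp
  finally show ?thesis by (simp add: K(2))
qed

text \<open>On the circle, inserting 1 = \<Sum> h_i cnj h_i / s and the conjugated splitting of h_i
  cnj k leaves a term in \<open>v\<close>, bounded directly, and a term in \<open>K\<close>, covered
  by \<open>cmean_pairing_bound\<close>. The sizes of \<open>k\<close> and \<open>K\<close> do not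
  enter.\<close>

lemma corona_pairing:
  assumes K: "\<And>i. i < n \<Longrightarrow> K i holomorphic_on ball 0 R" "\<And>i. i < n \<Longrightarrow> K i 0 = 0"
    and v: "\<And>i. i < n \<Longrightarrow> v i holomorphic_on ball 0 R"
    and k: "k holomorphic_on ball 0 R"
    and eq: "\<And>i z. i < n \<Longrightarrow> norm z = 1 \<Longrightarrow> cnj (h i z) * k z = v i z + cnj (K i z)"
    and v_le: "(\<Sum>i<n. cmean (\<lambda>z. (norm (v i z))\<^sup>2) 1) \<le> 1"
  shows "norm (cmean (\<lambda>z. cnj (k z) * \<delta> z ^ 6) 1) \<le> corona_const n"
proof -
  have eq': "h i z * cnj (k z) = cnj (v i z) + K i z" if "i < n" "norm z = 1" for i z
    using arg_cong[OF eq[OF that], of cnj] by simp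
  have vi: "cmean (\<lambda>z. (norm (v i z))\<^sup>2) 1 \<le> 1" if "i < n" for i
    using member_le_sum[of i "{..<n}" "\<lambda>i. cmean (\<lambda>z. (norm (v i z))\<^sup>2) 1"] v_le that
    by (auto simp: cmean_norm_square_nonneg)
  \<comment> \<open>On the circle K_i = h_i cnj k - cnj v_i, so the terms with cnj k cancel in the
    minor. Each \<open>v i\<close> has mean square at most 1, which gives 2 + 2 = 4.\<close>
  have L: "cmean (\<lambda>z. (norm (K i z * h j z - K j z * h i z))\<^sup>2) 1 \<le> 4" if ij: "i < n" "j < n" for i j
  proof -
    have "cmean (\<lambda>z. (norm (K i z * h j z - K j z * h i z))\<^sup>2) 1
      \<le> cmean (\<lambda>z. 2 * (norm (v j z))\<^sup>2 + 2 * (norm (v i z))\<^sup>2) 1"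
    proof (rule cmean_mono)
      fix z :: complex assume z: "norm z = 1"
      then have "z \<in> ball 0 R" using R by auto
      note hl = h_le[OF ij(1) this] h_le[OF ij(2) this]
      have "K i z * h j z - K j z * h i z = (h i z * cnj (k z) - cnj (v i z)) * h j z - (h j z * cnj (k z) - cnj (v j z)) * h i z"
        using eq' ij z by (simp add: algebra_simps)
      also have "\<dots> = cnj (v j z) * h i z - cnj (v i z) * h j z" by (simp add: algebra_simps)
      finally have "(norm (K i z * h j z - K j z * h i z))\<^sup>2 = (norm (cnj (v j z) * h i z - cnj (v i z) * h j z))\<^sup>2" by simp
      also have "\<dots> \<le> 2 * (norm (cnj (v j z) * h i z))\<^sup>2 + 2 * (norm (cnj (v i z) * h j z))\<^sup>2"
        by (rule norm_diff_square_le)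
      also have "\<dots> \<le> 2 * (norm (v j z))\<^sup>2 + 2 * (norm (v i z))\<^sup>2"
        using hl by (intro add_mono mult_left_mono power_mono) (auto simp: norm_mult mult_left_le)
      finally show "(norm (K i z * h j z - K j z * h i z))\<^sup>2 \<le> 2 * (norm (v j z))\<^sup>2 + 2 * (norm (v i z))\<^sup>2" .
    qed (use ij in \<open>auto intro!: continuous_intros holomorphic_intros cont K v h\<close>)
    also have "\<dots> = 2 * cmean (\<lambda>z. (norm (v j z))\<^sup>2) 1 + 2 * cmean (\<lambda>z. (norm (v i z))\<^sup>2) 1"
      by (subst cmean_add) (use ij in \<open>auto intro!: continuous_intros cont v simp: cmean_cmult\<close>)
    also have "\<dots> \<le> 4" using vi[OF ij(1)] vi[OF ij(2)] by simp
    finally show ?thesis .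
  qed
  have bound: "norm (cmean (\<lambda>z. (\<Sum>i<n. K i z * cnj (h i z)) * inverse (s z) * \<delta> z ^ 6) 1)
     \<le> real n * real n * (18 * pi * (real n + 1)\<^sup>2 + 4 + 128 * (real n + 1)\<^sup>2)"
    by (rule cmean_pairing_bound) (use K L in auto)
  have cs: "continuous_on (cball 0 1) s"
    unfolding s_def by (intro continuous_intros cont h) auto
  have snz: "s z \<noteq> 0" if "z \<in> cball 0 1" for z using norm_s_pos[of z] R that by auto
  let ?A = "\<lambda>z. \<Sum>i<n. cnj (v i z) * cnj (h i z) * inverse (s z) * \<delta> z ^ 6"
  let ?B = "\<lambda>z. (\<Sum>i<n. K i z * cnj (h i z)) * inverse (s z) * \<delta> z ^ 6"
  have cA: "continuous_on (cball 0 1) ?A"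
    using snz by (intro continuous_intros cont v h cs \<delta>) auto
  have cB: "continuous_on (cball 0 1) ?B"
    using snz by (intro continuous_intros cont K h cs \<delta>) auto
  have "cmean (\<lambda>z. cnj (k z) * \<delta> z ^ 6) 1 = cmean (\<lambda>z. ?A z + ?B z) 1"
  proof (rule cmean_cong)
    fix z :: complex assume z: "norm z = 1"
    then have nz: "s z \<noteq> 0" using snz by auto
    have "?A z + ?B z = (\<Sum>i<n. (cnj (v i z) + K i z) * cnj (h i z)) * (inverse (s z) * \<delta> z ^ 6)"
      by (simp add: sum_distrib_right distrib_right sum.distrib mult.assoc)
    also have "(\<Sum>i<n. (cnj (v i z) + K i z) * cnj (h i z)) = (\<Sum>i<n. cnj (k z) * (h i z * cnj (h i z)))"
      using z by (intro sum.cong) (auto simp: eq'[symmetric])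
    also have "\<dots> = cnj (k z) * s z" unfolding s_def by (simp add: sum_distrib_left)
    finally show "cnj (k z) * \<delta> z ^ 6 = ?A z + ?B z" using nz by simp
  qed simp
  also have "\<dots> = cmean ?A 1 + cmean ?B 1" by (rule cmean_add[OF cA cB]) simp
  finally have "norm (cmean (\<lambda>z. cnj (k z) * \<delta> z ^ 6) 1) \<le> norm (cmean ?A 1) + norm (cmean ?B 1)"
    by (simp add: norm_triangle_ineq)
  moreover have "norm (cmean ?A 1) \<le> 2 * pi * n + 1"
  proof -
    have "norm (cmean ?A 1) \<le> cmean (\<lambda>z. \<Sum>i<n. 1 + (norm (v i z))\<^sup>2) 1"
    proof (rule norm_cmean_le[OF cA])
      fix z :: complex assume z: "norm z = 1"
      then have zR: "z \<in> ball 0 R" using R by auto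
      show "norm (?A z) \<le> (\<Sum>i<n. 1 + (norm (v i z))\<^sup>2)"
      proof (rule sum_norm_le)
        fix i assume "i \<in> {..<n}"
        then have hi: "norm (h i z) \<le> 1" using h_le zR by auto
        have d: "norm (\<delta> z ^ 6) \<le> norm (s z)"
        proof -
          have "norm (\<delta> z) ^ 6 \<le> norm (\<delta> z) ^ 2"
            using \<delta>_le[OF zR] by (intro power_decreasing) auto
          also have "\<dots> \<le> norm (s z)" using lower[OF zR] unfolding norm_s .
          finally show ?thesis by (simp add: norm_power)
        qed
        have "norm (cnj (v i z) * cnj (h i z) * inverse (s z) * \<delta> z ^ 6)
          = norm (v i z) * norm (h i z) * (norm (\<delta> z ^ 6) / norm (s z))"
          by (simp add: norm_mult norm_inverse divide_inverse mult_ac)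
        also have "\<dots> \<le> norm (v i z) * 1 * 1"
          using hi d norm_s_pos[OF zR] by (intro mult_mono) (auto simp: divide_le_eq)
        also have "\<dots> \<le> 1 + (norm (v i z))\<^sup>2"
          using sum_squares_bound[of 1 "norm (v i z)"] norm_ge_zero[of "v i z"]
          unfolding power_one mult_1_right by linarith
        finally show "norm (cnj (v i z) * cnj (h i z) * inverse (s z) * \<delta> z ^ 6) \<le> 1 + (norm (v i z))\<^sup>2" .
      qed
    qed (auto intro!: continuous_intros cont v)
    also have "\<dots> = (\<Sum>i<n. cmean (\<lambda>z. 1 + (norm (v i z))\<^sup>2) 1)"
      by (rule cmean_sum) (auto intro!: continuous_intros cont v)
    also have "\<dots> = (\<Sum>i<n. 2 * pi + cmean (\<lambda>z. (norm (v i z))\<^sup>2) 1)"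
      by (intro sum.cong refl, subst cmean_add) (auto intro!: continuous_intros cont v simp: cmean_const)
    also have "\<dots> \<le> 2 * pi * n + 1"
      using v_le by (simp add: sum.distrib mult_ac)
    finally show ?thesis .
  qed
  ultimately show ?thesis using bound unfolding corona_const_def by linarith
qed

end

text \<open>For a square system uniqueness gives existence. This stands in for a duality theorem
  about an operator on H^2.\<close>

lemma linear_system_solvable:
  fixes M :: "nat \<Rightarrow> nat \<Rightarrow> 'a::field"
  assumes inj: "\<And>x. (\<And>c. c < N \<Longrightarrow> (\<Sum>b<N. M c b * x b) = 0) \<Longrightarrow> \<forall>b<N. x b = 0"
  obtains x where "\<And>c. c < N \<Longrightarrow> (\<Sum>b<N. M c b * x b) = y c"
proof -
  define A where "A = mat N N (\<lambda>(c, b). M c b)"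
  have A: "A \<in> carrier_mat N N" by (simp add: A_def)
  have mv: "vec_index (A *\<^sub>v w) c = (\<Sum>b<N. M c b * vec_index w b)" if "w \<in> carrier_vec N" "c < N" for w c
    using that by (auto simp: A_def scalar_prod_def lessThan_atLeast0 intro!: sum.cong)
  have "det A \<noteq> 0"
  proof
    assume "det A = 0"
    then obtain w where w: "w \<in> carrier_vec N" "w \<noteq> 0\<^sub>v N" "A *\<^sub>v w = 0\<^sub>v N"
      using det_0_iff_vec_prod_zero[OF A] by blast
    then have "\<forall>b<N. vec_index w b = 0"
      by (intro inj) (metis mv index_zero_vec(1))
    with w show False by (auto intro: eq_vecI)
  qed
  from det_non_zero_imp_unit[OF A this, of "()"] obtain B
    where B: "B \<in> carrier_mat N N" "A * B = 1\<^sub>m N"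
    by (auto simp: Units_def ring_mat_def)
  define w where "w = B *\<^sub>v vec N y"
  have w: "w \<in> carrier_vec N" using B(1) by (auto simp: w_def)
  have "A *\<^sub>v w = (A * B) *\<^sub>v vec N y"
    unfolding w_def by (rule assoc_mult_mat_vec[OF A B(1), symmetric]) simp
  also have "\<dots> = vec N y" unfolding B(2) by simp
  finally have "A *\<^sub>v w = vec N y" .
  then show ?thesis
    using mv[OF w] that[of "vec_index w"] by simp
qed

section \<open>The Bezout equation modulo powers of the variable\<close>

text \<open>The backward shift of Taylor coefficients. \<open>bshift_eq\<close> holds at every
  complex number, also outside the ball.\<close>

definition bshift :: "(complex \<Rightarrow> complex) \<Rightarrow> complex \<Rightarrow> complex" where
  "bshift f z = (if z = 0 then deriv f 0 else (f z - f 0) / z)"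

lemma bshift_eq: "f z = f 0 + z * bshift f z"
  by (simp add: bshift_def)

lemma bshift_holomorphic:
  assumes "f holomorphic_on ball 0 R"
  shows "bshift f holomorphic_on ball 0 R"
  using pole_lemma_open[OF assms open_ball, of 0] unfolding bshift_def[abs_def] diff_zero .

lemma cnj_mult_self_power:
  assumes "norm z = 1" "d \<le> b"
  shows "cnj z ^ d * z ^ b = z ^ (b - d)"
proof -
  have "cnj z * z = 1" using assms(1) by (simp add: complex_norm_square[symmetric] mult.commute)
  then have "cnj z ^ d * z ^ d = 1" by (simp flip: power_mult_distrib)
  moreover have "z ^ b = z ^ d * z ^ (b - d)" using assms(2) by (simp flip: power_add)
  ultimately show ?thesis by (simp flip: mult.assoc)
qed

text \<open>Taylor's formula with b + 1 terms: on the circle the conjugated terms times z^b become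
  z^(b-d) with d \<le> b and form \<open>v\<close>; the remainder z^(b+1) B becomes the conjugate of
  z B, so \<open>K\<close> vanishes at 0. Thus \<open>v\<close> is the Toeplitz operator with symbol
  cnj h applied to z^b.\<close>

lemma cnj_mult_power_split:
  assumes h: "h holomorphic_on ball 0 R"
  obtains v K where "v holomorphic_on ball 0 R" "K holomorphic_on ball 0 R" "K 0 = 0"
    "\<And>z. norm z = 1 \<Longrightarrow> cnj (h z) * z ^ b = v z + cnj (K z)"
proof -
  define B where "B d = (bshift ^^ d) h" for d
  have B: "B d holomorphic_on ball 0 R" for d
    unfolding B_def by (induction d) (auto intro: h bshift_holomorphic)
  have exp: "h z = (\<Sum>d<l. B d 0 * z ^ d) + z ^ l * B l z" for z l
  proof (induction l)
    case 0
    then show ?case by (simp add: B_def)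
  next
    case (Suc l)
    have "B l z = B l 0 + z * B (Suc l) z"
      using bshift_eq[of "B l" z] by (simp add: B_def)
    with Suc show ?case by (simp add: algebra_simps)
  qed
  show ?thesis
  proof (rule that)
    show "(\<lambda>z. \<Sum>d<Suc b. cnj (B d 0) * z ^ (b - d)) holomorphic_on ball 0 R"
      by (intro holomorphic_intros)
    show "(\<lambda>z. z * B (Suc b) z) holomorphic_on ball 0 R"
      by (intro holomorphic_intros B)
    fix z :: complex assume z: "norm z = 1"
    have zz: "cnj z * z = 1" using z by (simp add: complex_norm_square[symmetric] mult.commute)
    have "cnj (h z) * z ^ b = (\<Sum>d<Suc b. cnj (B d 0) * (cnj z ^ d * z ^ b)) + (cnj z ^ b * z ^ b) * cnj z * cnj (B (Suc b) z)"
      unfolding exp[of z "Suc b"] complex_cnj_add complex_cnj_mult cnj_sum complex_cnj_power distrib_right sum_distrib_right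
      by (simp only: mult_ac power_Suc)
    also have "(\<Sum>d<Suc b. cnj (B d 0) * (cnj z ^ d * z ^ b)) = (\<Sum>d<Suc b. cnj (B d 0) * z ^ (b - d))"
      by (intro sum.cong refl) (simp add: cnj_mult_self_power[OF z])
    finally show "cnj (h z) * z ^ b = (\<Sum>d<Suc b. cnj (B d 0) * z ^ (b - d)) + cnj (z * B (Suc b) z)"
      by (simp add: zz flip: power_mult_distrib)
  qed simp
qed

text \<open>The vanishing means are the first N Taylor coefficients, and each backward shift removes
  one. As an iterated shift, \<open>E\<close> satisfies the factorisation at all z.\<close>

lemma holomorphic_power_factor:
  assumes "F holomorphic_on ball 0 R" "R > 1"
    and "\<And>c. c < N \<Longrightarrow> cmean (\<lambda>z. F z * cnj z ^ c) 1 = 0"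
  shows "\<exists>E. E holomorphic_on ball 0 R \<and> (\<forall>z. F z = z ^ N * E z)"
  using assms
proof (induction N arbitrary: F)
  case 0
  then show ?case by auto
next
  case (Suc N)
  from Suc.prems(3)[of 0] have "F 0 = 0"
    using cmean_holomorphic[OF Suc.prems(1,2)] by simp
  then have F: "F z = z * bshift F z" for z using bshift_eq[of F z] by simp
  have "cmean (\<lambda>z. bshift F z * cnj z ^ c) 1 = 0" if "c < N" for c
  proof -
    have "cmean (\<lambda>z. bshift F z * cnj z ^ c) 1 = cmean (\<lambda>z. F z * cnj z ^ Suc c) 1"
    proof (rule cmean_cong)
      fix z :: complex assume z: "norm z = 1"
      have "z * cnj z = 1" using z by (simp add: complex_norm_square[symmetric])
      then have "z * bshift F z * (cnj z * cnj z ^ c) = bshift F z * cnj z ^ c"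
        by (metis mult.assoc mult.left_commute mult_1)
      then show "bshift F z * cnj z ^ c = F z * cnj z ^ Suc c" using F by simp
    qed simp
    then show ?thesis using Suc.prems(3)[of "Suc c"] that by simp
  qed
  from Suc.IH[OF bshift_holomorphic[OF Suc.prems(1)] Suc.prems(2) this]
  obtain E where "E holomorphic_on ball 0 R" "\<And>z. bshift F z = z ^ N * E z" by blast
  then show ?case using F by (intro exI[of _ E]) (simp add: mult_ac)
qed

context corona_data
begin

text \<open>If T sends (v_i) to \<Sum> h_i v_i, then \<open>v\<close> is the image of
  \<open>k\<close> under the adjoint, and the left side pairs T v with \<open>k\<close>. The cross
  terms v_i K_i are holomorphic and vanish at 0, so their means are 0.\<close>

lemma gram_identity:
  assumes K: "\<And>i. i < n \<Longrightarrow> K i holomorphic_on ball 0 R" "\<And>i. i < n \<Longrightarrow> K i 0 = 0"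
    and v: "\<And>i. i < n \<Longrightarrow> v i holomorphic_on ball 0 R"
    and eq: "\<And>i z. i < n \<Longrightarrow> norm z = 1 \<Longrightarrow> cnj (h i z) * k z = v i z + cnj (K i z)"
  shows "cmean (\<lambda>z. (\<Sum>i<n. h i z * v i z) * cnj (k z)) 1
    = of_real (\<Sum>i<n. cmean (\<lambda>z. (norm (v i z))\<^sup>2) 1)"
proof -
  have c: "continuous_on (cball 0 1) (v i)" "continuous_on (cball 0 1) (K i)" if "i < n" for i
    using cont v K that by auto
  have "cmean (\<lambda>z. (\<Sum>i<n. h i z * v i z) * cnj (k z)) 1
    = cmean (\<lambda>z. \<Sum>i<n. of_real ((norm (v i z))\<^sup>2) + v i z * K i z) 1"
  proof (rule cmean_cong)
    fix z :: complex assume z: "norm z = 1"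
    have "(\<Sum>i<n. h i z * v i z) * cnj (k z) = (\<Sum>i<n. v i z * cnj (cnj (h i z) * k z))"
      unfolding sum_distrib_right by (intro sum.cong) (auto simp: mult_ac)
    also have "\<dots> = (\<Sum>i<n. of_real ((norm (v i z))\<^sup>2) + v i z * K i z)"
      by (intro sum.cong refl) (simp add: eq z distrib_left complex_norm_square[symmetric] del: of_real_power)
    finally show "(\<Sum>i<n. h i z * v i z) * cnj (k z) = (\<Sum>i<n. of_real ((norm (v i z))\<^sup>2) + v i z * K i z)" .
  qed simp
  also have "\<dots> = (\<Sum>i<n. cmean (\<lambda>z. of_real ((norm (v i z))\<^sup>2) + v i z * K i z) 1)"
    by (rule cmean_sum) (auto intro!: continuous_intros c)
  also have "\<dots> = (\<Sum>i<n. of_real (cmean (\<lambda>z. (norm (v i z))\<^sup>2) 1))"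
  proof (intro sum.cong refl)
    fix i assume "i \<in> {..<n}"
    then have i: "i < n" by simp
    have "cmean (\<lambda>z. of_real ((norm (v i z))\<^sup>2) + v i z * K i z) 1
      = cmean (\<lambda>z. of_real ((norm (v i z))\<^sup>2)) 1 + cmean (\<lambda>z. v i z * K i z) 1"
      by (rule cmean_add) (auto intro!: continuous_intros c i)
    also have "cmean (\<lambda>z. v i z * K i z) 1 = 0"
      using cmean_holomorphic[OF holomorphic_on_mult[OF v[OF i] K(1)[OF i]] R] K(2)[OF i] by simp
    also have "cmean (\<lambda>z. complex_of_real ((norm (v i z))\<^sup>2)) 1 = of_real (cmean (\<lambda>z. (norm (v i z))\<^sup>2) 1)"
      by (rule cmean_of_real) (auto intro!: continuous_intros c i)
    finally show "cmean (\<lambda>z. of_real ((norm (v i z))\<^sup>2) + v i z * K i z) 1 = of_real (cmean (\<lambda>z. (norm (v i z))\<^sup>2) 1)"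
      by simp
  qed
  finally show ?thesis by simp
qed

lemma cmean_norm_square_eq_0:
  assumes "f holomorphic_on ball 0 R" "cmean (\<lambda>z. (norm (f z))\<^sup>2) 1 = 0" "norm z = 1"
  shows "f z = 0"
proof -
  have c: "continuous_on {0..2*pi} (\<lambda>t. (norm (f (of_real 1 * cis t)))\<^sup>2)"
    by (rule continuous_on_circle[of "cball 0 1" "\<lambda>z. (norm (f z))\<^sup>2"])
       (auto intro!: continuous_intros cont assms)
  have "((\<lambda>t. (norm (f (of_real 1 * cis t)))\<^sup>2) has_integral 0) (cbox 0 (2*pi))"
    using assms(2) integrable_integral[OF integrable_continuous_real[OF c]] by (simp add: cmean_def)
  then have *: "(norm (f (of_real 1 * cis t)))\<^sup>2 = 0" if "t \<in> cbox 0 (2*pi)" for t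
    using c that by (intro has_integral_0_cbox_imp_0[of 0 "2*pi" "\<lambda>t. (norm (f (of_real 1 * cis t)))\<^sup>2"])
      (auto simp: not_le[THEN iffD2, OF pi_gt_zero])
  obtain t where "0 \<le> t" "t < 2*pi" "z = cis t"
    using assms(3) complex_norm_eq_1_exp_eq
    by (metis Arg2pi_eq Arg2pi_ge_0 Arg2pi_lt_2pi cis_conv_exp mult_1 of_real_1)
  with *[of t] show ?thesis by simp
qed

text \<open>The solution is sought as the adjoint image of a polynomial \<open>k\<close> of degree
  below N. The equation modulo z^N is then a Gram system, and \<open>corona_pairing\<close> bounds
  its solution independently of N.\<close>

lemma truncated_bezout:
  obtains v E where "\<And>i. i < n \<Longrightarrow> v i holomorphic_on ball 0 R" "E holomorphic_on ball 0 R"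
    "\<And>z. (\<Sum>i<n. h i z * v i z) = \<delta> z ^ 6 + z ^ N * E z"
    "(\<Sum>i<n. cmean (\<lambda>z. (norm (v i z))\<^sup>2) 1) \<le> (corona_const n)\<^sup>2"
proof -
  have "\<forall>i b. \<exists>v K. i < n \<longrightarrow> v holomorphic_on ball 0 R \<and> K holomorphic_on ball 0 R \<and> K 0 = 0 \<and>
    (\<forall>z. norm z = 1 \<longrightarrow> cnj (h i z) * z ^ b = v z + cnj (K z))"
    using cnj_mult_power_split[OF h] by metis
  then obtain vv KK where vK: "\<And>i b. i < n \<Longrightarrow> vv i b holomorphic_on ball 0 R"
    "\<And>i b. i < n \<Longrightarrow> KK i b holomorphic_on ball 0 R" "\<And>i b. i < n \<Longrightarrow> KK i b 0 = 0"
    "\<And>i b z. i < n \<Longrightarrow> norm z = 1 \<Longrightarrow> cnj (h i z) * z ^ b = vv i b z + cnj (KK i b z)"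
    by metis
  define k where "k x z = (\<Sum>b<N. x b * z ^ b)" for x and z :: complex
  define v where "v x i z = (\<Sum>b<N. x b * vv i b z)" for x i z
  define K where "K x i z = (\<Sum>b<N. cnj (x b) * KK i b z)" for x i z
  have v: "v x i holomorphic_on ball 0 R" and K: "K x i holomorphic_on ball 0 R" "K x i 0 = 0" if "i < n" for i x
    unfolding v_def K_def using that by (auto intro!: holomorphic_intros vK sum.neutral simp: vK(3))
  have k: "k x holomorphic_on ball 0 R" for x
    unfolding k_def by (intro holomorphic_intros)
  have eq: "cnj (h i z) * k x z = v x i z + cnj (K x i z)" if "i < n" "norm z = 1" for i z x
  proof -
    have "cnj (h i z) * k x z = (\<Sum>b<N. x b * (cnj (h i z) * z ^ b))"
      by (simp add: k_def sum_distrib_left mult_ac)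
    then show ?thesis by (simp add: vK(4) that v_def K_def distrib_left sum.distrib)
  qed
  have cont_h: "continuous_on (cball 0 1) (h i)" "continuous_on (cball 0 1) (v x i)"
     "continuous_on (cball 0 1) (vv i b)" if "i < n" for i x b
    using cont h v vK that by auto
  have gram: "cmean (\<lambda>z. (\<Sum>i<n. h i z * v x i z) * cnj (k x z)) 1
    = of_real (\<Sum>i<n. cmean (\<lambda>z. (norm (v x i z))\<^sup>2) 1)" for x
    by (rule gram_identity[where K="K x"]) (use K v eq in auto)
  \<comment> \<open>Entry (c, b) pairs the image of z^b with z^c; by \<open>gram\<close> the
    quadratic form of this matrix is the squared norm of \<open>v\<close>.\<close>
  define M where "M c b = cmean (\<lambda>z. (\<Sum>i<n. h i z * vv i b z) * cnj z ^ c) 1" for c b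
  have M: "(\<Sum>b<N. M c b * x b) = cmean (\<lambda>z. (\<Sum>i<n. h i z * v x i z) * cnj z ^ c) 1" for c x
  proof -
    have "(\<Sum>b<N. M c b * x b) = (\<Sum>b<N. cmean (\<lambda>z. x b * ((\<Sum>i<n. h i z * vv i b z) * cnj z ^ c)) 1)"
      unfolding M_def cmean_cmult by (simp add: mult.commute)
    also have "\<dots> = cmean (\<lambda>z. \<Sum>b<N. x b * ((\<Sum>i<n. h i z * vv i b z) * cnj z ^ c)) 1"
      by (rule cmean_sum[symmetric]) (auto intro!: continuous_intros cont_h)
    also have "\<dots> = cmean (\<lambda>z. (\<Sum>i<n. h i z * v x i z) * cnj z ^ c) 1"
    proof (rule cmean_cong)
      fix z
      have "(\<Sum>b<N. x b * (\<Sum>i<n. h i z * vv i b z)) = (\<Sum>i<n. h i z * v x i z)"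
        unfolding v_def sum_distrib_left by (subst sum.swap) (simp add: mult_ac)
      from this[symmetric] show "(\<Sum>b<N. x b * ((\<Sum>i<n. h i z * vv i b z) * cnj z ^ c)) = (\<Sum>i<n. h i z * v x i z) * cnj z ^ c"
        by (simp only: sum_distrib_right[where A="{..<N}"] mult.assoc[symmetric])
    qed simp
    finally show ?thesis .
  qed
  have test_k: "cmean (\<lambda>z. F z * cnj (k x z)) 1 = (\<Sum>c<N. cnj (x c) * cmean (\<lambda>z. F z * cnj z ^ c) 1)"
    if "continuous_on (cball 0 1) F" for F x
  proof -
    have "cmean (\<lambda>z. F z * cnj (k x z)) 1 = cmean (\<lambda>z. \<Sum>c<N. cnj (x c) * (F z * cnj z ^ c)) 1"
      by (simp add: k_def sum_distrib_left mult_ac)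
    also have "\<dots> = (\<Sum>c<N. cmean (\<lambda>z. cnj (x c) * (F z * cnj z ^ c)) 1)"
      by (rule cmean_sum) (auto intro!: continuous_intros that)
    finally show ?thesis by (simp only: cmean_cmult)
  qed
  have cont_hv: "continuous_on (cball 0 1) (\<lambda>z. \<Sum>i<n. h i z * v x i z)" for x
    by (auto intro!: continuous_intros cont_h)
  obtain x where x: "\<And>c. c < N \<Longrightarrow> (\<Sum>b<N. M c b * x b) = cmean (\<lambda>z. \<delta> z ^ 6 * cnj z ^ c) 1"
  proof (rule linear_system_solvable[of N M "\<lambda>c. cmean (\<lambda>z. \<delta> z ^ 6 * cnj z ^ c) 1"])
    fix x assume "\<And>c. c < N \<Longrightarrow> (\<Sum>b<N. M c b * x b) = 0"
    then have "cmean (\<lambda>z. (\<Sum>i<n. h i z * v x i z) * cnj (k x z)) 1 = 0"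
      unfolding test_k[OF cont_hv] M by simp
    then have "(\<Sum>i<n. cmean (\<lambda>z. (norm (v x i z))\<^sup>2) 1) = 0"
      unfolding gram by (simp del: of_real_sum)
    then have "\<forall>i<n. cmean (\<lambda>z. (norm (v x i z))\<^sup>2) 1 = 0"
      by (subst (asm) sum_nonneg_eq_0_iff) (auto simp: cmean_norm_square_nonneg)
    then have v0: "v x i z = 0" if "i < n" "norm z = 1" for i z
      using cmean_norm_square_eq_0[OF v] that by blast
    \<comment> \<open>Where \<open>v\<close> vanishes on the circle, h_i cnj k = K_i. Multiplication
      by z^T, with T the degree of \<open>k\<close>, makes both sides holomorphic; comparing values
      at 0 gives h_i 0 cnj (x T) = 0 for all i, against \<open>lower\<close> at 0.\<close>
    show "\<forall>b<N. x b = 0"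
    proof (rule ccontr)
      assume "\<not> (\<forall>b<N. x b = 0)"
      then have ne: "{b. b < N \<and> x b \<noteq> 0} \<noteq> {}" by auto
      define T where "T = Max {b. b < N \<and> x b \<noteq> 0}"
      have T: "T < N" "x T \<noteq> 0" using Max_in[OF _ ne] by (auto simp: T_def)
      have Tmax: "x b = 0" if "b < N" "b > T" for b
        using that Max_ge[of "{b. b < N \<and> x b \<noteq> 0}" b] unfolding T_def by fastforce
      have "h i 0 = 0" if i: "i < n" for i
      proof -
        let ?p = "\<lambda>z. h i z * (\<Sum>b\<in>{..T}. cnj (x b) * z ^ (T - b))"
        have "cmean ?p 1 = cmean (\<lambda>z. z ^ T * K x i z) 1"
        proof (rule cmean_cong)
          fix z :: complex assume z: "norm z = 1"
          have "(\<Sum>b\<in>{..T}. cnj (x b) * z ^ (T - b)) = (\<Sum>b\<in>{..T}. cnj (x b) * (cnj z ^ b * z ^ T))"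
            by (intro sum.cong refl) (simp add: cnj_mult_self_power[OF z])
          also have "\<dots> = (\<Sum>b<N. cnj (x b) * (cnj z ^ b * z ^ T))"
            using T Tmax by (intro sum.mono_neutral_left) auto
          also have "\<dots> = cnj (k x z) * z ^ T" by (simp add: k_def sum_distrib_right mult.assoc)
          finally have "?p z = cnj (cnj (h i z) * k x z) * z ^ T" by (simp add: mult_ac)
          also have "\<dots> = z ^ T * K x i z" by (simp add: eq[OF i z] v0[OF i z])
          finally show "?p z = z ^ T * K x i z" .
        qed simp
        also have "\<dots> = 0"
          by (subst cmean_holomorphic[OF _ R]) (auto intro!: holomorphic_intros K simp: K i)
        also have "cmean ?p 1 = 2 * pi * (h i 0 * (\<Sum>b\<in>{..T}. cnj (x b) * 0 ^ (T - b)))"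
          by (rule cmean_holomorphic[OF _ R]) (intro holomorphic_intros h i)
        also have "(\<Sum>b\<in>{..T}. cnj (x b) * 0 ^ (T - b)) = (\<Sum>b\<in>{T}. cnj (x b))"
          by (intro sum.mono_neutral_cong_right) auto
        finally show ?thesis using T by simp
      qed
      then show False using lower[of 0] \<delta>_nz[of 0] R by simp
    qed
  qed (use that in blast)
  define F where "F z = (\<Sum>i<n. h i z * v x i z) - \<delta> z ^ 6" for z
  have cF: "F holomorphic_on ball 0 R"
    unfolding F_def by (intro holomorphic_intros h v \<delta>) auto
  have c\<delta>: "continuous_on (cball 0 1) \<delta>" using cont[OF \<delta>] by simp
  have "cmean (\<lambda>z. F z * cnj z ^ c) 1 = 0" if "c < N" for c
  proof -
    have "cmean (\<lambda>z. (\<Sum>i<n. h i z * v x i z) * cnj z ^ c) 1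
      = cmean (\<lambda>z. F z * cnj z ^ c + \<delta> z ^ 6 * cnj z ^ c) 1"
      by (rule cmean_cong) (auto simp: F_def algebra_simps)
    also have "\<dots> = cmean (\<lambda>z. F z * cnj z ^ c) 1 + cmean (\<lambda>z. \<delta> z ^ 6 * cnj z ^ c) 1"
      using cont(1)[OF cF] c\<delta> by (intro cmean_add continuous_intros) auto
    finally show ?thesis using x[OF that] M by simp
  qed
  from holomorphic_power_factor[OF cF R this] obtain E where
    E: "E holomorphic_on ball 0 R" "\<And>z. F z = z ^ N * E z" by blast
  \<comment> \<open>The error \<open>F\<close> is orthogonal to \<open>k\<close>, so the squared
    norm Y of \<open>v\<close> equals the pairing of \<open>k\<close> with \<delta>^6. This pairing
    is of degree one in \<open>k\<close>; scaling by 1 / sqrt Y normalises \<open>v\<close> and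
    yields sqrt Y \<le> \<open>corona_const n\<close>.\<close>
  define Y where "Y = (\<Sum>i<n. cmean (\<lambda>z. (norm (v x i z))\<^sup>2) 1)"
  have Y0: "Y \<ge> 0" unfolding Y_def by (intro sum_nonneg cmean_norm_square_nonneg)
  have "of_real Y = cmean (\<lambda>z. (\<Sum>i<n. h i z * v x i z) * cnj (k x z)) 1"
    unfolding Y_def using gram by simp
  also have "\<dots> = cmean (\<lambda>z. \<delta> z ^ 6 * cnj (k x z)) 1"
  proof -
    have "continuous_on (cball 0 1) (\<lambda>z. \<delta> z ^ 6)" by (intro continuous_intros c\<delta>)
    then show ?thesis using x M by (simp add: test_k cont_hv)
  qed
  finally have Y: "of_real Y = cmean (\<lambda>z. cnj (k x z) * \<delta> z ^ 6) 1" by (simp add: mult.commute)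
  have "Y \<le> (corona_const n)\<^sup>2"
  proof (cases "Y = 0")
    case False
    then have Yp: "Y > 0" using Y0 by simp
    define q where "q = complex_of_real (1 / sqrt Y)"
    have nq: "norm q = 1 / sqrt Y" "cnj q = q" using Y0 by (auto simp: q_def norm_divide)
    have "norm (cmean (\<lambda>z. cnj (q * k x z) * \<delta> z ^ 6) 1) \<le> corona_const n"
    proof (rule corona_pairing[where K="\<lambda>i z. q * K x i z" and v="\<lambda>i z. q * v x i z"])
      show "(\<Sum>i<n. cmean (\<lambda>z. (norm (q * v x i z))\<^sup>2) 1) \<le> 1"
      proof -
        have "(\<Sum>i<n. cmean (\<lambda>z. (norm (q * v x i z))\<^sup>2) 1) = (norm q)\<^sup>2 * Y"
          by (simp only: norm_mult power_mult_distrib cmean_cmult Y_def sum_distrib_left)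
        also have "\<dots> = 1" using Yp by (simp add: nq power_divide)
        finally show ?thesis by simp
      qed
      fix i z assume "i < n" "norm (z::complex) = 1"
      from eq[OF this] show "cnj (h i z) * (q * k x z) = q * v x i z + cnj (q * K x i z)"
        by (simp add: nq(2) algebra_simps)
    qed (auto intro!: holomorphic_intros K v k simp: K)
    also have "cmean (\<lambda>z. cnj (q * k x z) * \<delta> z ^ 6) 1 = cnj q * cmean (\<lambda>z. cnj (k x z) * \<delta> z ^ 6) 1"
      by (simp only: complex_cnj_mult mult.assoc cmean_cmult)
    also have "norm \<dots> = Y / sqrt Y"
      unfolding Y[symmetric] nq(2) norm_mult nq(1) using Y0 by simp
    also have "\<dots> = sqrt Y" using Yp by (simp add: real_div_sqrt)
    finally have "(sqrt Y)\<^sup>2 \<le> (corona_const n)\<^sup>2"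
      using Y0 by (intro power_mono) auto
    then show ?thesis using Y0 by simp
  qed simp
  then show ?thesis
    using E by (intro that[of "v x" E] v) (auto simp: F_def Y_def algebra_simps)
qed

end

section \<open>Growth of circle means\<close>

text \<open>For the real part M of the mean, g = r M' / 2 vanishes at r = 0 and has derivative 2 r
  Re (\<open>cmean c r\<close>) \<ge> 0. Hence g \<ge> 0 and M' \<ge> 0.\<close>

lemma cmean_mono_subharmonic:
  fixes f a b c e :: "complex \<Rightarrow> complex"
  assumes f: "wirtinger_on (ball 0 R) f a b" and b: "wirtinger_on (ball 0 R) b c e"
    and c: "\<And>z. z \<in> ball 0 R \<Longrightarrow> 0 \<le> Re (c z)"
    and r: "0 < r" "r \<le> r'" "r' < R"
  shows "Re (cmean f r) \<le> Re (cmean f r')"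
proof -
  have cont: "continuous_on (ball 0 R) b" "continuous_on (ball 0 R) f" "continuous_on (ball 0 R) c"
    using wirtinger_on_imp_continuous_on[OF b] wirtinger_on_imp_continuous_on[OF f] b
    by (simp_all add: wirtinger_on_def)
  have c_nonneg: "0 \<le> Re (cmean c x)" if "x \<in> {0<..<R}" for x
  proof -
    have i: "(\<lambda>t. c (of_real x * cis t)) integrable_on {0..2*pi}"
      by (rule integrable_circle[OF cont(3)]) (use that in auto)
    have "Re (cmean c x) = integral {0..2*pi} (\<lambda>t. Re (c (of_real x * cis t)))"
      unfolding cmean_def using integral_linear[OF i bounded_linear_Re] by (simp add: o_def)
    moreover have "0 \<le> integral {0..2*pi} (\<lambda>t. Re (c (of_real x * cis t)))"
      using integrable_linear[OF i bounded_linear_Re] that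
      by (intro integral_nonneg) (auto simp: o_def intro!: c)
    ultimately show ?thesis by simp
  qed
  define g where "g x = Re (cmean (\<lambda>z. b z * cnj z) x)" for x
  have dg: "(g has_field_derivative (2 * x * Re (cmean c x))) (at x)" if "x \<in> {0<..<R}" for x
    unfolding g_def[abs_def] has_field_derivative_def
    by (rule has_derivative_eq_rhs[OF has_derivative_Re[OF
          cmean_dbar_has_derivative[OF b that, unfolded has_vector_derivative_def]]])
       (simp add: fun_eq_iff)
  have cg: "continuous_on {0..<R} g"
    unfolding g_def[abs_def]
    by (intro continuous_intros continuous_on_cmean[where S="ball 0 R"] cont) auto
  have g_nonneg: "0 \<le> g x" if "x \<in> {0<..<R}" for x
  proof -
    have "g 0 \<le> g x"
    proof (rule DERIV_nonneg_imp_increasing_open[where f=g])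
      show "continuous_on {0..x} g" by (rule continuous_on_subset[OF cg]) (use that in auto)
      fix y assume "0 < y" "y < x"
      then show "\<exists>d. (g has_real_derivative d) (at y) \<and> 0 \<le> d"
        using dg[of y] c_nonneg[of y] that by (intro exI[of _ "2 * y * Re (cmean c y)"]) auto
    qed (use that in auto)
    then show ?thesis by (simp add: g_def cmean_def)
  qed
  show ?thesis
  proof (rule DERIV_nonneg_imp_nondecreasing[where f="\<lambda>x. Re (cmean f x)", OF r(2)])
    fix x assume "r \<le> x" "x \<le> r'"
    then have x: "x \<in> {0<..<R}" using r by auto
    have "((\<lambda>x. Re (cmean f x)) has_field_derivative (2 * g x / x)) (at x)"
      unfolding has_field_derivative_def g_def
      by (rule has_derivative_eq_rhs[OF has_derivative_Re[OF
            cmean_has_derivative[OF f x, unfolded has_vector_derivative_def]]])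
         (simp add: fun_eq_iff field_simps)
    then show "\<exists>y. ((\<lambda>x. Re (cmean f x)) has_real_derivative y) (at x) \<and> 0 \<le> y"
      using g_nonneg[OF x] x by (intro exI[of _ "2 * g x / x"]) auto
  qed
qed

lemma cmean_of_real_ball:
  assumes "continuous_on (ball 0 R) F" "0 \<le> r" "r < R"
  shows "cmean (\<lambda>z. complex_of_real (F z)) r = of_real (cmean F r)"
proof -
  have "(\<lambda>t. F (of_real r * cis t)) integrable_on {0..2*pi}"
    by (rule integrable_circle[OF assms(1)]) (use assms in auto)
  from has_integral_of_real[OF integrable_integral[OF this], where 'b=complex] show ?thesis
    unfolding cmean_def by (rule integral_unique)
qed

lemma cmean_norm_square_mono:
  assumes f: "f holomorphic_on ball 0 R" and r: "0 < r" "r \<le> r'" "r' < R"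
  shows "cmean (\<lambda>z. (norm (f z))\<^sup>2) r \<le> cmean (\<lambda>z. (norm (f z))\<^sup>2) r'"
proof -
  note w = wirtinger_on_holomorphic[OF f open_ball] wirtinger_on_cnj_holomorphic[OF f open_ball]
  have f': "deriv f holomorphic_on ball 0 R" using f by (intro holomorphic_deriv) auto
  note w' = wirtinger_on_cnj_holomorphic[OF f' open_ball]
  have w1: "wirtinger_on (ball 0 R) (\<lambda>z. of_real ((norm (f z))\<^sup>2)) (\<lambda>z. deriv f z * cnj (f z)) (\<lambda>z. f z * cnj (deriv f z))"
    using wirtinger_on_mult[OF w] by (simp only: complex_norm_square) simp
  have w2: "wirtinger_on (ball 0 R) (\<lambda>z. f z * cnj (deriv f z))
      (\<lambda>z. of_real ((norm (deriv f z))\<^sup>2)) (\<lambda>z. f z * cnj (deriv (deriv f) z))"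
    using wirtinger_on_mult[OF w(1) w'] by (simp only: complex_norm_square) simp
  have c: "continuous_on (ball 0 R) (\<lambda>z. (norm (f z))\<^sup>2)"
    using holomorphic_on_imp_continuous_on[OF f] by (intro continuous_intros)
  show ?thesis
    using cmean_mono_subharmonic[OF w1 w2 _ r] r
    by (simp add: cmean_of_real_ball[OF c] del: of_real_power)
qed

lemma wirtinger_on_powr:
  assumes P: "P holomorphic_on ball 0 R" and pos: "\<And>z. z \<in> ball 0 R \<Longrightarrow> 0 < Re (P z)"
  shows "wirtinger_on (ball 0 R) (\<lambda>z. of_real (Re (P z) powr q))
    (\<lambda>z. of_real (q / 2 * Re (P z) powr (q - 1)) * deriv P z)
    (\<lambda>z. of_real (q / 2 * Re (P z) powr (q - 1)) * cnj (deriv P z))"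
  unfolding wirtinger_on_def
proof (intro conjI ballI)
  have c: "continuous_on (ball 0 R) P" "continuous_on (ball 0 R) (deriv P)"
    using holomorphic_on_imp_continuous_on[OF P]
     holomorphic_on_imp_continuous_on[OF holomorphic_deriv[OF P open_ball]] by auto
  have c': "continuous_on (ball 0 R) (\<lambda>z. Re (P z) powr (q - 1))"
    using pos by (intro continuous_on_powr continuous_intros c) fastforce
  show "continuous_on (ball 0 R) (\<lambda>z. of_real (q / 2 * Re (P z) powr (q - 1)) * deriv P z)"
    "continuous_on (ball 0 R) (\<lambda>z. of_real (q / 2 * Re (P z) powr (q - 1)) * cnj (deriv P z))"
    by (intro continuous_intros c c')+
  fix z :: complex assume z: "z \<in> ball 0 R"
  have "(P has_derivative (\<lambda>w. deriv P z * w)) (at z)"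
    using holomorphic_derivI[OF P open_ball z] by (simp add: has_field_derivative_def)
  from has_derivative_Re[OF this] have 1: "((\<lambda>z. Re (P z)) has_derivative (\<lambda>w. Re (deriv P z * w))) (at z)" .
  have 2: "((\<lambda>x. x powr q) has_derivative (\<lambda>y. q * Re (P z) powr (q - 1) * y)) (at (Re (P z)))"
    using has_real_derivative_powr[OF pos[OF z], of q] by (simp add: has_field_derivative_def)
  have "((\<lambda>z. complex_of_real (Re (P z) powr q)) has_derivative
     (\<lambda>w. complex_of_real (q * Re (P z) powr (q - 1) * Re (deriv P z * w)))) (at z)"
    by (intro has_derivative_of_real) (use has_derivative_compose[OF 1 2] in simp)
  moreover have "complex_of_real (q * Re (P z) powr (q - 1) * Re (deriv P z * w))
     = of_real (q / 2 * Re (P z) powr (q - 1)) * deriv P z * w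
     + of_real (q / 2 * Re (P z) powr (q - 1)) * cnj (deriv P z) * cnj w" for w
  proof -
    have *: "complex_of_real (Re (deriv P z * w)) = (deriv P z * w + cnj (deriv P z * w)) / 2"
      by (simp add: complex_eq_iff)
    show ?thesis
      unfolding of_real_mult[of "q * Re (P z) powr (q - 1)" "Re (deriv P z * w)"] *
      by (simp add: field_simps)
  qed
  ultimately show "((\<lambda>z. complex_of_real (Re (P z) powr q)) has_derivative
     (\<lambda>w. of_real (q / 2 * Re (P z) powr (q - 1)) * deriv P z * w
     + of_real (q / 2 * Re (P z) powr (q - 1)) * cnj (deriv P z) * cnj w)) (at z)"
    by simp
qed

text \<open>The mixed derivative of (Re P)^p is p (p - 1) / 4 (Re P)^(p-2) |P'|^2, nonnegative for p
  \<ge> 1. Strict positivity of Re P keeps the powers smooth.\<close>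

lemma cmean_powr_mono:
  assumes P: "P holomorphic_on ball 0 R" and pos: "\<And>z. z \<in> ball 0 R \<Longrightarrow> 0 < Re (P z)"
    and "p \<ge> 1" and r: "0 < r" "r \<le> r'" "r' < R"
  shows "cmean (\<lambda>z. Re (P z) powr p) r \<le> cmean (\<lambda>z. Re (P z) powr p) r'"
proof -
  have P': "deriv P holomorphic_on ball 0 R" using P by (intro holomorphic_deriv) auto
  have "wirtinger_on (ball 0 R) (\<lambda>z. of_real (p / 2) * (of_real (Re (P z) powr (p - 1)) * cnj (deriv P z)))
    (\<lambda>z. of_real (p / 2) * (of_real ((p - 1) / 2 * Re (P z) powr (p - 1 - 1)) * deriv P z * cnj (deriv P z)))
    (\<lambda>z. of_real (p / 2) * (of_real ((p - 1) / 2 * Re (P z) powr (p - 1 - 1)) * cnj (deriv P z) * cnj (deriv P z)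
        + of_real (Re (P z) powr (p - 1)) * cnj (deriv (deriv P) z)))"
    using wirtinger_on_mult[OF wirtinger_on_const[of _ "of_real (p / 2)"]
       wirtinger_on_mult[OF wirtinger_on_powr[OF P pos, of "p - 1"] wirtinger_on_cnj_holomorphic[OF P' open_ball]]] by simp
  then have w2: "wirtinger_on (ball 0 R) (\<lambda>z. of_real (p / 2 * Re (P z) powr (p - 1)) * cnj (deriv P z))
    (\<lambda>z. of_real (p / 2 * ((p - 1) / 2) * Re (P z) powr (p - 1 - 1) * (norm (deriv P z))\<^sup>2))
    (\<lambda>z. of_real (p / 2) * (of_real ((p - 1) / 2 * Re (P z) powr (p - 1 - 1)) * cnj (deriv P z) * cnj (deriv P z)
        + of_real (Re (P z) powr (p - 1)) * cnj (deriv (deriv P) z)))"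
    by (simp only: of_real_mult mult.assoc complex_norm_square)
  have c: "continuous_on (ball 0 R) (\<lambda>z. Re (P z) powr p)"
    using pos by (intro continuous_on_powr continuous_intros holomorphic_on_imp_continuous_on[OF P]) fastforce
  have "Re (cmean (\<lambda>z. of_real (Re (P z) powr p)) r) \<le> Re (cmean (\<lambda>z. of_real (Re (P z) powr p)) r')"
  proof (rule cmean_mono_subharmonic[OF wirtinger_on_powr[OF P pos] w2 _ r])
    fix z
    show "0 \<le> Re (of_real (p / 2 * ((p - 1) / 2) * Re (P z) powr (p - 1 - 1) * (norm (deriv P z))\<^sup>2))"
      unfolding Re_complex_of_real using \<open>p \<ge> 1\<close> by (intro mult_nonneg_nonneg) auto
  qed
  then show ?thesis using r by (simp add: cmean_of_real_ball[OF c])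
qed

text \<open>The conjugate of the Szego kernel 1 / (1 - cnj z \<zeta>) is \<zeta> / (\<zeta> - z) on
  the circle, so the mean against it reproduces f z. The kernel is at most 1 / (1 - |z|), and |f|
  \<le> 1 + |f|^2 is used in place of Cauchy-Schwarz.\<close>

lemma norm_le_cmean_norm_square:
  assumes f: "f holomorphic_on ball 0 R" and "R > 1" and z: "norm z < 1"
  shows "2 * pi * norm (f z) \<le> (2 * pi + cmean (\<lambda>z. (norm (f z))\<^sup>2) 1) / (1 - norm z)"
proof -
  define q where "q \<zeta> = (if \<zeta> = z then deriv f z else (f \<zeta> - f z) / (\<zeta> - z))" for \<zeta>
  have q: "q holomorphic_on ball 0 R"
    unfolding q_def[abs_def] by (rule pole_lemma_open[OF f open_ball])
  have ne: "\<zeta> \<noteq> z" if "norm \<zeta> = 1" for \<zeta> using that z by auto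
  note c = continuous_on_cball_holomorphic[OF f \<open>R > 1\<close>] continuous_on_cball_holomorphic[OF q \<open>R > 1\<close>]
  define k where "k \<zeta> = inverse (1 - cnj z * \<zeta>)" for \<zeta>
  have nzk: "1 - cnj z * \<zeta> \<noteq> 0" if "norm \<zeta> * norm z < 1" for \<zeta>
  proof
    assume "1 - cnj z * \<zeta> = 0"
    then have "norm (cnj z * \<zeta>) = norm (1::complex)" by (metis eq_iff_diff_eq_0)
    with that show False by (simp add: norm_mult mult.commute)
  qed
  \<comment> \<open>The maximum with 1/2 avoids a division by zero at z = 0.\<close>
  define R' where "R' = 1 / (max (norm z) (1/2))"
  have R': "R' > 1" using z by (simp add: R'_def field_simps)
  have kR: "norm \<zeta> * norm z < 1" if "norm \<zeta> < R'" for \<zeta> :: complex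
  proof -
    have "norm \<zeta> * norm z \<le> norm \<zeta> * max (norm z) (1/2)" by (intro mult_left_mono) auto
    also have "\<dots> < 1" using that by (simp add: R'_def pos_less_divide_eq less_max_iff_disj)
    finally show ?thesis .
  qed
  have khol: "k holomorphic_on ball 0 R'"
    unfolding k_def using nzk kR by (intro holomorphic_intros) auto
  note ck = continuous_on_cball_holomorphic[OF khol R']
  have 1: "cmean (\<lambda>\<zeta>. cnj (k \<zeta>)) 1 = 2 * pi"
  proof -
    have "cmean (\<lambda>\<zeta>. cnj (k \<zeta>)) 1 = cnj (cmean k 1)"
      unfolding cmean_def by (simp add: integral_cnj)
    also have "cmean k 1 = 2 * pi"
      using cmean_holomorphic[OF khol R'] by (simp add: k_def)
    finally show ?thesis by simp
  qed
  have kid: "cnj (k \<zeta>) = \<zeta> / (\<zeta> - z)" if "norm \<zeta> = 1" for \<zeta>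
  proof -
    have "cnj \<zeta> * \<zeta> = 1" using that by (simp add: complex_norm_square[symmetric] mult.commute)
    then have "(1 - z * cnj \<zeta>) * \<zeta> = \<zeta> - z" by (simp add: algebra_simps)
    moreover have "\<zeta> \<noteq> 0" using that by auto
    ultimately have "1 - z * cnj \<zeta> = (\<zeta> - z) / \<zeta>" by (simp add: field_simps)
    then show ?thesis by (simp add: k_def inverse_eq_divide)
  qed
  have "0 = cmean (\<lambda>\<zeta>. \<zeta> * q \<zeta>) 1"
    by (subst cmean_holomorphic[OF _ \<open>R > 1\<close>]) (auto intro!: holomorphic_intros q)
  also have "\<dots> = cmean (\<lambda>\<zeta>. f \<zeta> * cnj (k \<zeta>) + (- f z) * cnj (k \<zeta>)) 1"
  proof (rule cmean_cong)
    fix \<zeta> :: complex assume n: "norm \<zeta> = 1"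
    show "\<zeta> * q \<zeta> = f \<zeta> * cnj (k \<zeta>) + (- f z) * cnj (k \<zeta>)"
      using ne[OF n] by (simp add: q_def kid[OF n] diff_divide_distrib algebra_simps)
  qed simp
  also have "\<dots> = cmean (\<lambda>\<zeta>. f \<zeta> * cnj (k \<zeta>)) 1 + cmean (\<lambda>\<zeta>. (- f z) * cnj (k \<zeta>)) 1"
    by (rule cmean_add) (intro continuous_intros c ck | simp)+
  also have "cmean (\<lambda>\<zeta>. (- f z) * cnj (k \<zeta>)) 1 = - f z * (2 * pi)"
    by (simp only: cmean_cmult 1)
  finally have "cmean (\<lambda>\<zeta>. f \<zeta> * cnj (k \<zeta>)) 1 = 2 * pi * f z" by (simp add: mult_ac)
  then have "2 * pi * norm (f z) = norm (cmean (\<lambda>\<zeta>. f \<zeta> * cnj (k \<zeta>)) 1)"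
    by (simp add: norm_mult)
  also have "\<dots> \<le> cmean (\<lambda>\<zeta>. 1 / (1 - norm z) * (1 + (norm (f \<zeta>))\<^sup>2)) 1"
  proof (rule norm_cmean_le)
    fix \<zeta> :: complex assume n: "norm \<zeta> = 1"
    have "1 - norm z \<le> norm (1 - cnj z * \<zeta>)"
      using norm_triangle_ineq2[of 1 "cnj z * \<zeta>"] n by (simp add: norm_mult)
    then have "norm (k \<zeta>) \<le> 1 / (1 - norm z)"
      using z unfolding k_def norm_inverse by (simp add: inverse_eq_divide frac_le)
    moreover have "norm (f \<zeta>) \<le> 1 + (norm (f \<zeta>))\<^sup>2"
      using sum_squares_bound[of 1 "norm (f \<zeta>)"] norm_ge_zero[of "f \<zeta>"]
      unfolding power_one mult_1_right by linarith
    ultimately have "norm (f \<zeta>) * norm (k \<zeta>) \<le> (1 + (norm (f \<zeta>))\<^sup>2) * (1 / (1 - norm z))"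
      by (intro mult_mono) auto
    then show "norm (f \<zeta> * cnj (k \<zeta>)) \<le> 1 / (1 - norm z) * (1 + (norm (f \<zeta>))\<^sup>2)"
      by (simp add: norm_mult)
  qed (intro continuous_intros c ck | simp)+
  also have "\<dots> = 1 / (1 - norm z) * (2 * pi + cmean (\<lambda>\<zeta>. (norm (f \<zeta>))\<^sup>2) 1)"
  proof -
    have "cmean (\<lambda>\<zeta>. 1 + (norm (f \<zeta>))\<^sup>2) 1 = cmean (\<lambda>\<zeta>. 1) 1 + cmean (\<lambda>\<zeta>. (norm (f \<zeta>))\<^sup>2) 1"
      by (rule cmean_add) (intro continuous_intros c | simp)+
    then show ?thesis by (simp only: cmean_cmult cmean_const mult_1_right)
  qed
  finally show ?thesis by (simp add: field_simps)
qed

section \<open>The Bezout equation in the Hardy space\<close>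

text \<open>Subsequences are refined one index at a time, so a single one serves all i.\<close>

lemma Montel_finite:
  fixes F :: "nat \<Rightarrow> nat \<Rightarrow> complex \<Rightarrow> complex"
  assumes "open S"
    and hol: "\<And>i N. i < n \<Longrightarrow> F i N holomorphic_on S"
    and bnd: "\<And>i K. i < n \<Longrightarrow> compact K \<Longrightarrow> K \<subseteq> S \<Longrightarrow> \<exists>B. \<forall>N. \<forall>z\<in>K. norm (F i N z) \<le> B"
  shows "\<exists>G r. strict_mono (r :: nat \<Rightarrow> nat) \<and> (\<forall>i<n. G i holomorphic_on S \<and>
    (\<forall>K. compact K \<and> K \<subseteq> S \<longrightarrow> uniform_limit K (\<lambda>N. F i (r N)) (G i) sequentially))"
  using hol bnd
proof (induction n)
  case 0
  then show ?case by (auto intro: exI[of _ id] simp: strict_mono_def)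
next
  case (Suc n)
  have "\<exists>G r. strict_mono (r :: nat \<Rightarrow> nat) \<and> (\<forall>i<n. G i holomorphic_on S \<and>
    (\<forall>K. compact K \<and> K \<subseteq> S \<longrightarrow> uniform_limit K (\<lambda>N. F i (r N)) (G i) sequentially))"
    using Suc.prems by (intro Suc.IH) auto
  then obtain G r where r: "strict_mono (r :: nat \<Rightarrow> nat)" and *: "\<forall>i<n. G i holomorphic_on S \<and>
    (\<forall>K. compact K \<and> K \<subseteq> S \<longrightarrow> uniform_limit K (\<lambda>N. F i (r N)) (G i) sequentially)"
    by blast
  then have G: "\<And>i. i < n \<Longrightarrow> G i holomorphic_on S"
    "\<And>i K. i < n \<Longrightarrow> compact K \<Longrightarrow> K \<subseteq> S \<Longrightarrow> uniform_limit K (\<lambda>N. F i (r N)) (G i) sequentially"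
    by blast+
  obtain g q where g: "g holomorphic_on S" "strict_mono (q :: nat \<Rightarrow> nat)"
    "\<And>K. compact K \<Longrightarrow> K \<subseteq> S \<Longrightarrow> uniform_limit K ((\<lambda>N. F n (r N)) \<circ> q) g sequentially"
  proof (rule Montel[OF \<open>open S\<close>, of "range (F n)" "\<lambda>N. F n (r N)"])
    fix K assume "compact K" "K \<subseteq> S"
    then show "\<exists>B. \<forall>h\<in>range (F n). \<forall>z\<in>K. norm (h z) \<le> B"
      using Suc.prems(2)[of n K] by blast
  qed (use Suc.prems(1)[of n] that in auto)
  define G' where "G' i = (if i < n then G i else g)" for i
  have "uniform_limit K (\<lambda>N. F i ((r \<circ> q) N)) (G' i) sequentially" if "i < Suc n" "compact K" "K \<subseteq> S" for i K
  proof (cases "i < n")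
    case True
    from filterlim_compose[OF G(2)[OF True that(2,3)] filterlim_subseq[OF g(2)]]
    show ?thesis using True by (simp add: G'_def o_def)
  next
    case False
    then show ?thesis using g(3)[OF that(2,3)] that(1) by (simp add: G'_def o_def less_Suc_eq)
  qed
  then show ?case
    using strict_mono_o[OF r g(2)] G(1) g(1)
    by (intro exI[of _ G'] exI[of _ "r \<circ> q"]) (auto simp: G'_def less_Suc_eq o_def)
qed

text \<open>The dilated problems are solved modulo z^N with a bound depending on n only. Point
  evaluations are bounded in mean-square norm, so the solutions form a normal family, and the
  remainders z^N E_N tend to 0 pointwise.\<close>

theorem corona_H2:
  fixes h :: "nat \<Rightarrow> complex \<Rightarrow> complex" and \<delta> :: "complex \<Rightarrow> complex"
  assumes h: "\<And>i. i < n \<Longrightarrow> h i holomorphic_on ball 0 1"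
    and \<delta>: "\<delta> holomorphic_on ball 0 1"
    and h_le: "\<And>i z. i < n \<Longrightarrow> z \<in> ball 0 1 \<Longrightarrow> norm (h i z) \<le> 1"
    and \<delta>_le: "\<And>z. z \<in> ball 0 1 \<Longrightarrow> norm (\<delta> z) \<le> 1"
    and \<delta>_nz: "\<And>z. z \<in> ball 0 1 \<Longrightarrow> \<delta> z \<noteq> 0"
    and lower: "\<And>z. z \<in> ball 0 1 \<Longrightarrow> (norm (\<delta> z))\<^sup>2 \<le> (\<Sum>i<n. (norm (h i z))\<^sup>2)"
  shows "\<exists>G B. (\<forall>i<n. G i holomorphic_on ball 0 1) \<and>
    (\<forall>z\<in>ball 0 1. (\<Sum>i<n. h i z * G i z) = \<delta> z ^ 6) \<and>
    (\<forall>i<n. \<forall>r\<in>{0<..<1}. cmean (\<lambda>z. (norm (G i z))\<^sup>2) r \<le> B)"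
proof -
  define \<rho> where "\<rho> N = real (Suc N) / real (Suc (Suc N))" for N
  have \<rho>: "0 < \<rho> N" "\<rho> N < 1" for N by (auto simp: \<rho>_def field_simps)
  have \<rho>_lim: "\<rho> \<longlonglongrightarrow> 1"
    unfolding \<rho>_def[abs_def] by real_asymp
  have inball: "of_real (\<rho> N) * z \<in> ball 0 1" if "z \<in> ball 0 (1 / \<rho> N)" for z :: complex and N
    using that \<rho>[of N] by (simp add: norm_mult pos_less_divide_eq mult.commute)
  have data: "corona_data n (1 / \<rho> N) (\<lambda>i z. h i (of_real (\<rho> N) * z)) (\<lambda>z. \<delta> (of_real (\<rho> N) * z))" for N
  proof
    show "1 / \<rho> N > 1" using \<rho>[of N] by simp
    show "(\<lambda>z. \<delta> (of_real (\<rho> N) * z)) holomorphic_on ball 0 (1 / \<rho> N)"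
      using inball by (intro holomorphic_on_compose_gen[OF _ \<delta>, unfolded o_def] holomorphic_intros) auto
    show "(\<lambda>z. h i (of_real (\<rho> N) * z)) holomorphic_on ball 0 (1 / \<rho> N)" if "i < n" for i
      using inball by (intro holomorphic_on_compose_gen[OF _ h[OF that], unfolded o_def] holomorphic_intros) auto
  qed (use h_le \<delta>_le \<delta>_nz lower inball in blast)+
  define C where "C = (corona_const n)\<^sup>2"
  have "\<forall>N. \<exists>v E. (\<forall>i<n. v i holomorphic_on ball 0 (1 / \<rho> N)) \<and> E holomorphic_on ball 0 (1 / \<rho> N) \<and>
    (\<forall>z. (\<Sum>i<n. h i (of_real (\<rho> N) * z) * v i z) = \<delta> (of_real (\<rho> N) * z) ^ 6 + z ^ N * E z) \<and>
    (\<Sum>i<n. cmean (\<lambda>z. (norm (v i z))\<^sup>2) 1) \<le> C"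
  proof
    fix N
    obtain v E where "\<And>i. i < n \<Longrightarrow> v i holomorphic_on ball 0 (1 / \<rho> N)" "E holomorphic_on ball 0 (1 / \<rho> N)"
      "\<And>z. (\<Sum>i<n. h i (of_real (\<rho> N) * z) * v i z) = \<delta> (of_real (\<rho> N) * z) ^ 6 + z ^ N * E z"
      "(\<Sum>i<n. cmean (\<lambda>z. (norm (v i z))\<^sup>2) 1) \<le> (corona_const n)\<^sup>2"
      using corona_data.truncated_bezout[OF data[of N], of N] by blast
    then show "\<exists>v E. (\<forall>i<n. v i holomorphic_on ball 0 (1 / \<rho> N)) \<and> E holomorphic_on ball 0 (1 / \<rho> N) \<and>
      (\<forall>z. (\<Sum>i<n. h i (of_real (\<rho> N) * z) * v i z) = \<delta> (of_real (\<rho> N) * z) ^ 6 + z ^ N * E z) \<and>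
      (\<Sum>i<n. cmean (\<lambda>z. (norm (v i z))\<^sup>2) 1) \<le> C"
      unfolding C_def by (intro exI[of _ v] exI[of _ E]) blast
  qed
  from choice[OF this] obtain v where "\<forall>N. \<exists>E. (\<forall>i<n. v N i holomorphic_on ball 0 (1 / \<rho> N)) \<and> E holomorphic_on ball 0 (1 / \<rho> N) \<and>
    (\<forall>z. (\<Sum>i<n. h i (of_real (\<rho> N) * z) * v N i z) = \<delta> (of_real (\<rho> N) * z) ^ 6 + z ^ N * E z) \<and>
    (\<Sum>i<n. cmean (\<lambda>z. (norm (v N i z))\<^sup>2) 1) \<le> C" by (rule exE)
  from choice[OF this] obtain E where
    *: "\<forall>N. (\<forall>i<n. v N i holomorphic_on ball 0 (1 / \<rho> N)) \<and> E N holomorphic_on ball 0 (1 / \<rho> N) \<and>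
    (\<forall>z. (\<Sum>i<n. h i (of_real (\<rho> N) * z) * v N i z) = \<delta> (of_real (\<rho> N) * z) ^ 6 + z ^ N * E N z) \<and>
    (\<Sum>i<n. cmean (\<lambda>z. (norm (v N i z))\<^sup>2) 1) \<le> C" by (rule exE)
  then have v: "\<And>N i. i < n \<Longrightarrow> v N i holomorphic_on ball 0 (1 / \<rho> N)"
    and E: "\<And>N. E N holomorphic_on ball 0 (1 / \<rho> N)"
    and eq: "\<And>N z. (\<Sum>i<n. h i (of_real (\<rho> N) * z) * v N i z) = \<delta> (of_real (\<rho> N) * z) ^ 6 + z ^ N * E N z"
    and vC: "\<And>N. (\<Sum>i<n. cmean (\<lambda>z. (norm (v N i z))\<^sup>2) 1) \<le> C"
    by simp_all
  have \<rho>': "1 / \<rho> N > 1" for N using \<rho>[of N] by simp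
  have viC: "cmean (\<lambda>z. (norm (v N i z))\<^sup>2) 1 \<le> C" if "i < n" for N i
    using member_le_sum[of i "{..<n}" "\<lambda>i. cmean (\<lambda>z. (norm (v N i z))\<^sup>2) 1"] vC[of N] that
    by (auto simp: cmean_norm_square_nonneg)
  define A where "A = (2 * pi + C) / (2 * pi)"
  have C0: "C \<ge> 0" by (simp add: C_def)
  have A0: "A \<ge> 0" using C0 by (simp add: A_def)
  have v_le: "norm (v N i z) \<le> A / (1 - norm z)" if "i < n" "norm z < 1" for N i z
  proof -
    have "2 * pi * norm (v N i z) \<le> (2 * pi + cmean (\<lambda>z. (norm (v N i z))\<^sup>2) 1) / (1 - norm z)"
      by (rule norm_le_cmean_norm_square[OF v[OF that(1)] \<rho>' that(2)])
    also have "\<dots> \<le> (2 * pi + C) / (1 - norm z)"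
      using viC[OF that(1), of N] that(2) by (intro divide_right_mono) auto
    finally have "norm (v N i z) \<le> (2 * pi + C) / (1 - norm z) / (2 * pi)"
      by (subst pos_le_divide_eq) (simp_all add: mult_ac)
    then show ?thesis by (simp add: A_def mult.commute)
  qed
  have sub: "ball 0 1 \<subseteq> ball (0::complex) (1 / \<rho> N)" "cball 0 1 \<subseteq> ball (0::complex) (1 / \<rho> N)" for N
    using \<rho>'[of N] by auto
  have vh: "v N i holomorphic_on ball 0 1" if "i < n" for N i
    using holomorphic_on_subset[OF v[OF that] sub(1)] .
  have bnd: "\<exists>B. \<forall>N. \<forall>z\<in>K. norm (v N i z) \<le> B" if "i < n" "compact K" "K \<subseteq> ball 0 1" for i and K :: "complex set"
  proof -
    obtain q where q: "q < 1" "\<And>z. z \<in> K \<Longrightarrow> norm z \<le> q"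
    proof (cases "K = {}")
      case True
      then show ?thesis using that[of 0] by auto
    next
      case False
      obtain z0 where "z0 \<in> K" "\<forall>z\<in>K. norm z \<le> norm z0"
        using continuous_attains_sup[OF \<open>compact K\<close> False, of norm] by (auto intro: continuous_intros)
      then show ?thesis using that[of "norm z0"] \<open>K \<subseteq> ball 0 1\<close> by auto
    qed
    have "norm (v N i z) \<le> A / (1 - q)" if "z \<in> K" for N z
    proof -
      have "norm (v N i z) \<le> A / (1 - norm z)" using v_le \<open>i < n\<close> q that by fastforce
      also have "\<dots> \<le> A / (1 - q)" using q(1) q(2)[OF that] A0 by (intro divide_left_mono) auto
      finally show ?thesis .
    qed
    then show ?thesis by blast
  qed
  have "\<exists>G r. strict_mono (r :: nat \<Rightarrow> nat) \<and> (\<forall>i<n. G i holomorphic_on ball 0 1 \<and>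
    (\<forall>K. compact K \<and> K \<subseteq> ball 0 1 \<longrightarrow> uniform_limit K (\<lambda>N. v (r N) i) (G i) sequentially))"
    by (rule Montel_finite[of _ _ "\<lambda>i N. v N i"]) (use bnd vh in auto)
  then obtain G r where r: "strict_mono (r :: nat \<Rightarrow> nat)" and *: "\<forall>i<n. G i holomorphic_on ball 0 1 \<and>
    (\<forall>K. compact K \<and> K \<subseteq> ball 0 1 \<longrightarrow> uniform_limit K (\<lambda>N. v (r N) i) (G i) sequentially)"
    by blast
  then have G: "\<And>i. i < n \<Longrightarrow> G i holomorphic_on ball 0 1"
    and lim: "\<And>i K. i < n \<Longrightarrow> compact K \<Longrightarrow> K \<subseteq> ball 0 1 \<Longrightarrow> uniform_limit K (\<lambda>N. v (r N) i) (G i) sequentially"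
    by blast+
  show ?thesis
  proof (intro exI[of _ G] exI[of _ "2 * C + 4 * pi"] conjI allI impI ballI)
    show "G i holomorphic_on ball 0 1" if "i < n" for i by (rule G[OF that])
  next
    fix z :: complex assume z: "z \<in> ball 0 1"
    \<comment> \<open>A radius strictly between |z| and 1. On that circle z^N E_N is bounded by B
      for every N, so the maximum principle gives a remainder of at most (|z| / q)^N B at z.\<close>
    define q where "q = (1 + norm z) / 2"
    have q: "norm z < q" "q < 1" "0 < q" using z by (auto simp: q_def intro: add_pos_nonneg)
    define B where "B = n * (A / (1 - q)) + 1"
    have rest: "norm (z ^ N * E N z) \<le> (norm z / q) ^ N * B" for N
    proof -
      have sqN: "ball 0 q \<subseteq> ball (0::complex) (1 / \<rho> N)" "cball 0 q \<subseteq> ball (0::complex) (1 / \<rho> N)"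
        using q \<rho>'[of N] by auto
      have "norm (E N z) \<le> B / q ^ N"
      proof (rule maximum_modulus_frontier[of "E N" "ball 0 q"])
        show "E N holomorphic_on interior (ball 0 q)"
          using holomorphic_on_subset[OF E[of N], of "ball 0 q"] sqN by auto
        show "continuous_on (closure (ball 0 q)) (E N)"
          using continuous_on_subset[OF holomorphic_on_imp_continuous_on[OF E[of N]] sqN(2)] q by simp
        show "z \<in> ball 0 q" using q by simp
        fix w assume "w \<in> frontier (ball (0::complex) q)"
        then have w: "norm w = q" using q by simp
        then have w1: "of_real (\<rho> N) * w \<in> ball 0 1" using q sub(1)[of N] by (intro inball) auto
        have "norm (w ^ N * E N w) = norm ((\<Sum>i<n. h i (of_real (\<rho> N) * w) * v N i w) - \<delta> (of_real (\<rho> N) * w) ^ 6)"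
          unfolding eq by simp
        also have "\<dots> \<le> norm (\<Sum>i<n. h i (of_real (\<rho> N) * w) * v N i w) + norm (\<delta> (of_real (\<rho> N) * w) ^ 6)"
          by (rule norm_triangle_ineq4)
        also have "\<dots> \<le> (\<Sum>i<n. A / (1 - q)) + 1"
        proof (intro add_mono sum_norm_le)
          fix i assume "i \<in> {..<n}"
          then have "norm (h i (of_real (\<rho> N) * w)) * norm (v N i w) \<le> 1 * (A / (1 - q))"
            using h_le[OF _ w1] v_le[of i w N] w q by (intro mult_mono) auto
          then show "norm (h i (of_real (\<rho> N) * w) * v N i w) \<le> A / (1 - q)" by (simp add: norm_mult)
        next
          show "norm (\<delta> (of_real (\<rho> N) * w) ^ 6) \<le> 1"
            using \<delta>_le[OF w1] by (simp add: norm_power power_le_one)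
        qed
        finally have "q ^ N * norm (E N w) \<le> B" by (simp add: norm_mult norm_power w B_def)
        then show "norm (E N w) \<le> B / q ^ N" using q by (simp add: field_simps)
      qed simp
      then have "norm z ^ N * norm (E N z) \<le> norm z ^ N * (B / q ^ N)" by (intro mult_left_mono) auto
      then show ?thesis by (simp add: norm_mult norm_power power_divide)
    qed
    have lim0: "(\<lambda>N. (norm z / q) ^ r N * B) \<longlonglongrightarrow> 0"
    proof -
      have "(\<lambda>N. (norm z / q) ^ N) \<longlonglongrightarrow> 0" using q by (intro LIMSEQ_realpow_zero) auto
      from tendsto_mult_left_zero[OF filterlim_compose[OF this filterlim_subseq[OF r]]] show ?thesis .
    qed
    have E0: "(\<lambda>N. z ^ r N * E (r N) z) \<longlonglongrightarrow> 0"
      by (rule Lim_null_comparison[OF _ lim0]) (use rest in auto)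
    have zlim: "(\<lambda>N. of_real (\<rho> (r N)) * z) \<longlonglongrightarrow> z"
    proof -
      have "(\<lambda>N. complex_of_real (\<rho> (r N))) \<longlonglongrightarrow> of_real 1"
        by (intro tendsto_of_real filterlim_compose[OF \<rho>_lim filterlim_subseq[OF r]])
      from tendsto_mult[OF this tendsto_const[of z]] show ?thesis by simp
    qed
    have complim: "(\<lambda>N. f (of_real (\<rho> (r N)) * z)) \<longlonglongrightarrow> f z" if "f holomorphic_on ball 0 1" for f :: "complex \<Rightarrow> complex"
      using isCont_tendsto_compose[OF _ zlim, of f] holomorphic_on_imp_continuous_on[OF that] z
      by (simp add: continuous_on_eq_continuous_at)
    have vlim: "(\<lambda>N. v (r N) i z) \<longlonglongrightarrow> G i z" if "i < n" for i
      using tendsto_uniform_limitI[OF lim[OF that, of "{z}"]] z by auto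
    have "(\<lambda>N. \<Sum>i<n. h i (of_real (\<rho> (r N)) * z) * v (r N) i z) \<longlonglongrightarrow> (\<Sum>i<n. h i z * G i z)"
      by (intro tendsto_sum tendsto_mult complim h vlim) auto
    moreover have "(\<lambda>N. \<Sum>i<n. h i (of_real (\<rho> (r N)) * z) * v (r N) i z) \<longlonglongrightarrow> \<delta> z ^ 6 + 0"
      unfolding eq by (intro tendsto_add tendsto_power complim \<delta> E0)
    ultimately show "(\<Sum>i<n. h i z * G i z) = \<delta> z ^ 6"
      using LIMSEQ_unique by fastforce
  next
    fix i x assume i: "i < n" and x: "x \<in> {0<..<1::real}"
    have "uniform_limit (sphere 0 x) (\<lambda>N. v (r N) i) (G i) sequentially"
      by (rule lim[OF i]) (use x in auto)
    then have "\<forall>\<^sub>F N in sequentially. \<forall>z\<in>sphere 0 x. dist (v (r N) i z) (G i z) < 1"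
      by (rule uniform_limitD) simp
    then obtain N where "\<forall>z\<in>sphere 0 x. dist (v (r N) i z) (G i z) < 1"
      using eventually_happens'[OF sequentially_bot] by blast
    then have N: "dist (v (r N) i z) (G i z) < 1" if "norm z = x" for z
      using that by simp
    have cG: "continuous_on (ball 0 1) (G i)" and cv: "continuous_on (cball 0 1) (v (r N) i)"
      using holomorphic_on_imp_continuous_on[OF G[OF i]]
       continuous_on_cball_holomorphic[OF v[OF i] \<rho>'] by auto
    have cv': "continuous_on (ball 0 1) (v (r N) i)"
      by (rule continuous_on_subset[OF cv]) auto
    \<comment> \<open>One approximant within distance 1 on this circle suffices: |G|^2 \<le> 2 |v|^2
      + 2, whence the bound 2 C + 4 pi.\<close>
    have "cmean (\<lambda>z. (norm (G i z))\<^sup>2) x \<le> cmean (\<lambda>z. 2 * (norm (v (r N) i z))\<^sup>2 + 2) x"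
      unfolding cmean_def
    proof (intro integral_le)
      show "(\<lambda>t. (norm (G i (of_real x * cis t)))\<^sup>2) integrable_on {0..2*pi}"
        by (rule integrable_circle[of "ball 0 1" "\<lambda>z. (norm (G i z))\<^sup>2"]) (use x cG in \<open>auto intro!: continuous_intros\<close>)
      show "(\<lambda>t. 2 * (norm (v (r N) i (of_real x * cis t)))\<^sup>2 + 2) integrable_on {0..2*pi}"
        by (rule integrable_circle[of "ball 0 1" "\<lambda>z. 2 * (norm (v (r N) i z))\<^sup>2 + 2"]) (use x cv' in \<open>auto intro!: continuous_intros\<close>)
      fix t
      let ?w = "of_real x * cis t"
      have "norm (v (r N) i ?w - G i ?w) \<le> 1" using N[of ?w] x by (simp add: dist_norm)
      then have "(norm (v (r N) i ?w - G i ?w))\<^sup>2 \<le> 1" by (simp add: power_le_one)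
      then show "(norm (G i ?w))\<^sup>2 \<le> 2 * (norm (v (r N) i ?w))\<^sup>2 + 2"
        using norm_diff_square_le[of "v (r N) i ?w" "v (r N) i ?w - G i ?w"] by simp
    qed
    also have "\<dots> = cmean (\<lambda>z. 2 * (norm (v (r N) i z))\<^sup>2) x + cmean (\<lambda>z. 2) x"
      by (rule cmean_add) (use x cv in \<open>auto intro!: continuous_intros\<close>)
    also have "\<dots> = 2 * cmean (\<lambda>z. (norm (v (r N) i z))\<^sup>2) x + 4 * pi"
      by (simp add: cmean_cmult cmean_const)
    also have "cmean (\<lambda>z. (norm (v (r N) i z))\<^sup>2) x \<le> cmean (\<lambda>z. (norm (v (r N) i z))\<^sup>2) 1"
      by (rule cmean_norm_square_mono[OF v[OF i]]) (use x \<rho>' in auto)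
    also have "\<dots> \<le> C" by (rule viC[OF i])
    finally show "cmean (\<lambda>z. (norm (G i z))\<^sup>2) x \<le> 2 * C + 4 * pi" by simp
  qed
qed

section \<open>Bounded logarithmic means\<close>

text \<open>Splitting off the constant coefficients leaves a common factor z cnj z = 1; terms with a
  conjugated polynomial may be conjugated under Re.\<close>

lemma Re_poly_mult_cnj_poly:
  "\<exists>s. \<forall>z::complex. norm z = 1 \<longrightarrow> Re (poly p z * cnj (poly q z)) = Re (poly s z)"
proof (induction p arbitrary: q)
  case 0
  then show ?case by (intro exI[of _ 0]) simp
next
  case (pCons a p)
  obtain b q' where q: "q = pCons b q'" by (cases q)
  obtain s where s: "\<And>z. norm z = 1 \<Longrightarrow> Re (poly p z * cnj (poly q' z)) = Re (poly s z)"
    using pCons.IH by blast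
  show ?case
  proof (intro exI allI impI)
    fix z :: complex assume z: "norm z = 1"
    then have zz: "z * cnj z = 1" by (simp add: complex_norm_square[symmetric])
    have "poly (pCons a p) z * cnj (poly q z) = a * cnj (poly q z) + cnj b * z * poly p z
        + (z * cnj z) * (poly p z * cnj (poly q' z))"
      by (simp add: q algebra_simps)
    also have "Re \<dots> = Re (cnj a * poly q z) + Re (cnj b * z * poly p z) + Re (poly s z)"
      unfolding zz using s[OF z] by simp
    also have "\<dots> = Re (poly (Polynomial.smult (cnj a) q + pCons 0 (Polynomial.smult (cnj b) p) + s) z)"
      by (simp add: mult_ac)
    finally show "Re (poly (pCons a p) z * cnj (poly q z)) =
      Re (poly (Polynomial.smult (cnj a) q + pCons 0 (Polynomial.smult (cnj b) p) + s) z)" .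
  qed
qed

text \<open>Products rest on Re q Re s = (Re (q s) + Re (q cnj s)) / 2, where the second term is
  again the real part of a polynomial on the circle.\<close>

lemma real_polynomial_function_on_circle:
  fixes g :: "complex \<Rightarrow> real"
  assumes "real_polynomial_function g"
  shows "\<exists>q. \<forall>z. norm z = 1 \<longrightarrow> g z = Re (poly q z)"
  using assms
proof (induction rule: real_polynomial_function.induct)
  case (linear f)
  interpret bounded_linear f by fact
  have "f z = Re (poly [:0, Complex (f 1) (- f \<i>):] z)" for z
  proof -
    have "f z = f (Re z *\<^sub>R 1 + Im z *\<^sub>R \<i>)"
      by (rule arg_cong[of _ _ f]) (simp add: complex_eq_iff)
    also have "\<dots> = Re z * f 1 + Im z * f \<i>" by (simp only: add scaleR real_scaleR_def)
    finally show ?thesis by (simp add: mult.commute)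
  qed
  then show ?case by blast
next
  case (const c)
  show ?case by (intro exI[of _ "[:of_real c:]"]) simp
next
  case (add f g)
  then obtain q s where "\<forall>z. norm z = 1 \<longrightarrow> f z = Re (poly q z)" "\<forall>z. norm z = 1 \<longrightarrow> g z = Re (poly s z)"
    by blast
  then show ?case by (intro exI[of _ "q + s"]) simp
next
  case (mult f g)
  then obtain q s where qs: "\<forall>z. norm z = 1 \<longrightarrow> f z = Re (poly q z)" "\<forall>z. norm z = 1 \<longrightarrow> g z = Re (poly s z)"
    by blast
  obtain t where t: "\<forall>z. norm z = 1 \<longrightarrow> Re (poly q z * cnj (poly s z)) = Re (poly t z)"
    using Re_poly_mult_cnj_poly by blast
  have "f z * g z = Re (poly (Polynomial.smult (1/2) (q * s + t)) z)" if z: "norm z = 1" for z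
  proof -
    have "f z * g z = (Re (poly q z * poly s z) + Re (poly q z * cnj (poly s z))) / 2"
      using z qs by simp
    then show ?thesis by (simp only: t[rule_format, OF z]) simp
  qed
  then show ?case by blast
qed

lemma trigonometric_approximation:
  fixes w :: "complex \<Rightarrow> real"
  assumes "continuous_on (sphere 0 1) w" "e > 0"
  obtains q where "\<And>z. norm z = 1 \<Longrightarrow> \<bar>w z - Re (poly q z)\<bar> < e"
proof -
  obtain g where g: "real_polynomial_function g" "\<And>x. x \<in> sphere 0 1 \<Longrightarrow> \<bar>w x - g x\<bar> < e"
    using Stone_Weierstrass_real_polynomial_function[OF compact_sphere assms] by blast
  obtain q where "\<forall>z. norm z = 1 \<longrightarrow> g z = Re (poly q z)"
    using real_polynomial_function_on_circle[OF g(1)] by blast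
  then show ?thesis using g(2) by (intro that[of q]) auto
qed

section \<open>Estimates for \<open>log_plus\<close> and its circle means\<close>

lemma log_plus_nonneg [simp]: "0 \<le> log_plus x"
  by (simp add: log_plus_def)

text \<open>The case x = 0 uses \<open>ln 0 = 0\<close>. In this form continuity and monotonicity
  are visible.\<close>

lemma log_plus_eq: "0 \<le> x \<Longrightarrow> log_plus x = ln (max 1 x)"
  by (cases "x = 0") (auto simp: log_plus_def max_def)

lemma log_plus_mono: "0 \<le> x \<Longrightarrow> x \<le> y \<Longrightarrow> log_plus x \<le> log_plus y"
  by (simp add: log_plus_eq)

lemma log_plus_mult_le:
  assumes "0 \<le> x" "0 \<le> y"
  shows "log_plus (x * y) \<le> log_plus x + log_plus y"
proof -
  have "max 1 (x * y) \<le> max 1 x * max 1 y"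
    using assms mult_mono[of 1 "max 1 x" 1 "max 1 y"] mult_mono[of x "max 1 x" y "max 1 y"] by simp
  then have "ln (max 1 (x * y)) \<le> ln (max 1 x * max 1 y)" by simp
  also have "\<dots> = ln (max 1 x) + ln (max 1 y)" by (rule ln_mult_pos) auto
  finally show ?thesis using assms by (simp add: log_plus_eq)
qed

lemma log_plus_add_le:
  assumes "0 \<le> x" "0 \<le> y"
  shows "log_plus (x + y) \<le> 1 + log_plus x + log_plus y"
proof -
  have "x + y \<le> max 1 x + max 1 y" by simp
  also have "\<dots> \<le> 2 * (max 1 x * max 1 y)"
  proof -
    have "a + b \<le> 2 * (a * b)" if "a \<ge> 1" "b \<ge> 1" for a b :: real
    proof -
      have "2 * (a * b) = 2 * ((a - 1) * (b - 1)) + 2 * a + 2 * b - 2" by (simp add: algebra_simps)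
      moreover have "0 \<le> (a - 1) * (b - 1)" using that by simp
      ultimately show ?thesis using that by linarith
    qed
    then show ?thesis by auto
  qed
  finally have "log_plus (x + y) \<le> log_plus (2 * (max 1 x * max 1 y))"
    using assms by (intro log_plus_mono) auto
  also have "\<dots> \<le> log_plus 2 + (log_plus (max 1 x) + log_plus (max 1 y))"
    by (intro order_trans[OF log_plus_mult_le] add_left_mono log_plus_mult_le) auto
  also have "log_plus 2 \<le> 1" using ln_2_less_1 by (simp add: log_plus_def)
  finally have "log_plus (x + y) \<le> 1 + (log_plus (max 1 x) + log_plus (max 1 y))" by simp
  moreover have "log_plus (max 1 x) = log_plus x" "log_plus (max 1 y) = log_plus y"
    using assms by (simp_all add: log_plus_eq)
  ultimately show ?thesis by simp
qed

lemma powr_add3_le: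
  fixes a b c p :: real
  assumes "0 \<le> a" "0 \<le> b" "0 \<le> c" "0 \<le> p"
  shows "(a + b + c) powr p \<le> 3 powr p * (a powr p + b powr p + c powr p)"
proof -
  define m where "m = max a (max b c)"
  have m: "m powr p \<le> a powr p + b powr p + c powr p"
    unfolding m_def max_def by (auto intro: add_nonneg_nonneg)
  have "(a + b + c) powr p \<le> (3 * m) powr p"
    using assms by (intro powr_mono2) (auto simp: m_def)
  also have "\<dots> = 3 powr p * m powr p"
    using assms by (subst powr_mult) (auto simp: m_def)
  also have "\<dots> \<le> 3 powr p * (a powr p + b powr p + c powr p)"
    using m by (intro mult_left_mono) auto
  finally show ?thesis .
qed

text \<open>The growth condition of \<open>Np_carrier\<close> detached from extensionality and from
  the factor 1 / (2 pi), so that it applies to plain lambda terms.\<close>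

definition log_mean_bounded :: "real \<Rightarrow> (complex \<Rightarrow> complex) \<Rightarrow> bool" where
  "log_mean_bounded p f \<longleftrightarrow> (\<exists>B. \<forall>r\<in>{0<..<1}. cmean (\<lambda>z. log_plus (norm (f z)) powr p) r \<le> B)"

lemma continuous_on_log_plus:
  assumes "continuous_on S f" "p > 0"
  shows "continuous_on S (\<lambda>z. log_plus (norm (f z)) powr p)"
proof -
  have "continuous_on S (\<lambda>z. ln (max 1 (norm (f z))))"
    by (intro continuous_intros assms) auto
  then have "continuous_on S (\<lambda>z. log_plus (norm (f z)))" by (simp add: log_plus_eq)
  then show ?thesis using assms(2) by (intro continuous_on_powr' continuous_intros) auto
qed

lemma integrable_circle_disc:
  fixes F :: "complex \<Rightarrow> 'a::banach"
  assumes "continuous_on (ball 0 1) F" "r \<in> {0<..<1}"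
  shows "(\<lambda>t. F (of_real r * cis t)) integrable_on {0..2*pi}"
  by (rule integrable_circle[OF assms(1)]) (use assms in auto)

text \<open>Common source of closure under sums, products and domination; the three terms K, f, g
  fit \<open>powr_add3_le\<close>.\<close>

lemma log_mean_bounded_combine:
  assumes f: "continuous_on (ball 0 1) f" "log_mean_bounded p f"
    and g: "continuous_on (ball 0 1) g" "log_mean_bounded p g"
    and u: "continuous_on (ball 0 1) u" and "p > 0" "K \<ge> 0"
    and le: "\<And>z. z \<in> ball 0 1 \<Longrightarrow> log_plus (norm (u z)) \<le> K + log_plus (norm (f z)) + log_plus (norm (g z))"
  shows "log_mean_bounded p u"
proof -
  obtain B where B: "\<And>r. r \<in> {0<..<1} \<Longrightarrow> cmean (\<lambda>z. log_plus (norm (f z)) powr p) r \<le> B"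
    using f(2) unfolding log_mean_bounded_def by blast
  obtain C where C: "\<And>r. r \<in> {0<..<1} \<Longrightarrow> cmean (\<lambda>z. log_plus (norm (g z)) powr p) r \<le> C"
    using g(2) unfolding log_mean_bounded_def by blast
  have "cmean (\<lambda>z. log_plus (norm (u z)) powr p) r \<le> 3 powr p * (2 * pi * K powr p + B + C)" if r: "r \<in> {0<..<1}" for r
  proof -
    note i = integrable_circle_disc[OF continuous_on_log_plus[OF f(1) \<open>p > 0\<close>] r]
      integrable_circle_disc[OF continuous_on_log_plus[OF g(1) \<open>p > 0\<close>] r]
    have i3: "(\<lambda>t. 3 powr p * (K powr p + log_plus (norm (f (of_real r * cis t))) powr p
        + log_plus (norm (g (of_real r * cis t))) powr p)) integrable_on {0..2*pi}"
      by (rule integrable_circle_disc[OF _ r, of "\<lambda>z. 3 powr p * (K powr p + log_plus (norm (f z)) powr p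
            + log_plus (norm (g z)) powr p)"])
         (intro continuous_intros continuous_on_log_plus f g \<open>p > 0\<close>)
    have "cmean (\<lambda>z. log_plus (norm (u z)) powr p) r
      \<le> cmean (\<lambda>z. 3 powr p * (K powr p + log_plus (norm (f z)) powr p + log_plus (norm (g z)) powr p)) r"
      unfolding cmean_def
    proof (intro integral_le i3
          integrable_circle_disc[OF continuous_on_log_plus[OF u \<open>p > 0\<close>] r])
      fix t
      let ?z = "of_real r * cis t"
      have "log_plus (norm (u ?z)) powr p \<le> (K + log_plus (norm (f ?z)) + log_plus (norm (g ?z))) powr p"
        using r \<open>p > 0\<close> by (intro powr_mono2 le) auto
      also have "\<dots> \<le> 3 powr p * (K powr p + log_plus (norm (f ?z)) powr p + log_plus (norm (g ?z)) powr p)"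
        using assms(6,7) by (intro powr_add3_le) auto
      finally show "log_plus (norm (u ?z)) powr p
        \<le> 3 powr p * (K powr p + log_plus (norm (f ?z)) powr p + log_plus (norm (g ?z)) powr p)" .
    qed
    also have "\<dots> = 3 powr p * (2 * pi * K powr p + cmean (\<lambda>z. log_plus (norm (f z)) powr p) r
        + cmean (\<lambda>z. log_plus (norm (g z)) powr p) r)"
      unfolding cmean_def using i
      by (simp add: integral_add integrable_add integrable_const_ivl)
    also have "\<dots> \<le> 3 powr p * (2 * pi * K powr p + B + C)"
      using B[OF r] C[OF r] by (intro mult_left_mono) auto
    finally show ?thesis .
  qed
  then show ?thesis unfolding log_mean_bounded_def by blast
qed

lemma log_mean_bounded_zero: "log_mean_bounded p (\<lambda>z. 0)"
  by (auto simp: log_mean_bounded_def cmean_def log_plus_def)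

lemma log_mean_bounded_le:
  assumes f: "continuous_on (ball 0 1) f" "log_mean_bounded p f"
    and u: "continuous_on (ball 0 1) u" and "p > 0" "K \<ge> 0"
    and le: "\<And>z. z \<in> ball 0 1 \<Longrightarrow> log_plus (norm (u z)) \<le> K + log_plus (norm (f z))"
  shows "log_mean_bounded p u"
  by (rule log_mean_bounded_combine[OF f continuous_on_const[of _ 0] log_mean_bounded_zero u assms(4,5)])
     (use le in \<open>auto intro: add_increasing2\<close>)

lemma log_mean_bounded_const_bound:
  assumes u: "continuous_on (ball 0 1) u" and "p > 0"
    and le: "\<And>z. z \<in> ball 0 1 \<Longrightarrow> norm (u z) \<le> K"
  shows "log_mean_bounded p u"
  by (rule log_mean_bounded_le[OF continuous_on_const[of _ 0] log_mean_bounded_zero u \<open>p > 0\<close> log_plus_nonneg[of K]])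
     (use le in \<open>auto intro!: add_increasing2 log_plus_mono\<close>)

lemma log_mean_bounded_mult:
  assumes "continuous_on (ball 0 1) f" "log_mean_bounded p f"
    and "continuous_on (ball 0 1) g" "log_mean_bounded p g" and "p > 0"
  shows "log_mean_bounded p (\<lambda>z. f z * g z)"
  by (rule log_mean_bounded_combine[OF assms(1-4) _ assms(5), of _ 0])
     (use assms in \<open>auto intro!: continuous_intros log_plus_mult_le simp: norm_mult\<close>)

lemma log_mean_bounded_add:
  assumes "continuous_on (ball 0 1) f" "log_mean_bounded p f"
    and "continuous_on (ball 0 1) g" "log_mean_bounded p g" and "p > 0"
  shows "log_mean_bounded p (\<lambda>z. f z + g z)"
proof (rule log_mean_bounded_combine[OF assms(1-4) _ assms(5), of _ 1])
  fix z
  have "log_plus (norm (f z + g z)) \<le> log_plus (norm (f z) + norm (g z))"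
    by (intro log_plus_mono norm_triangle_ineq) auto
  also have "\<dots> \<le> 1 + log_plus (norm (f z)) + log_plus (norm (g z))"
    by (intro log_plus_add_le) auto
  finally show "log_plus (norm (f z + g z)) \<le> 1 + log_plus (norm (f z)) + log_plus (norm (g z))" .
qed (use assms in \<open>auto intro!: continuous_intros\<close>)

lemma log_mean_bounded_prod:
  assumes "finite I" "\<And>i. i \<in> I \<Longrightarrow> continuous_on (ball 0 1) (f i)"
    "\<And>i. i \<in> I \<Longrightarrow> log_mean_bounded p (f i)" "p > 0"
  shows "log_mean_bounded p (\<lambda>z. \<Prod>i\<in>I. f i z)"
  using assms
proof (induction I)
  case empty
  have "log_mean_bounded p (\<lambda>z. 1)" by (rule log_mean_bounded_const_bound[of _ _ 1]) (use assms in auto)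
  then show ?case by simp
next
  case (insert i I)
  have "log_mean_bounded p (\<lambda>z. f i z * (\<Prod>i\<in>I. f i z))"
    by (rule log_mean_bounded_mult) (use insert in \<open>auto intro!: continuous_intros\<close>)
  then show ?case using insert by simp
qed

text \<open>For x > 1, log x \<le> (p/2) x^(2/p), whose p-th power is a multiple of x^2. This is why
  H^2 growth suffices for every p.\<close>

lemma log_plus_powr_le_square:
  assumes "p > 0" "0 \<le> x"
  shows "log_plus x powr p \<le> (p / 2) powr p * x\<^sup>2"
proof (cases "x \<le> 1")
  case True
  then have "log_plus x = 0" using assms by (simp add: log_plus_eq max_def)
  then show ?thesis using assms by simp
next
  case False
  then have "ln x \<le> x powr (2 / p) / (2 / p)"
    using assms by (intro ln_powr_bound) auto
  then have "log_plus x powr p \<le> (p / 2 * x powr (2 / p)) powr p"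
    using False assms by (intro powr_mono2) (auto simp: log_plus_def field_simps)
  also have "\<dots> = (p / 2) powr p * (x powr (2 / p)) powr p"
    using assms by (subst powr_mult) auto
  also have "(x powr (2 / p)) powr p = x\<^sup>2" using assms False by (simp add: powr_powr)
  finally show ?thesis .
qed

lemma log_mean_bounded_H2:
  assumes G: "continuous_on (ball 0 1) G" and "p > 0"
    and B: "\<And>r. r \<in> {0<..<1} \<Longrightarrow> cmean (\<lambda>z. (norm (G z))\<^sup>2) r \<le> B"
  shows "log_mean_bounded p G"
proof -
  have "cmean (\<lambda>z. log_plus (norm (G z)) powr p) r \<le> (p / 2) powr p * B" if r: "r \<in> {0<..<1}" for r
  proof -
    have "continuous_on (ball 0 1) (\<lambda>z. (p / 2) powr p * (norm (G z))\<^sup>2)" by (intro continuous_intros G)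
    then have "cmean (\<lambda>z. log_plus (norm (G z)) powr p) r \<le> cmean (\<lambda>z. (p / 2) powr p * (norm (G z))\<^sup>2) r"
      unfolding cmean_def using r log_plus_powr_le_square[OF \<open>p > 0\<close>]
      by (intro integral_le integrable_circle_disc continuous_on_log_plus G \<open>p > 0\<close>) auto
    also have "\<dots> \<le> (p / 2) powr p * B"
      unfolding cmean_cmult using B[OF r] by (intro mult_left_mono) auto
    finally show ?thesis .
  qed
  then show ?thesis unfolding log_mean_bounded_def by blast
qed

section \<open>Outer divisors\<close>

text \<open>On the unit circle Re q lies between log+ |g(\<rho> z)| + 1 and the same + 3. The lower
  bound makes exp (- q) compensate g by the maximum principle; the upper one controls the p-th
  mean.\<close>

lemma outer_approximant:
  assumes g: "g holomorphic_on ball 0 1" and \<rho>: "0 < \<rho>" "\<rho> < 1" and "p \<ge> 1"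
    and B: "cmean (\<lambda>z. log_plus (norm (g z)) powr p) \<rho> \<le> B"
  obtains q where "\<And>z. z \<in> cball 0 1 \<Longrightarrow> Re (poly q z) \<ge> 0"
    "\<And>z. z \<in> cball 0 1 \<Longrightarrow> norm (exp (- poly q z) * g (of_real \<rho> * z)) \<le> 1"
    "\<And>r. r \<in> {0<..1} \<Longrightarrow> cmean (\<lambda>z. Re (poly q z) powr p) r \<le> 3 powr p * (B + 2 * pi * 3 powr p)"
proof -
  have in1: "of_real \<rho> * z \<in> ball 0 1" if "z \<in> cball 0 1" for z :: complex
  proof -
    have "\<rho> * norm z \<le> \<rho> * 1" using that \<rho> by (intro mult_left_mono) auto
    then have "\<rho> * norm z < 1" using \<rho> by linarith
    then show ?thesis using \<rho> by (simp add: norm_mult)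
  qed
  have cg: "continuous_on (cball 0 1) (\<lambda>z. g (of_real \<rho> * z))"
    by (rule continuous_on_compose2[OF holomorphic_on_imp_continuous_on[OF g]])
       (use in1 in \<open>auto intro!: continuous_intros\<close>)
  define w where "w z = log_plus (norm (g (of_real \<rho> * z)))" for z
  have cw: "continuous_on (cball 0 1) w"
    using continuous_on_log_plus[OF cg, of 1] by (simp add: w_def[abs_def])
  have w0: "w z \<ge> 0" for z by (simp add: w_def)
  \<comment> \<open>Shift 2 and accuracy 1 leave Re q at least 1 on the circle, hence room for
    strict positivity.\<close>
  have "continuous_on (sphere 0 1) (\<lambda>z. w z + 2)"
    by (intro continuous_intros continuous_on_subset[OF cw]) auto
  from trigonometric_approximation[OF this, of 1] obtain q
    where q: "\<And>z. norm z = 1 \<Longrightarrow> \<bar>w z + 2 - Re (poly q z)\<bar> < 1" by auto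
  have q1: "Re (poly q z) \<ge> w z + 1" "Re (poly q z) \<le> w z + 3" if "norm z = 1" for z
    using q[OF that] by linarith+
  \<comment> \<open>The maximum principle for exp (- q) acts as a minimum principle for Re
    q.\<close>
  have q2: "Re (poly q z) \<ge> 1" if "z \<in> cball 0 1" for z
  proof -
    have "norm (exp (- poly q z)) \<le> exp (-1)"
    proof (rule maximum_modulus_frontier[of "\<lambda>z. exp (- poly q z)" "cball 0 1"])
      fix x :: complex assume "x \<in> frontier (cball 0 1)"
      then have "norm x = 1" by simp
      then show "norm (exp (- poly q x)) \<le> exp (-1)"
        using q1(1)[of x] w0[of x] by simp
    qed (use that in \<open>auto intro!: holomorphic_intros continuous_intros\<close>)
    then show ?thesis by simp
  qed
  \<comment> \<open>\<open>cmean_powr_mono\<close> is used up to radius 1 and so requires positivity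
    on a larger ball; compactness of the closed disc supplies the margin.\<close>
  obtain e where e: "e > 0" "(\<Union>x\<in>cball 0 1. ball x e) \<subseteq> {z. Re (poly q z) > 0}"
  proof (rule compact_subset_open_imp_ball_epsilon_subset)
    show "open {z. Re (poly q z) > 0}"
      by (intro open_Collect_less continuous_intros)
    show "cball 0 1 \<subseteq> {z. 0 < Re (poly q z)}" using q2 by fastforce
  qed auto
  have pos: "Re (poly q z) > 0" if "z \<in> ball 0 (1 + e)" for z
  proof (cases "norm z \<le> 1")
    case True
    then show ?thesis using q2[of z] by simp
  next
    case False
    define x where "x = z /\<^sub>R norm z"
    have "dist x z = norm ((1 / norm z - 1) *\<^sub>R z)"
      by (simp add: x_def dist_norm scaleR_left_diff_distrib inverse_eq_divide)
    also have "\<dots> = \<bar>1 / norm z - 1\<bar> * norm z" by simp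
    also have "\<dots> = norm z - 1" using False by (auto simp: abs_if field_simps)
    finally have "z \<in> ball x e" using that by simp
    moreover have "norm z \<noteq> 0" using False by auto
    then have "x \<in> cball 0 1" by (simp add: x_def)
    ultimately have "z \<in> (\<Union>x\<in>cball 0 1. ball x e)" by blast
    then show ?thesis using e(2) by blast
  qed
  show ?thesis
  proof (rule that[of q])
    show "Re (poly q z) \<ge> 0" if "z \<in> cball 0 1" for z using q2[OF that] by simp
    show "norm (exp (- poly q z) * g (of_real \<rho> * z)) \<le> 1" if "z \<in> cball 0 1" for z
    proof (rule maximum_modulus_frontier[of "\<lambda>z. exp (- poly q z) * g (of_real \<rho> * z)" "cball 0 1"])
      show "(\<lambda>z. exp (- poly q z) * g (of_real \<rho> * z)) holomorphic_on interior (cball 0 1)"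
        using in1 by (intro holomorphic_intros holomorphic_on_compose_gen[OF _ g, unfolded o_def]) auto
      show "continuous_on (closure (cball 0 1)) (\<lambda>z. exp (- poly q z) * g (of_real \<rho> * z))"
        using cg by (auto intro!: continuous_intros)
      fix x :: complex assume "x \<in> frontier (cball 0 1)"
      then have x: "norm x = 1" by simp
      have "norm (g (of_real \<rho> * x)) \<le> exp (w x)"
      proof -
        have "exp (w x) = max 1 (norm (g (of_real \<rho> * x)))" by (simp add: w_def log_plus_eq)
        then show ?thesis by simp
      qed
      also have "\<dots> \<le> exp (Re (poly q x))" using q1(1)[OF x] by simp
      finally have "exp (- Re (poly q x)) * norm (g (of_real \<rho> * x)) \<le> exp (- Re (poly q x)) * exp (Re (poly q x))"
        by (intro mult_left_mono) auto
      then show "norm (exp (- poly q x) * g (of_real \<rho> * x)) \<le> 1"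
        by (simp add: norm_mult flip: exp_add)
    qed (use that in auto)
    fix r :: real assume r: "r \<in> {0<..1}"
    have cq: "continuous_on (cball 0 1) (\<lambda>z. Re (poly q z) powr p)"
    proof (intro continuous_on_powr continuous_intros ballI)
      fix z :: complex assume "z \<in> cball 0 1"
      with q2[OF this] show "Re (poly q z) \<noteq> 0" by auto
    qed
    have cw': "continuous_on (cball 0 1) (\<lambda>z. w z powr p)"
      unfolding w_def using continuous_on_log_plus[OF cg] \<open>p \<ge> 1\<close> by simp
    have "cmean (\<lambda>z. Re (poly q z) powr p) r \<le> cmean (\<lambda>z. Re (poly q z) powr p) 1"
      by (rule cmean_powr_mono[where R="1 + e"]) (use r e \<open>p \<ge> 1\<close> pos in \<open>auto intro!: holomorphic_intros\<close>)
    also have "\<dots> \<le> cmean (\<lambda>z. 3 powr p * (w z powr p + 3 powr p)) 1"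
    proof (rule cmean_mono[OF cq])
      show "continuous_on (cball 0 1) (\<lambda>z. 3 powr p * (w z powr p + 3 powr p))"
        by (intro continuous_on_mult continuous_on_add continuous_on_const cw')
      fix z :: complex assume z: "norm z = 1"
      have "Re (poly q z) powr p \<le> (w z + 3 + 0) powr p"
        using q1[OF z] q2[of z] z \<open>p \<ge> 1\<close> by (intro powr_mono2) auto
      also have "\<dots> \<le> 3 powr p * (w z powr p + 3 powr p + 0 powr p)"
        using w0[of z] \<open>p \<ge> 1\<close> by (intro powr_add3_le) auto
      finally show "Re (poly q z) powr p \<le> 3 powr p * (w z powr p + 3 powr p)" by simp
    qed simp
    also have "\<dots> = 3 powr p * (cmean (\<lambda>z. w z powr p) 1 + 2 * pi * 3 powr p)"
      unfolding cmean_cmult by (subst cmean_add) (auto intro!: cw' simp: cmean_const)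
    also have "cmean (\<lambda>z. w z powr p) 1 = cmean (\<lambda>z. log_plus (norm (g z)) powr p) \<rho>"
      by (simp add: cmean_def w_def)
    also have "3 powr p * (\<dots> + 2 * pi * 3 powr p) \<le> 3 powr p * (B + 2 * pi * 3 powr p)"
      using B by (intro mult_left_mono) auto
    finally show "cmean (\<lambda>z. Re (poly q z) powr p) r \<le> 3 powr p * (B + 2 * pi * 3 powr p)" .
  qed
qed

text \<open>Upper bounds pass to a locally uniform limit of the functions exp (- q N). The uniform
  bound on the p-th means of Re (q N) keeps the limit from collapsing to 0 and controls its
  inverse.\<close>

theorem log_mean_bounded_outer_divisor:
  assumes g: "g holomorphic_on ball 0 1" "log_mean_bounded p g" and "p \<ge> 1"
  obtains d where "d holomorphic_on ball 0 1" "\<And>z. z \<in> ball 0 1 \<Longrightarrow> d z \<noteq> 0"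
    "\<And>z. z \<in> ball 0 1 \<Longrightarrow> norm (d z) \<le> 1" "\<And>z. z \<in> ball 0 1 \<Longrightarrow> norm (d z * g z) \<le> 1"
    "log_mean_bounded p (\<lambda>z. inverse (d z))"
proof -
  define \<rho> where "\<rho> N = real (Suc N) / real (Suc (Suc N))" for N
  have \<rho>: "0 < \<rho> N" "\<rho> N < 1" for N by (auto simp: \<rho>_def field_simps)
  have \<rho>_lim: "\<rho> \<longlonglongrightarrow> 1"
    unfolding \<rho>_def[abs_def] by real_asymp
  obtain B where B: "\<And>r. r \<in> {0<..<1} \<Longrightarrow> cmean (\<lambda>z. log_plus (norm (g z)) powr p) r \<le> B"
    using g(2) unfolding log_mean_bounded_def by blast
  define C where "C = 3 powr p * (B + 2 * pi * 3 powr p)"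
  have "\<exists>q. (\<forall>z\<in>cball 0 1. Re (poly q z) \<ge> 0) \<and>
    (\<forall>z\<in>cball 0 1. norm (exp (- poly q z) * g (of_real (\<rho> N) * z)) \<le> 1) \<and>
    (\<forall>r\<in>{0<..1}. cmean (\<lambda>z. Re (poly q z) powr p) r \<le> C)" for N
  proof -
    have "cmean (\<lambda>z. log_plus (norm (g z)) powr p) (\<rho> N) \<le> B" by (rule B) (use \<rho> in auto)
    note approx = outer_approximant[OF g(1) \<rho> \<open>p \<ge> 1\<close> this]
    obtain q where "\<And>z. z \<in> cball 0 1 \<Longrightarrow> Re (poly q z) \<ge> 0"
      "\<And>z. z \<in> cball 0 1 \<Longrightarrow> norm (exp (- poly q z) * g (of_real (\<rho> N) * z)) \<le> 1"
      "\<And>r. r \<in> {0<..1} \<Longrightarrow> cmean (\<lambda>z. Re (poly q z) powr p) r \<le> C"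
      using approx unfolding C_def by blast
    then show ?thesis by (intro exI[of _ q]) blast
  qed
  then have "\<forall>N. \<exists>q. (\<forall>z\<in>cball 0 1. Re (poly q z) \<ge> 0) \<and>
    (\<forall>z\<in>cball 0 1. norm (exp (- poly q z) * g (of_real (\<rho> N) * z)) \<le> 1) \<and>
    (\<forall>r\<in>{0<..1}. cmean (\<lambda>z. Re (poly q z) powr p) r \<le> C)" by blast
  from choice[OF this] obtain q where "\<forall>N. (\<forall>z\<in>cball 0 1. Re (poly (q N) z) \<ge> 0) \<and>
    (\<forall>z\<in>cball 0 1. norm (exp (- poly (q N) z) * g (of_real (\<rho> N) * z)) \<le> 1) \<and>
    (\<forall>r\<in>{0<..1}. cmean (\<lambda>z. Re (poly (q N) z) powr p) r \<le> C)" by (rule exE)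
  then have q0: "\<And>N z. z \<in> cball 0 1 \<Longrightarrow> Re (poly (q N) z) \<ge> 0"
    and qg: "\<And>N z. z \<in> cball 0 1 \<Longrightarrow> norm (exp (- poly (q N) z) * g (of_real (\<rho> N) * z)) \<le> 1"
    and qC: "\<And>N r. r \<in> {0<..1} \<Longrightarrow> cmean (\<lambda>z. Re (poly (q N) z) powr p) r \<le> C"
    by blast+
  have cq: "continuous_on S (\<lambda>z. Re (poly (q N) z) powr p)" if "S \<subseteq> cball 0 1" for N S
    using q0 that \<open>p \<ge> 1\<close> by (intro continuous_on_powr' continuous_intros) auto
  define D where "D N z = exp (- poly (q N) z)" for N z
  have D1: "norm (D N z) \<le> 1" if "z \<in> cball 0 1" for N z using q0[OF that] by (simp add: D_def)
  have Dhol: "D N holomorphic_on S" for N S unfolding D_def by (intro holomorphic_intros)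
  obtain d r where d: "d holomorphic_on ball 0 1" and r: "strict_mono (r :: nat \<Rightarrow> nat)"
    and lim: "\<And>x. x \<in> ball 0 1 \<Longrightarrow> (\<lambda>n. D (r n) x) \<longlonglongrightarrow> d x"
    and ulim: "\<And>K. compact K \<Longrightarrow> K \<subseteq> ball 0 1 \<Longrightarrow> uniform_limit K (D \<circ> r) d sequentially"
  proof (rule Montel[of "ball 0 1" "range D" D])
    fix K :: "complex set" assume "K \<subseteq> ball 0 1"
    then show "\<exists>B. \<forall>h\<in>range D. \<forall>z\<in>K. norm (h z) \<le> B"
      using D1 by (intro exI[of _ 1]) auto
  qed (use Dhol that in auto)
  \<comment> \<open>A bound for Re (q N) at 0, from the mean value property and x \<le> 1 +
    x^p.\<close>
  define M where "M = (2 * pi + C) / (2 * pi)"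
  have D0: "norm (D N 0) \<ge> exp (- M)" for N
  proof -
    have "2 * pi * Re (poly (q N) 0) = Re (cmean (poly (q N)) 1)"
      by (subst cmean_holomorphic[of _ 2]) (auto intro!: holomorphic_intros)
    also have "\<dots> = cmean (\<lambda>z. Re (poly (q N) z)) 1"
    proof -
      have "(\<lambda>t. poly (q N) (of_real 1 * cis t)) integrable_on {0..2*pi}"
        by (rule integrable_circle[where S=UNIV]) (auto intro!: continuous_intros)
      from integral_linear[OF this bounded_linear_Re] show ?thesis by (simp add: cmean_def o_def)
    qed
    also have "\<dots> \<le> cmean (\<lambda>z. 1 + Re (poly (q N) z) powr p) 1"
    proof (rule cmean_mono)
      show "continuous_on (cball 0 1) (\<lambda>z. 1 + Re (poly (q N) z) powr p)"
        by (intro continuous_on_add continuous_on_const cq) auto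
      fix z :: complex assume "norm z = 1"
      then have "Re (poly (q N) z) \<ge> 0" by (intro q0) auto
      moreover have "x \<le> 1 + x powr p" if "x \<ge> 0" for x
      proof (cases "x \<le> 1")
        case False
        then have "x powr 1 \<le> x powr p" using \<open>p \<ge> 1\<close> by (intro powr_mono) auto
        then show ?thesis using False by simp
      qed (use that in \<open>auto intro: add_increasing2\<close>)
      ultimately show "Re (poly (q N) z) \<le> 1 + Re (poly (q N) z) powr p" by blast
    qed (auto intro!: continuous_intros)
    also have "\<dots> = 2 * pi + cmean (\<lambda>z. Re (poly (q N) z) powr p) 1"
      by (subst cmean_add) (auto intro!: cq simp: cmean_const)
    also have "\<dots> \<le> 2 * pi + C" using qC[of 1 N] by simp
    finally have "Re (poly (q N) 0) \<le> M" by (simp add: M_def field_simps)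
    then show ?thesis by (simp add: D_def)
  qed
  have d0: "d 0 \<noteq> 0"
  proof -
    have "norm (d 0) \<ge> exp (- M)"
      by (rule tendsto_lowerbound[OF tendsto_norm[OF lim[of 0]]]) (use D0 in auto)
    then have "norm (d 0) > 0" by (rule less_le_trans[OF exp_gt_zero])
    then show ?thesis by simp
  qed
  \<comment> \<open>Hurwitz's theorem requires a nonconstant limit; the constant case is settled by
    \<open>d0\<close>.\<close>
  have dnz: "d z \<noteq> 0" if z: "z \<in> ball 0 1" for z
  proof (cases "d constant_on ball 0 1")
    case True
    then have "d z = d 0" using z unfolding constant_on_def by auto
    then show ?thesis using d0 by simp
  next
    case False
    show ?thesis
      by (rule Hurwitz_no_zeros[of "ball 0 1" "D \<circ> r" d, OF _ _ _ d ulim False _ z])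
         (use Dhol in \<open>auto simp: D_def\<close>)
  qed
  show ?thesis
  proof (rule that[OF d dnz])
    fix z :: complex assume z: "z \<in> ball 0 1"
    show "norm (d z) \<le> 1"
      by (rule tendsto_upperbound[OF tendsto_norm[OF lim[OF z]]]) (use D1 z in auto)
    have zlim: "(\<lambda>N. of_real (\<rho> (r N)) * z) \<longlonglongrightarrow> z"
    proof -
      have "(\<lambda>N. complex_of_real (\<rho> (r N))) \<longlonglongrightarrow> of_real 1"
        by (intro tendsto_of_real filterlim_compose[OF \<rho>_lim filterlim_subseq[OF r]])
      from tendsto_mult[OF this tendsto_const[of z]] show ?thesis by simp
    qed
    have "(\<lambda>N. g (of_real (\<rho> (r N)) * z)) \<longlonglongrightarrow> g z"
      using isCont_tendsto_compose[OF _ zlim, of g] holomorphic_on_imp_continuous_on[OF g(1)] z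
      by (simp add: continuous_on_eq_continuous_at)
    from tendsto_norm[OF tendsto_mult[OF lim[OF z] this]]
    show "norm (d z * g z) \<le> 1"
      by (rule tendsto_upperbound) (use qg z in \<open>auto simp: D_def\<close>)
  next
    have cd: "continuous_on (ball 0 1) (\<lambda>z. inverse (d z))"
      using dnz holomorphic_on_imp_continuous_on[OF d] by (intro continuous_intros) auto
    have "cmean (\<lambda>z. log_plus (norm (inverse (d z))) powr p) x \<le> 3 powr p * (C + 2 * pi)" if x: "x \<in> {0<..<1}" for x
    proof -
      have cs: "compact (sphere (0::complex) x)" "sphere 0 x \<subseteq> ball (0::complex) 1" "sphere (0::complex) x \<noteq> {}"
        using x by auto
      have "continuous_on (sphere 0 x) (\<lambda>z. norm (d z))"
        by (intro continuous_intros continuous_on_subset[OF holomorphic_on_imp_continuous_on[OF d] cs(2)])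
      from continuous_attains_inf[OF cs(1,3) this]
      obtain z0 where z0: "z0 \<in> sphere 0 x" "\<And>z. z \<in> sphere 0 x \<Longrightarrow> norm (d z0) \<le> norm (d z)"
        by blast
      \<comment> \<open>With the minimum of |d| on the circle as tolerance, a single approximant
        satisfies |D| \<le> 2 |d| there. Hence log+ (1/|d|) \<le> 1 + Re q, with a mean bound
        independent of the radius.\<close>
      have "norm (d z0) > 0" using dnz z0(1) cs(2) by auto
      from uniform_limitD[OF ulim[OF cs(1,2)] this]
      obtain N where *: "\<forall>z\<in>sphere 0 x. dist ((D \<circ> r) N z) (d z) < norm (d z0)"
        using eventually_happens'[OF sequentially_bot] by blast
      have N: "norm (D (r N) z) \<le> 2 * norm (d z)" if "norm z = x" for z
      proof -
        have s: "z \<in> sphere 0 x" using that by simp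
        from bspec[OF * s] have "norm (D (r N) z - d z) < norm (d z0)" by (simp add: dist_norm)
        with z0(2)[OF s] norm_triangle_ineq2[of "D (r N) z" "d z"] show ?thesis by linarith
      qed
      have "cmean (\<lambda>z. log_plus (norm (inverse (d z))) powr p) x
        \<le> cmean (\<lambda>z. 3 powr p * (Re (poly (q (r N)) z) powr p + 1)) x"
        unfolding cmean_def
      proof (intro integral_le)
        show "(\<lambda>t. log_plus (norm (inverse (d (of_real x * cis t)))) powr p) integrable_on {0..2*pi}"
          by (rule integrable_circle_disc[OF continuous_on_log_plus[OF cd] x]) (use \<open>p \<ge> 1\<close> in auto)
        show "(\<lambda>t. 3 powr p * (Re (poly (q (r N)) (of_real x * cis t)) powr p + 1)) integrable_on {0..2*pi}"
          by (rule integrable_circle_disc[OF _ x, of "\<lambda>z. 3 powr p * (Re (poly (q (r N)) z) powr p + 1)"])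
             (intro continuous_on_mult continuous_on_add continuous_on_const cq, auto)
        fix t
        let ?z = "of_real x * cis t"
        have z: "norm ?z = x" "?z \<in> ball 0 1" using x by auto
        have "norm (inverse (d ?z)) \<le> 2 * exp (Re (poly (q (r N)) ?z))"
        proof -
          have "exp (- Re (poly (q (r N)) ?z)) \<le> 2 * norm (d ?z)" using N[OF z(1)] by (simp add: D_def)
          moreover have "norm (d ?z) > 0" using dnz[OF z(2)] by simp
          ultimately show ?thesis unfolding norm_inverse by (simp add: exp_minus field_simps)
        qed
        then have "log_plus (norm (inverse (d ?z))) \<le> log_plus (2 * exp (Re (poly (q (r N)) ?z)))"
          by (intro log_plus_mono) auto
        also have "\<dots> \<le> log_plus 2 + log_plus (exp (Re (poly (q (r N)) ?z)))"
          by (intro log_plus_mult_le) auto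
        also have "\<dots> \<le> 1 + Re (poly (q (r N)) ?z)"
          using q0[of ?z "r N"] z ln_2_less_1 by (auto simp: log_plus_def)
        finally have "log_plus (norm (inverse (d ?z))) powr p \<le> (Re (poly (q (r N)) ?z) + 1 + 0) powr p"
          using \<open>p \<ge> 1\<close> by (intro powr_mono2) auto
        also have "\<dots> \<le> 3 powr p * (Re (poly (q (r N)) ?z) powr p + 1 powr p + 0 powr p)"
          using q0[of ?z "r N"] z \<open>p \<ge> 1\<close> by (intro powr_add3_le) auto
        finally show "log_plus (norm (inverse (d ?z))) powr p \<le> 3 powr p * (Re (poly (q (r N)) ?z) powr p + 1)"
          by simp
      qed
      also have "\<dots> = 3 powr p * (cmean (\<lambda>z. Re (poly (q (r N)) z) powr p) x + 2 * pi)"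
        unfolding cmean_cmult using x by (subst cmean_add) (auto intro!: cq simp: cmean_const)
      also have "\<dots> \<le> 3 powr p * (C + 2 * pi)"
        using qC[of x "r N"] x by (intro mult_left_mono) auto
      finally show ?thesis .
    qed
    then show "log_mean_bounded p (\<lambda>z. inverse (d z))"
      unfolding log_mean_bounded_def by blast
  qed
qed

section \<open>The ring of the Privalov class\<close>

lemma log_mean_bounded_cong:
  assumes "\<And>z. z \<in> ball 0 1 \<Longrightarrow> f z = g z"
  shows "log_mean_bounded p f \<longleftrightarrow> log_mean_bounded p g"
proof -
  have "cmean (\<lambda>z. log_plus (norm (f z)) powr p) r = cmean (\<lambda>z. log_plus (norm (g z)) powr p) r"
    if "r \<in> {0<..<1}" for r
    by (rule cmean_cong) (use assms that in auto)
  then show ?thesis by (auto simp: log_mean_bounded_def)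
qed

lemma log_mean_bounded_power:
  assumes "continuous_on (ball 0 1) f" "log_mean_bounded p f" "p > 0"
  shows "log_mean_bounded p (\<lambda>z. f z ^ k)"
  using log_mean_bounded_prod[of "{..<k}" "\<lambda>i. f" p] assms by simp

lemma carrier_Np_iff:
  "f \<in> carrier (Np p) \<longleftrightarrow> f \<in> extensional unit_disc \<and> f holomorphic_on unit_disc \<and> log_mean_bounded p f"
proof -
  have *: "integral {0..2*pi} (\<lambda>\<theta>. log_plus (norm (f (of_real r * cis \<theta>))) powr p / (2*pi))
    = cmean (\<lambda>z. log_plus (norm (f z)) powr p) r / (2*pi)" for r
    by (simp add: cmean_def)
  have "bdd_above ((\<lambda>r. integral {0..2*pi}
      (\<lambda>\<theta>. log_plus (norm (f (of_real r * cis \<theta>))) powr p / (2*pi))) ` {0<..<1}) \<longleftrightarrow> log_mean_bounded p f"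
    unfolding *
  proof
    assume "bdd_above ((\<lambda>r. cmean (\<lambda>z. log_plus (norm (f z)) powr p) r / (2*pi)) ` {0<..<1})"
    then obtain M where "\<forall>r\<in>{0<..<1}. cmean (\<lambda>z. log_plus (norm (f z)) powr p) r / (2*pi) \<le> M"
      unfolding bdd_above_def by blast
    then show "log_mean_bounded p f"
      unfolding log_mean_bounded_def
      by (intro exI[of _ "M * (2*pi)"]) (simp add: pos_divide_le_eq)
  next
    assume "log_mean_bounded p f"
    then obtain M where "\<forall>r\<in>{0<..<1}. cmean (\<lambda>z. log_plus (norm (f z)) powr p) r \<le> M"
      unfolding log_mean_bounded_def by blast
    then show "bdd_above ((\<lambda>r. cmean (\<lambda>z. log_plus (norm (f z)) powr p) r / (2*pi)) ` {0<..<1})"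
      by (intro bdd_aboveI2[of _ _ "M / (2*pi)"] divide_right_mono) auto
  qed
  moreover have "carrier (Np p) = Np_carrier p" by (simp add: Np_def)
  ultimately show ?thesis
    unfolding Np_carrier_def by (simp only: mem_Collect_eq)
qed

lemma restrict_in_carrier_Np:
  assumes "f holomorphic_on unit_disc" "log_mean_bounded p f"
  shows "restrict f unit_disc \<in> carrier (Np p)"
proof -
  have "restrict f unit_disc holomorphic_on unit_disc"
    by (rule holomorphic_transform[OF assms(1)]) simp
  moreover have "log_mean_bounded p (restrict f unit_disc)"
    using assms(2) log_mean_bounded_cong[of "restrict f unit_disc" f] by simp
  ultimately show ?thesis by (simp add: carrier_Np_iff)
qed

lemma carrier_NpD:
  assumes "f \<in> carrier (Np p)"
  shows "f holomorphic_on unit_disc" "continuous_on unit_disc f" "log_mean_bounded p f" "f \<in> extensional unit_disc"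
  using assms holomorphic_on_imp_continuous_on by (auto simp: carrier_Np_iff)

lemma Np_simps:
  "x \<otimes>\<^bsub>Np p\<^esub> y = (\<lambda>z\<in>unit_disc. x z * y z)"
  "x \<oplus>\<^bsub>Np p\<^esub> y = (\<lambda>z\<in>unit_disc. x z + y z)"
  "\<one>\<^bsub>Np p\<^esub> = (\<lambda>z\<in>unit_disc. 1)" "\<zero>\<^bsub>Np p\<^esub> = (\<lambda>z\<in>unit_disc. 0)"
  by (simp_all add: Np_def)

lemma log_mean_bounded_const:
  assumes "p > 0"
  shows "log_mean_bounded p (\<lambda>z. c)"
  by (rule log_mean_bounded_const_bound[of _ _ "norm c"]) (use assms in auto)

lemma uminus_in_carrier_Np:
  assumes "x \<in> carrier (Np p)" "p > 0"
  shows "(\<lambda>z\<in>unit_disc. - x z) \<in> carrier (Np p)"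
proof (rule restrict_in_carrier_Np)
  show "log_mean_bounded p (\<lambda>z. - x z)"
    using carrier_NpD(3)[OF assms(1)] by (simp add: log_mean_bounded_def)
qed (use carrier_NpD[OF assms(1)] in \<open>auto intro!: holomorphic_intros\<close>)

lemma sum_in_carrier_Np:
  assumes "finite I" "\<And>i. i \<in> I \<Longrightarrow> a i \<in> carrier (Np p)" "p > 0"
  shows "(\<lambda>z\<in>unit_disc. \<Sum>i\<in>I. a i z) \<in> carrier (Np p)"
proof (rule restrict_in_carrier_Np)
  show "(\<lambda>z. \<Sum>i\<in>I. a i z) holomorphic_on unit_disc"
    by (intro holomorphic_intros carrier_NpD(1)[OF assms(2)])
  show "log_mean_bounded p (\<lambda>z. \<Sum>i\<in>I. a i z)"
    using assms
  proof (induction I)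
    case empty
    then show ?case by (simp add: log_mean_bounded_zero)
  next
    case (insert i I)
    have "log_mean_bounded p (\<lambda>z. a i z + (\<Sum>i\<in>I. a i z))"
      using insert carrier_NpD(2,3) by (intro log_mean_bounded_add continuous_intros) auto
    then show ?case using insert by simp
  qed
qed

lemma mult_in_carrier_Np:
  assumes "x \<in> carrier (Np p)" "y \<in> carrier (Np p)" "p > 0"
  shows "(\<lambda>z\<in>unit_disc. x z * y z) \<in> carrier (Np p)"
  using carrier_NpD[OF assms(1)] carrier_NpD[OF assms(2)] assms(3)
  by (intro restrict_in_carrier_Np log_mean_bounded_mult holomorphic_intros) auto

lemma add_in_carrier_Np:
  assumes "x \<in> carrier (Np p)" "y \<in> carrier (Np p)" "p > 0"
  shows "(\<lambda>z\<in>unit_disc. x z + y z) \<in> carrier (Np p)"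
  using carrier_NpD[OF assms(1)] carrier_NpD[OF assms(2)] assms(3)
  by (intro restrict_in_carrier_Np log_mean_bounded_add holomorphic_intros) auto

lemma const_in_carrier_Np: "p > 0 \<Longrightarrow> (\<lambda>z\<in>unit_disc. c) \<in> carrier (Np p)"
  by (intro restrict_in_carrier_Np log_mean_bounded_const holomorphic_intros)

lemma cring_Np:
  assumes "p > 0"
  shows "cring (Np p)"
proof (rule cringI)
  show "abelian_group (Np p)"
  proof (rule abelian_groupI)
    fix x assume x: "x \<in> carrier (Np p)"
    show "\<zero>\<^bsub>Np p\<^esub> \<oplus>\<^bsub>Np p\<^esub> x = x"
      using carrier_NpD(4)[OF x] by (auto simp: Np_simps extensional_def)
    show "\<exists>y\<in>carrier (Np p). y \<oplus>\<^bsub>Np p\<^esub> x = \<zero>\<^bsub>Np p\<^esub>"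
      by (rule bexI[OF _ uminus_in_carrier_Np[OF x assms]]) (auto simp: Np_simps)
  qed (auto simp: Np_simps add_in_carrier_Np const_in_carrier_Np assms algebra_simps)
  show "comm_monoid (Np p)"
  proof (rule comm_monoidI)
    fix x assume x: "x \<in> carrier (Np p)"
    show "\<one>\<^bsub>Np p\<^esub> \<otimes>\<^bsub>Np p\<^esub> x = x"
      using carrier_NpD(4)[OF x] by (auto simp: Np_simps extensional_def)
  qed (auto simp: Np_simps mult_in_carrier_Np const_in_carrier_Np assms algebra_simps)
qed (auto simp: Np_simps algebra_simps)

lemma a_inv_Np:
  assumes "p > 0" "x \<in> carrier (Np p)"
  shows "\<ominus>\<^bsub>Np p\<^esub> x = (\<lambda>z\<in>unit_disc. - x z)"
proof -
  interpret cring "Np p" by (rule cring_Np[OF assms(1)])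
  show ?thesis
    by (rule minus_equality[OF _ assms(2) uminus_in_carrier_Np[OF assms(2,1)]])
       (auto simp: Np_simps)
qed

text \<open>\<open>genideal\<close> is an intersection of ideals; this explicit ideal bounds it from
  above.\<close>

lemma combination_ideal:
  assumes "p > 0" and f: "\<And>i. i \<in> I \<Longrightarrow> f i \<in> carrier (Np p)" and "finite I"
  shows "ideal {s. \<exists>g. (\<forall>i\<in>I. g i \<in> carrier (Np p)) \<and> s = (\<lambda>z\<in>unit_disc. \<Sum>i\<in>I. f i z * g i z)} (Np p)"
    (is "ideal ?J _")
proof -
  interpret cring "Np p" by (rule cring_Np[OF assms(1)])
  have sub: "?J \<subseteq> carrier (Np p)"
  proof
    fix s assume "s \<in> ?J"
    then obtain g where g: "\<forall>i\<in>I. g i \<in> carrier (Np p)" "s = (\<lambda>z\<in>unit_disc. \<Sum>i\<in>I. f i z * g i z)" by blast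
    have "s = (\<lambda>z\<in>unit_disc. \<Sum>i\<in>I. (\<lambda>z\<in>unit_disc. f i z * g i z) z)" using g(2) by auto
    also have "\<dots> \<in> carrier (Np p)"
      by (intro sum_in_carrier_Np mult_in_carrier_Np assms) (use g f in auto)
    finally show "s \<in> carrier (Np p)" .
  qed
  have closed: "(\<lambda>z\<in>unit_disc. a z * s z) \<in> ?J" if s: "s \<in> ?J" and a: "a \<in> carrier (Np p)" for s a
  proof -
    obtain g where g: "\<forall>i\<in>I. g i \<in> carrier (Np p)" "s = (\<lambda>z\<in>unit_disc. \<Sum>i\<in>I. f i z * g i z)" using s by blast
    then show ?thesis
      by (intro CollectI exI[of _ "\<lambda>i. \<lambda>z\<in>unit_disc. a z * g i z"])
         (auto intro!: mult_in_carrier_Np a assms simp: sum_distrib_left mult_ac)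
  qed
  have "subgroup ?J (add_monoid (Np p))"
  proof
    show "?J \<subseteq> carrier (add_monoid (Np p))" using sub by simp
    show "\<one>\<^bsub>add_monoid (Np p)\<^esub> \<in> ?J"
      using const_in_carrier_Np[OF assms(1), of 0]
      by (intro CollectI exI[of _ "\<lambda>i. \<lambda>z\<in>unit_disc. 0"]) (auto simp: Np_simps)
    fix x y assume x: "x \<in> ?J"
    have "x \<in> carrier (Np p)" using x sub by blast
    from a_inv_Np[OF assms(1) this] have "inv\<^bsub>add_monoid (Np p)\<^esub> x = (\<lambda>z\<in>unit_disc. - x z)"
      unfolding a_inv_def .
    also have "\<dots> = (\<lambda>z\<in>unit_disc. (\<lambda>z\<in>unit_disc. - 1) z * x z)"
      by (rule restrict_ext) simp
    finally have "inv\<^bsub>add_monoid (Np p)\<^esub> x = (\<lambda>z\<in>unit_disc. (\<lambda>z\<in>unit_disc. - 1) z * x z)" .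
    then show "inv\<^bsub>add_monoid (Np p)\<^esub> x \<in> ?J"
      using closed[OF x const_in_carrier_Np[OF assms(1), of "-1"]] by simp
    assume y: "y \<in> ?J"
    obtain g where g: "\<forall>i\<in>I. g i \<in> carrier (Np p)" "x = (\<lambda>z\<in>unit_disc. \<Sum>i\<in>I. f i z * g i z)" using x by blast
    obtain g' where g': "\<forall>i\<in>I. g' i \<in> carrier (Np p)" "y = (\<lambda>z\<in>unit_disc. \<Sum>i\<in>I. f i z * g' i z)" using y by blast
    show "x \<otimes>\<^bsub>add_monoid (Np p)\<^esub> y \<in> ?J"
      using g g'
      by (intro CollectI exI[of _ "\<lambda>i. \<lambda>z\<in>unit_disc. g i z + g' i z"])
         (auto intro!: add_in_carrier_Np assms simp: Np_simps distrib_left sum.distrib)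
  qed
  then show ?thesis
  proof (rule idealI[OF ring_axioms])
    fix a x assume "a \<in> ?J" "x \<in> carrier (Np p)"
    from closed[OF this] show "x \<otimes>\<^bsub>Np p\<^esub> a \<in> ?J" "a \<otimes>\<^bsub>Np p\<^esub> x \<in> ?J"
      by (simp_all add: Np_simps mult.commute)
  qed
qed

lemma sum_in_ideal_Np:
  assumes "ideal J (Np p)" "finite I" "\<And>i. i \<in> I \<Longrightarrow> a i \<in> J"
  shows "(\<lambda>z\<in>unit_disc. \<Sum>i\<in>I. a i z) \<in> J"
proof -
  interpret ideal J "Np p" by fact
  show ?thesis using assms(2,3)
  proof (induction I)
    case empty
    show ?case
      using additive_subgroup.zero_closed[OF is_additive_subgroup] unfolding Np_simps sum.empty .
  next
    case (insert i I)
    then have "a i \<in> J" "(\<lambda>z\<in>unit_disc. \<Sum>i\<in>I. a i z) \<in> J" by blast+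
    then have "a i \<oplus>\<^bsub>Np p\<^esub> (\<lambda>z\<in>unit_disc. \<Sum>i\<in>I. a i z) \<in> J"
      by (rule additive_subgroup.a_closed[OF is_additive_subgroup])
    moreover have "a i \<oplus>\<^bsub>Np p\<^esub> (\<lambda>z\<in>unit_disc. \<Sum>i\<in>I. a i z) = (\<lambda>z\<in>unit_disc. \<Sum>i\<in>insert i I. a i z)"
      using insert by (auto simp: Np_simps)
    ultimately show ?case by (simp only:)
  qed
qed

lemma genideal_Np_eq_carrier_iff:
  assumes "p > 0" and f: "\<And>i. i \<in> I \<Longrightarrow> f i \<in> carrier (Np p)" and "finite I"
  shows "genideal (Np p) (f ` I) = carrier (Np p) \<longleftrightarrow>
    (\<exists>g. (\<forall>i\<in>I. g i \<in> carrier (Np p)) \<and> (\<forall>z\<in>unit_disc. (\<Sum>i\<in>I. f i z * g i z) = 1))"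
    (is "?lhs \<longleftrightarrow> ?rhs")
proof -
  interpret cring "Np p" by (rule cring_Np[OF assms(1)])
  have fI: "f ` I \<subseteq> carrier (Np p)" using f by auto
  show ?thesis
  proof
    assume ?lhs
    let ?J = "{s. \<exists>g. (\<forall>i\<in>I. g i \<in> carrier (Np p)) \<and> s = (\<lambda>z\<in>unit_disc. \<Sum>i\<in>I. f i z * g i z)}"
    have "f ` I \<subseteq> ?J"
    proof
      fix s assume "s \<in> f ` I"
      then obtain j where j: "j \<in> I" "s = f j" by blast
      have "f j = (\<lambda>z\<in>unit_disc. \<Sum>i\<in>I. f i z * (\<lambda>z\<in>unit_disc. if i = j then 1 else 0) z)"
      proof
        fix z
        show "f j z = (\<lambda>z\<in>unit_disc. \<Sum>i\<in>I. f i z * (\<lambda>z\<in>unit_disc. if i = j then 1 else 0) z) z"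
        proof (cases "z \<in> unit_disc")
          case True
          have "(\<Sum>i\<in>I. f i z * (\<lambda>z\<in>unit_disc. if i = j then 1 else 0) z) = (\<Sum>i\<in>I. if i = j then f i z else 0)"
            using True by (intro sum.cong) auto
          then show ?thesis using True j \<open>finite I\<close> by simp
        next
          case False
          then show ?thesis using carrier_NpD(4)[OF f[OF j(1)]] by (simp add: extensional_def)
        qed
      qed
      then show "s \<in> ?J"
        unfolding j(2) using const_in_carrier_Np[OF assms(1)]
        by (intro CollectI exI[of _ "\<lambda>i. \<lambda>z\<in>unit_disc. if i = j then 1 else 0"]) auto
    qed
    then have "genideal (Np p) (f ` I) \<subseteq> ?J"
      by (intro genideal_minimal combination_ideal assms) auto
    then have "\<one>\<^bsub>Np p\<^esub> \<in> ?J" using \<open>?lhs\<close> one_closed by auto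
    then obtain g where g: "\<forall>i\<in>I. g i \<in> carrier (Np p)"
      "(\<lambda>z\<in>unit_disc. 1) = (\<lambda>z\<in>unit_disc. \<Sum>i\<in>I. f i z * g i z)" unfolding Np_simps by blast
    have "(\<Sum>i\<in>I. f i z * g i z) = 1" if "z \<in> unit_disc" for z
      using fun_cong[OF g(2), of z] that by simp
    with g(1) show ?rhs by blast
  next
    assume ?rhs
    then obtain g where g: "\<And>i. i \<in> I \<Longrightarrow> g i \<in> carrier (Np p)"
      "\<And>z. z \<in> unit_disc \<Longrightarrow> (\<Sum>i\<in>I. f i z * g i z) = 1" by blast
    note J = genideal_ideal[OF fI]
    interpret J: ideal "genideal (Np p) (f ` I)" "Np p" by (rule J)
    have "(\<lambda>z\<in>unit_disc. \<Sum>i\<in>I. (f i \<otimes>\<^bsub>Np p\<^esub> g i) z) \<in> genideal (Np p) (f ` I)"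
      by (intro sum_in_ideal_Np[OF J \<open>finite I\<close>] J.I_r_closed g) (use genideal_self[OF fI] in auto)
    moreover have "(\<lambda>z\<in>unit_disc. \<Sum>i\<in>I. (f i \<otimes>\<^bsub>Np p\<^esub> g i) z) = \<one>\<^bsub>Np p\<^esub>"
      using g(2) by (auto simp: Np_simps)
    ultimately show ?lhs using J.one_imp_carrier by simp
  qed
qed

lemma unit_Np_iff:
  assumes "p > 0"
  shows "g \<in> Units (Np p) \<longleftrightarrow> g \<in> carrier (Np p) \<and>
    (\<exists>e\<in>carrier (Np p). \<forall>z\<in>unit_disc. g z * e z = 1)"
proof -
  have "(e \<otimes>\<^bsub>Np p\<^esub> g = \<one>\<^bsub>Np p\<^esub> \<and> g \<otimes>\<^bsub>Np p\<^esub> e = \<one>\<^bsub>Np p\<^esub>) \<longleftrightarrow> (\<forall>z\<in>unit_disc. g z * e z = 1)" for e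
  proof
    assume "e \<otimes>\<^bsub>Np p\<^esub> g = \<one>\<^bsub>Np p\<^esub> \<and> g \<otimes>\<^bsub>Np p\<^esub> e = \<one>\<^bsub>Np p\<^esub>"
    then have "(\<lambda>z\<in>unit_disc. g z * e z) = (\<lambda>z\<in>unit_disc. 1)" by (simp add: Np_simps)
    note eq = fun_cong[OF this]
    show "\<forall>z\<in>unit_disc. g z * e z = 1"
    proof
      fix z :: complex assume "z \<in> unit_disc"
      then show "g z * e z = 1" using eq[of z] by simp
    qed
  qed (auto simp: Np_simps mult.commute)
  then show ?thesis by (auto simp: Units_def)
qed

section \<open>The corona theorem for the Privalov class\<close>

lemma norm_prod_le_norm_member:
  fixes d :: "'i \<Rightarrow> 'a::{real_normed_field}"
  assumes "finite I" "i \<in> I" "\<And>j. j \<in> I \<Longrightarrow> norm (d j) \<le> 1"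
  shows "norm (\<Prod>j\<in>I. d j) \<le> norm (d i)"
proof -
  have "norm (\<Prod>j\<in>I. d j) = norm (d i) * (\<Prod>j\<in>I - {i}. norm (d j))"
    using assms by (simp add: prod.remove norm_mult prod_norm)
  also have "\<dots> \<le> norm (d i) * 1"
    using assms by (intro mult_left_mono prod_le_1) auto
  finally show ?thesis by simp
qed

text \<open>The product of the individual divisors works: the extra factors have norm at most 1 and
  preserve each bound.\<close>

lemma outer_common_divisor:
  assumes "g ` I \<subseteq> carrier (Np p)" and "finite I" "p \<ge> 1"
  obtains d where "d holomorphic_on ball 0 1" "\<And>z. z \<in> ball 0 1 \<Longrightarrow> d z \<noteq> 0"
    "\<And>z. z \<in> ball 0 1 \<Longrightarrow> norm (d z) \<le> 1" "\<And>i z. i \<in> I \<Longrightarrow> z \<in> ball 0 1 \<Longrightarrow> norm (d z * g i z) \<le> 1"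
    "log_mean_bounded p (\<lambda>z. inverse (d z))"
proof -
  have g: "g i \<in> carrier (Np p)" if "i \<in> I" for i using assms(1) that by blast
  have "\<forall>i. \<exists>d. i \<in> I \<longrightarrow> d holomorphic_on ball 0 1 \<and> (\<forall>z\<in>ball 0 1. d z \<noteq> 0 \<and> norm (d z) \<le> 1 \<and> norm (d z * g i z) \<le> 1)
    \<and> log_mean_bounded p (\<lambda>z. inverse (d z))"
  proof
    fix i
    show "\<exists>d. i \<in> I \<longrightarrow> d holomorphic_on ball 0 1 \<and> (\<forall>z\<in>ball 0 1. d z \<noteq> 0 \<and> norm (d z) \<le> 1 \<and> norm (d z * g i z) \<le> 1)
      \<and> log_mean_bounded p (\<lambda>z. inverse (d z))"
    proof (cases "i \<in> I")
      case True
      obtain d where "d holomorphic_on ball 0 1" "\<And>z. z \<in> ball 0 1 \<Longrightarrow> d z \<noteq> 0"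
        "\<And>z. z \<in> ball 0 1 \<Longrightarrow> norm (d z) \<le> 1" "\<And>z. z \<in> ball 0 1 \<Longrightarrow> norm (d z * g i z) \<le> 1"
        "log_mean_bounded p (\<lambda>z. inverse (d z))"
        using log_mean_bounded_outer_divisor[OF carrier_NpD(1,3)[OF g[OF True]] \<open>p \<ge> 1\<close>] by blast
      then show ?thesis by (intro exI[of _ d]) blast
    qed simp
  qed
  from choice[OF this] obtain d where *: "\<forall>i. i \<in> I \<longrightarrow> d i holomorphic_on ball 0 1 \<and>
      (\<forall>z\<in>ball 0 1. d i z \<noteq> 0 \<and> norm (d i z) \<le> 1 \<and> norm (d i z * g i z) \<le> 1)
    \<and> log_mean_bounded p (\<lambda>z. inverse (d i z))" by (rule exE)
  then have d: "\<And>i. i \<in> I \<Longrightarrow> d i holomorphic_on ball 0 1"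
    "\<And>i z. i \<in> I \<Longrightarrow> z \<in> ball 0 1 \<Longrightarrow> d i z \<noteq> 0" "\<And>i z. i \<in> I \<Longrightarrow> z \<in> ball 0 1 \<Longrightarrow> norm (d i z) \<le> 1"
    "\<And>i z. i \<in> I \<Longrightarrow> z \<in> ball 0 1 \<Longrightarrow> norm (d i z * g i z) \<le> 1"
    "\<And>i. i \<in> I \<Longrightarrow> log_mean_bounded p (\<lambda>z. inverse (d i z))"
    by blast+
  show ?thesis
  proof (rule that[of "\<lambda>z. \<Prod>i\<in>I. d i z"])
    show "(\<lambda>z. \<Prod>i\<in>I. d i z) holomorphic_on ball 0 1" by (intro holomorphic_intros d)
    show "(\<Prod>i\<in>I. d i z) \<noteq> 0" if "z \<in> ball 0 1" for z
      using d(2) that \<open>finite I\<close> by auto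
    show "norm (\<Prod>i\<in>I. d i z) \<le> 1" if "z \<in> ball 0 1" for z
      unfolding prod_norm[symmetric] using d(3) that by (intro prod_le_1) auto
    show "norm ((\<Prod>i\<in>I. d i z) * g i z) \<le> 1" if "i \<in> I" "z \<in> ball 0 1" for i z
    proof -
      have "norm ((\<Prod>i\<in>I. d i z) * g i z) \<le> norm (d i z) * norm (g i z)"
        unfolding norm_mult
        by (intro mult_right_mono norm_prod_le_norm_member) (use that d(3) \<open>finite I\<close> in auto)
      also have "\<dots> \<le> 1" using d(4)[OF that] by (simp add: norm_mult)
      finally show ?thesis .
    qed
    have "log_mean_bounded p (\<lambda>z. \<Prod>i\<in>I. inverse (d i z))"
    proof (rule log_mean_bounded_prod)
      show "continuous_on (ball 0 1) (\<lambda>z. inverse (d i z))" if "i \<in> I" for i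
        using d(2)[OF that] holomorphic_on_imp_continuous_on[OF d(1)[OF that]] by (intro continuous_intros) auto
    qed (use d \<open>finite I\<close> \<open>p \<ge> 1\<close> in auto)
    then show "log_mean_bounded p (\<lambda>z. inverse (\<Prod>i\<in>I. d i z))"
      by (simp add: prod_inversef[symmetric] o_def)
  qed
qed

theorem theorem5:
  fixes p :: real and n :: nat and f :: "nat \<Rightarrow> complex \<Rightarrow> complex"
  assumes "1 < p" and "n \<ge> 1" and "\<And>i. i \<in> {1..n} \<Longrightarrow> f i \<in> carrier (Np p)"
  shows "genideal (Np p) (f ` {1..n}) = carrier (Np p) \<longleftrightarrow>
    (\<exists>g\<in>Units (Np p). \<forall>z\<in>unit_disc. norm (g z) \<le> (\<Sum>i=1..n. norm (f i z)))"
proof -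
  have p: "p > 0" "p \<ge> 1" using assms(1) by auto
  note f = assms(3)
  have gen: "genideal (Np p) (f ` {1..n}) = carrier (Np p) \<longleftrightarrow>
    (\<exists>g. (\<forall>i\<in>{1..n}. g i \<in> carrier (Np p)) \<and> (\<forall>z\<in>unit_disc. (\<Sum>i=1..n. f i z * g i z) = 1))"
    by (rule genideal_Np_eq_carrier_iff[OF p(1)]) (use f in auto)
  show ?thesis unfolding gen
  proof
    assume "\<exists>g. (\<forall>i\<in>{1..n}. g i \<in> carrier (Np p)) \<and> (\<forall>z\<in>unit_disc. (\<Sum>i=1..n. f i z * g i z) = 1)"
    then obtain g where g: "\<And>i. i \<in> {1..n} \<Longrightarrow> g i \<in> carrier (Np p)"
      "\<And>z. z \<in> unit_disc \<Longrightarrow> (\<Sum>i=1..n. f i z * g i z) = 1" by blast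
    \<comment> \<open>If |d g_i| \<le> 1, the Bezout equation times d reads d = \<Sum> f_i (d g_i),
      so d itself is the required unit.\<close>
    have gI: "g ` {1..n} \<subseteq> carrier (Np p)" using g(1) by blast
    obtain d where d: "d holomorphic_on unit_disc" "\<And>z. z \<in> unit_disc \<Longrightarrow> d z \<noteq> 0"
      "\<And>z. z \<in> unit_disc \<Longrightarrow> norm (d z) \<le> 1" "\<And>i z. i \<in> {1..n} \<Longrightarrow> z \<in> unit_disc \<Longrightarrow> norm (d z * g i z) \<le> 1"
      "log_mean_bounded p (\<lambda>z. inverse (d z))"
      using outer_common_divisor[OF gI finite_atLeastAtMost p(2)] by blast
    show "\<exists>g\<in>Units (Np p). \<forall>z\<in>unit_disc. norm (g z) \<le> (\<Sum>i=1..n. norm (f i z))"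
    proof (intro bexI ballI)
      fix z assume z: "z \<in> unit_disc"
      have "norm (d z) = norm (\<Sum>i=1..n. f i z * (d z * g i z))"
        using arg_cong[OF g(2)[OF z], of "\<lambda>x. norm (d z * x)"] by (simp add: sum_distrib_left mult_ac)
      also have "\<dots> \<le> (\<Sum>i=1..n. norm (f i z))"
        by (intro sum_norm_le) (use d(4) z in \<open>auto simp: norm_mult mult_left_le\<close>)
      finally show "norm ((\<lambda>z\<in>unit_disc. d z) z) \<le> (\<Sum>i=1..n. norm (f i z))" using z by simp
    next
      have "(\<lambda>z\<in>unit_disc. d z) \<in> carrier (Np p)"
        using d(1,3) p holomorphic_on_imp_continuous_on[OF d(1)]
        by (intro restrict_in_carrier_Np log_mean_bounded_const_bound[of _ _ 1]) auto
      moreover have "(\<lambda>z\<in>unit_disc. inverse (d z)) \<in> carrier (Np p)"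
        using d by (intro restrict_in_carrier_Np holomorphic_intros) auto
      moreover have "\<forall>z\<in>unit_disc. (\<lambda>z\<in>unit_disc. d z) z * (\<lambda>z\<in>unit_disc. inverse (d z)) z = 1"
        using d(2) by simp
      ultimately show "(\<lambda>z\<in>unit_disc. d z) \<in> Units (Np p)"
        unfolding unit_Np_iff[OF p(1)] by blast
    qed
  next
    assume "\<exists>g\<in>Units (Np p). \<forall>z\<in>unit_disc. norm (g z) \<le> (\<Sum>i=1..n. norm (f i z))"
    then obtain g where gU: "g \<in> Units (Np p)"
      and g: "\<And>z. z \<in> unit_disc \<Longrightarrow> norm (g z) \<le> (\<Sum>i=1..n. norm (f i z))" by blast
    obtain e where e: "e \<in> carrier (Np p)" "\<And>z. z \<in> unit_disc \<Longrightarrow> g z * e z = 1"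
      using gU unfolding unit_Np_iff[OF p(1)] by blast
    \<comment> \<open>Slot 0 holds the inverse of g: a common divisor then also satisfies |d e|
      \<le> 1, that is |d| \<le> |g|.\<close>
    define a where "a i = (if i = 0 then e else f i)" for i
    have aI: "a ` {0..n} \<subseteq> carrier (Np p)"
      using e(1) f by (auto simp: a_def)
    obtain d where d: "d holomorphic_on unit_disc" "\<And>z. z \<in> unit_disc \<Longrightarrow> d z \<noteq> 0"
      "\<And>z. z \<in> unit_disc \<Longrightarrow> norm (d z) \<le> 1" "\<And>i z. i \<in> {0..n} \<Longrightarrow> z \<in> unit_disc \<Longrightarrow> norm (d z * a i z) \<le> 1"
      "log_mean_bounded p (\<lambda>z. inverse (d z))"
      using outer_common_divisor[OF aI finite_atLeastAtMost p(2)] by blast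
    have de: "norm (d z * e z) \<le> 1" if "z \<in> unit_disc" for z
      using d(4)[of 0 z] that by (simp add: a_def)
    have df: "norm (d z * f i z) \<le> 1" if "i \<in> {1..n}" "z \<in> unit_disc" for i z
      using d(4)[of i z] that by (auto simp: a_def)
    define h where "h i z = d z * f (Suc i) z" for i z
    \<comment> \<open>One factor d comes from |d| \<le> \<Sum> |f_i|, the other from passing to h_i
      = d f_i. Cauchy-Schwarz gives |d|^4 \<le> n \<Sum> |h_i|^2, and division by n absorbs the
      constant.\<close>
    define \<delta> where "\<delta> z = d z ^ 2 / of_nat n" for z
    have h: "h i holomorphic_on unit_disc" if "i < n" for i
      unfolding h_def by (intro holomorphic_intros d carrier_NpD(1)[OF f]) (use that in auto)
    have \<delta>: "\<delta> holomorphic_on unit_disc"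
      unfolding \<delta>_def by (intro holomorphic_intros d) (use assms(2) in auto)
    have \<delta>_le: "norm (\<delta> z) \<le> 1" if "z \<in> unit_disc" for z
    proof -
      have "norm (d z) ^ 2 \<le> 1" using d(3)[OF that] by (simp add: power_le_one)
      also have "1 \<le> real n" using assms(2) by simp
      finally show ?thesis using assms(2) by (simp add: \<delta>_def norm_divide norm_power divide_le_eq)
    qed
    have lower: "(norm (\<delta> z))\<^sup>2 \<le> (\<Sum>i<n. (norm (h i z))\<^sup>2)" if z: "z \<in> unit_disc" for z
    proof -
      have "norm (d z) \<le> norm (g z)"
      proof -
        have "norm (d z) = norm (d z * e z) * norm (g z)"
          using arg_cong[OF e(2)[OF z], of norm] by (simp add: norm_mult mult_ac)
        also have "\<dots> \<le> 1 * norm (g z)" using de[OF z] by (intro mult_right_mono) auto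
        finally show ?thesis by simp
      qed
      also have "\<dots> \<le> (\<Sum>i=1..n. norm (f i z))" by (rule g[OF z])
      also have "\<dots> = (\<Sum>i<n. norm (f (Suc i) z))"
        by (rule sum.reindex_bij_witness[of _ Suc "\<lambda>i. i - 1"]) auto
      finally have "norm (d z) * norm (d z) \<le> norm (d z) * (\<Sum>i<n. norm (f (Suc i) z))"
        by (intro mult_left_mono) auto
      then have "(norm (d z))\<^sup>2 \<le> (\<Sum>i<n. norm (h i z))"
        by (simp add: power2_eq_square h_def norm_mult sum_distrib_left)
      then have "((norm (d z))\<^sup>2)\<^sup>2 \<le> (\<Sum>i<n. norm (h i z))\<^sup>2" by (intro power_mono) auto
      also have "\<dots> \<le> (\<Sum>i<n. (norm (h i z))\<^sup>2) * n"
        using sum_squared_le_sum_of_squares[of "\<lambda>i. norm (h i z)" "{..<n}"] by simp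
      also have "\<dots> \<le> (\<Sum>i<n. (norm (h i z))\<^sup>2) * (real n)\<^sup>2"
        using assms(2) by (intro mult_left_mono sum_nonneg) (auto simp: power2_eq_square)
      finally show ?thesis
        using assms(2) by (simp add: \<delta>_def norm_divide norm_power power_divide divide_le_eq)
    qed
    have h_le: "norm (h i z) \<le> 1" if "i < n" "z \<in> unit_disc" for i z
      using df[of "Suc i" z] that by (simp add: h_def)
    have \<delta>_nz: "\<delta> z \<noteq> 0" if "z \<in> unit_disc" for z
      using d(2)[OF that] assms(2) by (simp add: \<delta>_def)
    have "\<exists>G B. (\<forall>i<n. G i holomorphic_on unit_disc) \<and>
      (\<forall>z\<in>unit_disc. (\<Sum>i<n. h i z * G i z) = \<delta> z ^ 6) \<and>
      (\<forall>i<n. \<forall>r\<in>{0<..<1}. cmean (\<lambda>z. (norm (G i z))\<^sup>2) r \<le> B)"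
      by (rule corona_H2) (use h \<delta> h_le \<delta>_le \<delta>_nz lower in blast)+
    then obtain G B where G: "\<And>i. i < n \<Longrightarrow> G i holomorphic_on unit_disc"
      "\<And>z. z \<in> unit_disc \<Longrightarrow> (\<Sum>i<n. h i z * G i z) = \<delta> z ^ 6"
      "\<And>i r. i < n \<Longrightarrow> r \<in> {0<..<1} \<Longrightarrow> cmean (\<lambda>z. (norm (G i z))\<^sup>2) r \<le> B"
      by blast
    \<comment> \<open>Here \<delta>^6 = d^12 / n^6, and \<open>h\<close> already contains one factor
      d; this leaves d^-11 and n^6.\<close>
    define u where "u i z = of_nat n ^ 6 * (inverse (d z) ^ 11 * G (i - 1) z)" for i z
    have cd: "continuous_on unit_disc (\<lambda>z. inverse (d z))"
      using d(2) holomorphic_on_imp_continuous_on[OF d(1)] by (intro continuous_intros) auto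
    show "\<exists>g. (\<forall>i\<in>{1..n}. g i \<in> carrier (Np p)) \<and> (\<forall>z\<in>unit_disc. (\<Sum>i=1..n. f i z * g i z) = 1)"
    proof (intro exI conjI ballI)
      fix i assume "i \<in> {1..n}"
      then have i: "i - 1 < n" by auto
      note cG = holomorphic_on_imp_continuous_on[OF G(1)[OF i]]
      have "log_mean_bounded p (\<lambda>z. inverse (d z) ^ 11 * G (i - 1) z)"
        by (intro log_mean_bounded_mult log_mean_bounded_power cd d cG p
            log_mean_bounded_H2[OF cG p(1) G(3)[OF i]] continuous_intros)
      then have "log_mean_bounded p (u i)"
        unfolding u_def
        by (intro log_mean_bounded_mult[OF continuous_on_const log_mean_bounded_const] continuous_intros cd cG p)
      moreover have "u i holomorphic_on unit_disc"
        unfolding u_def using d(2) by (intro holomorphic_intros d(1) G(1) i) auto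
      ultimately show "restrict (u i) unit_disc \<in> carrier (Np p)" by (intro restrict_in_carrier_Np)
    next
      fix z assume z: "z \<in> unit_disc"
      have nz: "d z \<noteq> 0" "of_nat n \<noteq> (0::complex)" using d(2)[OF z] assms(2) by auto
      have "(\<Sum>i=1..n. f i z * restrict (u i) unit_disc z) = (\<Sum>i<n. f (Suc i) z * u (Suc i) z)"
        using z by (intro sum.reindex_bij_witness[of _ Suc "\<lambda>i. i - 1"]) auto
      also have "\<dots> = (\<Sum>i<n. of_nat n ^ 6 * inverse (d z) ^ 12 * (h i z * G i z))"
      proof (rule sum.cong[OF refl])
        fix i
        have "inverse (d z) ^ 11 = inverse (d z) ^ 12 * d z"
          using nz(1) by (simp add: eval_nat_numeral)
        then show "f (Suc i) z * u (Suc i) z = of_nat n ^ 6 * inverse (d z) ^ 12 * (h i z * G i z)"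
          by (simp add: u_def h_def mult_ac)
      qed
      also have "\<dots> = of_nat n ^ 6 * inverse (d z) ^ 12 * \<delta> z ^ 6"
        by (simp only: sum_distrib_left[symmetric] G(2)[OF z])
      also have "\<dots> = 1"
        using nz by (simp add: \<delta>_def power_divide power_inverse flip: power_mult)
      finally show "(\<Sum>i=1..n. f i z * restrict (u i) unit_disc z) = 1" .
    qed
  qed
qed

end
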